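(* For every integer $n \geq 2$ there exist a bounded convex domain $\Omega \subset \mathbb{R}^n$, a measurable function $\rho : \Omega \to [0,1]$, and a convex function $u$, continuous on $\overline{\Omega}$, which is an Alexandrov solution of $$\det D^2 u = \rho \leq 1 \ \text{ in } \Omega, \qquad u|_{\partial\Omega} = 0,$$ such that $u \notin W^{2,1}_{\mathrm{loc}}(\Omega)$.
   Context: For a convex function $u$ on an open convex set $\Omega \subset \mathbb{R}^n$, the subdifferential at $x$ is $\partial u(x) = \{p \in \mathbb{R}^n : u(y) \geq u(x) + p\cdot(y-x) \text{ for all } y \in \Omega\}$, and the Monge-Ampère measure of $u$ is $Mu(E) = |\bigcup_{x\in E}\partial u(x)|$ (Lebesgue measure) for Borel $E \subset \Omega$. "$u$ is an Alexandrov solution of $\det D^2u = \rho$ in $\Omega$" means $Mu = \rho\,dx$ as Borel measures on $\Omega$. The statement $u \notin W^{2,1}_{\mathrm{loc}}(\Omega)$ means that the distributional Hessian $D^2u$ is not represented by a function in $L^1_{\mathrm{loc}}(\Omega)$. *)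

theory Defs
  imports "HOL-Analysis.Analysis"
begin

definition subdifferential :: "(real^'n) set \<Rightarrow> (real^'n \<Rightarrow> real) \<Rightarrow> real^'n \<Rightarrow> (real^'n) set" where
  "subdifferential \<Omega> u x = {p. \<forall>y\<in>\<Omega>. u y \<ge> u x + p \<bullet> (y - x)}"

text \<open>
  For \<open>u\<close> convex on an open convex \<open>\<Omega>\<close> and Borel \<open>E \<subseteq> \<Omega>\<close>, the union below is Lebesgue measurable
  but need not be Borel, hence the completed measure \<open>lebesgue\<close>.
\<close>
definition monge_ampere_measure ::
    "(real^'n) set \<Rightarrow> (real^'n \<Rightarrow> real) \<Rightarrow> (real^'n) set \<Rightarrow> ennreal" where
  "monge_ampere_measure \<Omega> u E = emeasure lebesgue (\<Union>x\<in>E. subdifferential \<Omega> u x)"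

text \<open>\<open>u\<close> is an Alexandrov solution of $\det D^2 u = \rho$ in \<open>\<Omega>\<close>; \<open>\<rho>\<close> is meant to be nonnegative.\<close>
definition alexandrov_solution ::
    "(real^'n) set \<Rightarrow> (real^'n \<Rightarrow> real) \<Rightarrow> (real^'n \<Rightarrow> real) \<Rightarrow> bool" where
  "alexandrov_solution \<Omega> \<rho> u \<longleftrightarrow>
     (\<forall>E\<in>sets borel. E \<subseteq> \<Omega> \<longrightarrow>
        monge_ampere_measure \<Omega> u E = (\<integral>\<^sup>+x\<in>E. ennreal (\<rho> x) \<partial>lebesgue))"

definition partial_deriv :: "'n::finite \<Rightarrow> (real^'n \<Rightarrow> real) \<Rightarrow> real^'n \<Rightarrow> real" where
  "partial_deriv i f x = frechet_derivative f (at x) (axis i 1)"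

fun partial_derivs :: "'n::finite list \<Rightarrow> (real^'n \<Rightarrow> real) \<Rightarrow> real^'n \<Rightarrow> real" where
  "partial_derivs [] f = f"
| "partial_derivs (i # is) f = partial_deriv i (partial_derivs is f)"

text \<open>
  Differentiability of every iterated partial derivative entails its continuity, so this is the
  usual class $C^\infty$ on the whole space.
\<close>
definition smooth :: "(real^'n \<Rightarrow> real) \<Rightarrow> bool" where
  "smooth f \<longleftrightarrow> (\<forall>is x. partial_derivs is f differentiable (at x))"

text \<open>$C_c^\infty(\Omega)$, each test function being extended by zero outside \<open>\<Omega>\<close>.\<close>
definition test_functions :: "(real^'n) set \<Rightarrow> (real^'n \<Rightarrow> real) set" where
  "test_functions \<Omega> =
     {\<phi>. smooth \<phi> \<and> compact (closure {x. \<phi> x \<noteq> 0}) \<and> closure {x. \<phi> x \<noteq> 0} \<subseteq> \<Omega>}"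

definition locally_integrable :: "(real^'n) set \<Rightarrow> (real^'n \<Rightarrow> 'b::euclidean_space) \<Rightarrow> bool" where
  "locally_integrable \<Omega> g \<longleftrightarrow> (\<forall>K. compact K \<and> K \<subseteq> \<Omega> \<longrightarrow> g absolutely_integrable_on K)"

text \<open>
  The matrix field \<open>H\<close> represents the distributional Hessian of \<open>u\<close> on \<open>\<Omega>\<close>. Two integrations by
  parts make the sign positive.
\<close>
definition represents_distributional_hessian ::
    "(real^'n) set \<Rightarrow> (real^'n \<Rightarrow> real) \<Rightarrow> (real^'n \<Rightarrow> real^'n^'n) \<Rightarrow> bool" where
  "represents_distributional_hessian \<Omega> u H \<longleftrightarrow>
     (\<forall>\<phi>\<in>test_functions \<Omega>. \<forall>i j.
        (LINT x:\<Omega>|lebesgue. u x * partial_deriv i (partial_deriv j \<phi>) x) =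
        (LINT x:\<Omega>|lebesgue. H x $ i $ j * \<phi> x))"

text \<open>
  $u \in W^{2,1}_{loc}(\Omega)$ for a locally integrable \<open>u\<close> (here always a continuous one). No separate
  condition on first derivatives is needed: they are locally integrable as soon as the
  distributional Hessian is.
\<close>
definition W21_loc :: "(real^'n) set \<Rightarrow> (real^'n \<Rightarrow> real) \<Rightarrow> bool" where
  "W21_loc \<Omega> u \<longleftrightarrow>
     (\<exists>H. locally_integrable \<Omega> H \<and> represents_distributional_hessian \<Omega> u H)"

end

theory Submission
  imports Defs
begin

text \<open>
  The partial Legendre transform \<open>w (p, y) = sup\<^sub>x (p x - u (x, y))\<close> turns \<open>0 \<le> det D\<^sup>2u \<le> 1\<close> into the linear
  conditions \<open>w\<^sub>y\<^sub>y \<le> 0 \<le> w\<^sub>p\<^sub>p + w\<^sub>y\<^sub>y\<close>, and \<open>\<partial>\<^sub>x\<^sub>x u\<close> is the image of Lebesgue measure under \<open>(p, y) \<mapsto> (w\<^sub>p, y)\<close>.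
  So \<open>\<partial>\<^sub>x\<^sub>x u\<close> has a singular part as soon as \<open>w\<^sub>p\<^sub>p\<close> vanishes on a set of positive measure, while \<open>w\<^sub>p\<close> may
  still be strictly increasing in \<open>p\<close>. Take
  \<open>w\<^sub>p\<^sub>p = \<Sum>n. b\<^sub>n (\<psi>\<^sub>n(y) \<beta>\<^sub>n(p) + 1 - \<psi>\<^sub>n(y))\<close>, where \<open>\<beta>\<^sub>n\<close> are rapidly oscillating periodic spikes of mean 1
  with small supports. For \<open>y\<^sup>2 \<le> 1\<close> only the spikes are present and \<open>w\<^sub>p\<^sub>p\<close> vanishes off their supports;
  for \<open>y\<^sup>2 > 1\<close> they are averaged out one scale after another. The averaged mass leaves room for a
  concave term \<open>- \<eta>(y)\<close> which makes \<open>u\<close> coercive, so that a sublevel set of \<open>u\<close> serves as the domain.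
  The remaining variables are added as half of a squared norm.
\<close>

section \<open>Change of variables in one coordinate\<close>

text \<open>Formally the transform gives u_xx = 1 / w_pp and det D^2 u = - w_yy / w_pp, so w_yy must
  vanish wherever w_pp does. A single spike density would vanish on whole intervals of p; there w_p
  would be constant, and p could not be recovered from (x, y). Infinitely many scales leave a common
  zero set that contains no interval but still has positive measure, like a fat Cantor set. The
  obstacle is that w has to be affine in y over this set for y^2 \<le> 1, while bounded sublevel
  sets need w to fall in y at infinity. Replacing \<beta>_n by its mean costs the term b_n
  \<psi>_n'' k_n in w_yy, where k_n'' = \<beta>_n - 1. Rapid oscillation makes k_n small, but the
  term has no sign and must be paid for by positive w_pp at the same point. Hence the finest scales
  are averaged first as y^2 grows beyond 1: when \<psi>_n leaves 1, \<psi>_(n+1) is already 0 and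
  the mass b_(n+1) is available at every p. Half of the averaged mass R(y) covers these errors, the
  other half is spent on \<eta>'' = R / 2, so that - R \<le> w_yy \<le> 0 and R \<le> w_pp.\<close>

text \<open>
  The change-of-variables theorem and Sard's lemma of HOL-Analysis require an index type of class
  \<open>wellorder\<close>. The copy \<open>'a wo\<close> of a finite type \<open>'a\<close> carries an arbitrary well-order.
\<close>
typedef 'a wo = "UNIV :: 'a set" ..

instance wo :: (finite) finite
proof
  have "UNIV = range (Abs_wo :: 'a \<Rightarrow> 'a wo)"
    by (metis Rep_wo_inverse surjI)
  then show "finite (UNIV :: 'a wo set)" by (metis finite finite_imageI)
qed

definition wo_index :: "'a::finite wo \<Rightarrow> nat" where
  "wo_index x = to_nat_on UNIV (Rep_wo x)"

lemma wo_index_inject: "wo_index x = wo_index y \<longleftrightarrow> x = y"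
  unfolding wo_index_def by (simp add: Rep_wo_inject countable_finite)

instantiation wo :: (finite) wellorder
begin
definition "x \<le> y \<longleftrightarrow> wo_index x \<le> wo_index y"
definition "x < y \<longleftrightarrow> wo_index x < wo_index y"
instance
proof
  fix P :: "'a wo \<Rightarrow> bool" and a
  assume step: "\<And>x. (\<And>y. y < x \<Longrightarrow> P y) \<Longrightarrow> P x"
  show "P a"
  proof (induction "wo_index a" arbitrary: a rule: less_induct)
    case less
    show ?case by (rule step, rule less) (simp add: less_wo_def)
  qed
qed (auto simp: less_eq_wo_def less_wo_def wo_index_inject)
end

section \<open>Transfer of integrals between an index type and its well-ordered copy\<close>

definition to_wo :: "real^'n::finite \<Rightarrow> real^('n wo)" where
  "to_wo x = (\<chi> k. x $ Rep_wo k)"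

definition of_wo :: "real^('n wo) \<Rightarrow> real^'n::finite" where
  "of_wo x = (\<chi> k. x $ Abs_wo k)"

lemma of_to_wo [simp]: "of_wo (to_wo x) = x" and to_of_wo [simp]: "to_wo (of_wo y) = y"
  by (simp_all add: of_wo_def to_wo_def vec_eq_iff Abs_wo_inverse Rep_wo_inverse)

lemma linear_to_wo: "linear to_wo" and linear_of_wo: "linear of_wo"
  by (auto simp: linear_iff to_wo_def of_wo_def vec_eq_iff)

lemma bij_Rep_wo: "bij (Rep_wo :: 'n wo \<Rightarrow> 'n)"
  by (metis Abs_wo_inverse Rep_wo_inverse UNIV_I bijI')

lemma to_wo_cbox: "to_wo ` cbox a b = cbox (to_wo a) (to_wo b)"
proof -
  have 1: "to_wo x \<in> cbox (to_wo a) (to_wo b) \<longleftrightarrow> x \<in> cbox a b" for x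
    unfolding mem_box_cart to_wo_def by (simp, metis Abs_wo_inverse UNIV_I)
  show ?thesis
  proof (intro set_eqI iffI)
    fix y assume "y \<in> cbox (to_wo a) (to_wo b)"
    then show "y \<in> to_wo ` cbox a b"
      using 1[of "of_wo y"] by (intro image_eqI[of _ _ "of_wo y"]) auto
  qed (use 1 in auto)
qed

lemma of_wo_cbox: "of_wo ` cbox c d = cbox (of_wo c) (of_wo d)"
  using arg_cong[OF to_wo_cbox[of "of_wo c" "of_wo d"], of "image of_wo"] by (simp add: image_image)

lemmas wo_cbox = to_wo_cbox of_wo_cbox

text \<open>The product of the side lengths is merely reindexed along the bijection
  \<open>Rep_wo\<close>.\<close>

lemma content_wo: "measure lborel (cbox (of_wo c) (of_wo d)) = measure lborel (cbox c d)"
proof (cases "cbox c d = {}")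
  case True
  then have "cbox (of_wo c) (of_wo d) = {}" by (metis wo_cbox(2) image_empty)
  then show ?thesis using True by simp
next
  case False
  then have "cbox (of_wo c) (of_wo d) \<noteq> {}" by (metis wo_cbox(2) image_is_empty)
  then have "measure lborel (cbox (of_wo c) (of_wo d)) = (\<Prod>k\<in>UNIV. of_wo d $ k - of_wo c $ k)"
    by (simp add: content_cbox_cart)
  also have "\<dots> = (\<Prod>k\<in>UNIV. d $ k - c $ k)"
    using prod.reindex_bij_betw[OF bij_Rep_wo, of "\<lambda>k. of_wo d $ k - of_wo c $ k"]
    by (simp add: of_wo_def Rep_wo_inverse)
  finally show ?thesis using False by (simp add: content_cbox_cart)
qed

lemma has_integral_wo_cbox:
  fixes f :: "real^'n::finite \<Rightarrow> real"
  assumes "(f has_integral I) (cbox a b)"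
  shows "((\<lambda>x. f (of_wo x)) has_integral I) (cbox (to_wo a) (to_wo b))"
proof -
  have "((\<lambda>x. f (of_wo x)) has_integral (1 / 1) *\<^sub>R I) (to_wo ` cbox a b)"
  proof (rule has_integral_twiddle[where g=of_wo and r=1])
    show "\<exists>w z. of_wo ` cbox u v = cbox w z" for u v :: "real^('n wo)" using wo_cbox(2) by blast
    show "\<exists>w z. to_wo ` cbox u v = cbox w z" for u v :: "real^'n" using wo_cbox(1) by blast
    show "measure lborel (of_wo ` cbox u v) = 1 * measure lborel (cbox u v)" for u v :: "real^('n wo)"
      by (simp add: wo_cbox content_wo)
    show "isCont of_wo x" for x :: "real^('n wo)"
      using linear_continuous_at linear_conv_bounded_linear linear_of_wo by blast
  qed (use assms in auto)
  then show ?thesis by (simp add: wo_cbox)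
qed

lemma norm_to_wo: "norm (to_wo x) = norm x"
proof -
  have "(\<Sum>k\<in>UNIV. (x $ Rep_wo k)\<^sup>2) = (\<Sum>k\<in>UNIV. (x $ k)\<^sup>2)"
    by (rule sum.reindex_bij_betw[OF bij_Rep_wo])
  then show ?thesis by (simp add: norm_vec_def L2_set_def to_wo_def)
qed

lemma norm_of_wo: "norm (of_wo x) = norm x"
  by (metis norm_to_wo to_of_wo)

lemma has_integral_wo_cbox_iff:
  fixes f :: "real^'n::finite \<Rightarrow> real"
  shows "((\<lambda>x. f (of_wo x)) has_integral I) (cbox (to_wo a) (to_wo b)) \<longleftrightarrow> (f has_integral I) (cbox a b)"
proof 
  assume *: "((\<lambda>x. f (of_wo x)) has_integral I) (cbox (to_wo a) (to_wo b))"
  have "((\<lambda>x. f (of_wo (to_wo x))) has_integral (1 / 1) *\<^sub>R I) (of_wo ` cbox (to_wo a) (to_wo b))"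
  proof (rule has_integral_twiddle[where g=to_wo and r=1])
    show "\<exists>w z. to_wo ` cbox u v = cbox w z" for u v :: "real^'n" using wo_cbox(1) by blast
    show "\<exists>w z. of_wo ` cbox u v = cbox w z" for u v :: "real^('n wo)" using wo_cbox(2) by blast
    show "measure lborel (to_wo ` cbox u v) = 1 * measure lborel (cbox u v)" for u v :: "real^'n"
      using content_wo[of "to_wo u" "to_wo v"] by (simp add: wo_cbox)
    show "isCont to_wo x" for x :: "real^'n"
      using linear_continuous_at linear_conv_bounded_linear linear_to_wo by blast
  qed (use * in auto)
  then show "(f has_integral I) (cbox a b)" by (simp add: wo_cbox)
qed (rule has_integral_wo_cbox)

text \<open>Integrals over the whole space are tested on boxes that contain a large ball. The
  reindexing is an isometry that maps boxes onto boxes, so both sides impose the same condition on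
  corresponding boxes.\<close>

lemma has_integral_wo:
  fixes f :: "real^'n::finite \<Rightarrow> real"
  shows "((\<lambda>x. f (of_wo x)) has_integral I) UNIV \<longleftrightarrow> (f has_integral I) UNIV"
proof -
  have ball: "ball 0 B \<subseteq> cbox (to_wo a) (to_wo b) \<longleftrightarrow> ball 0 B \<subseteq> cbox a b" for B and a b :: "real^'n"
  proof -
    have eq: "(ball 0 B :: (real^('n wo)) set) = to_wo ` ball 0 B"
      by (auto simp: image_iff norm_to_wo intro!: bexI[of _ "of_wo _"] simp: norm_of_wo)
    have "ball 0 B \<subseteq> cbox (to_wo a) (to_wo b) \<longleftrightarrow> to_wo ` ball 0 B \<subseteq> to_wo ` cbox a b"
      by (simp only: wo_cbox eq)
    also have "\<dots> \<longleftrightarrow> ball 0 B \<subseteq> cbox a b"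
      by (rule inj_image_subset_iff[OF inj_on_inverseI[of _ of_wo]]) simp
    finally show ?thesis .
  qed
  have all: "(\<forall>c d. P c d) \<longleftrightarrow> (\<forall>a b. P (to_wo a) (to_wo b))" for P :: "real^('n wo) \<Rightarrow> real^('n wo) \<Rightarrow> bool"
  proof -
    have "P c d" if "\<forall>a b. P (to_wo a) (to_wo b)" for c d
      using that[rule_format, of "of_wo c" "of_wo d"] by simp
    then show ?thesis by blast
  qed
  have "(\<forall>a b. ball 0 B \<subseteq> cbox a b \<longrightarrow> (\<exists>z. ((\<lambda>x. f (of_wo x)) has_integral z) (cbox a b) \<and> norm (z - I) < e))
      \<longleftrightarrow> (\<forall>a b. ball 0 B \<subseteq> cbox a b \<longrightarrow> (\<exists>z. (f has_integral z) (cbox a b) \<and> norm (z - I) < e))" for e B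
    by (subst all) (simp add: ball has_integral_wo_cbox_iff)
  then show ?thesis
    unfolding has_integral'[where S=UNIV] by simp
qed

lemma has_integral_wo_on:
  fixes f :: "real^'n::finite \<Rightarrow> real"
  shows "((\<lambda>x. f (of_wo x)) has_integral I) (to_wo ` S) \<longleftrightarrow> (f has_integral I) S"
proof -
  have "of_wo x \<in> S \<longleftrightarrow> x \<in> to_wo ` S" for x
    by (auto simp: image_iff) (metis to_of_wo)
  then have "((\<lambda>x. f (of_wo x)) has_integral I) (to_wo ` S) \<longleftrightarrow>
      ((\<lambda>x. (\<lambda>y. if y \<in> S then f y else 0) (of_wo x)) has_integral I) UNIV"
    by (subst has_integral_restrict_UNIV[symmetric]) simp
  then show ?thesis
    using has_integral_wo[of "\<lambda>y. if y \<in> S then f y else 0" I] has_integral_restrict_UNIV[of S f I] by blast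
qed

lemma absolutely_integrable_wo_on:
  fixes f :: "real^'n::finite \<Rightarrow> real"
  shows "(\<lambda>x. f (of_wo x)) absolutely_integrable_on (to_wo ` S) \<longleftrightarrow> f absolutely_integrable_on S"
  using has_integral_wo_on[of f _ S] has_integral_wo_on[of "\<lambda>x. norm (f x)" _ S]
  unfolding absolutely_integrable_on_def integrable_on_def by auto

lemma integral_wo_on:
  fixes f :: "real^'n::finite \<Rightarrow> real"
  shows "integral (to_wo ` S) (\<lambda>x. f (of_wo x)) = integral S f"
  using has_integral_wo_on[of f _ S] unfolding integral_def integrable_on_def by simp

lemma negligible_wo: "negligible (to_wo ` S) \<longleftrightarrow> negligible S"
proof -
  have "indicat_real (to_wo ` S) = (\<lambda>x. indicat_real S (of_wo x))"
    by (auto simp: fun_eq_iff indicator_def image_iff) (metis to_of_wo)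
  then show ?thesis unfolding negligible_UNIV by (simp add: has_integral_wo)
qed

section \<open>Maps that replace a single coordinate\<close>

text \<open>The vector \<open>c\<close> is the combination of the rows of the identity matrix with
  coefficients \<open>c\<close>, so Cramer's lemma reads off \<open>c $ i\<close>. The matrix is the
  Jacobian of a map that changes one coordinate.\<close>

lemma det_replace_row:
  fixes c :: "real^'n::finite"
  shows "det (\<chi> k l. if k = i then c $ l else if k = l then 1 else 0) = c $ i"
proof -
  have "(\<Sum>k\<in>UNIV. c $ k *s row k (mat 1 :: real^'n^'n)) = c"
    by (simp add: vec_eq_iff row_def mat_def mult_delta_right)
  then have "(\<chi> k. if k = i then \<Sum>k\<in>UNIV. c $ k *s row k (mat 1 :: real^'n^'n) else row k (mat 1)) = (\<chi> k l. if k = i then c $ l else if k = l then 1 else 0)"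
    by (simp add: vec_eq_iff row_def mat_def)
  then show ?thesis using cramer_lemma_transpose[of i c "mat 1 :: real^'n^'n"] by simp
qed

definition coord_map :: "'n \<Rightarrow> (real^'n \<Rightarrow> real) \<Rightarrow> real^'n \<Rightarrow> real^'n" where
  "coord_map i \<gamma> x = (\<chi> k. if k = i then \<gamma> x else x $ k)"

lemma has_derivative_coord_map:
  assumes "(\<gamma> has_derivative \<gamma>') (at x within S)"
  shows "(coord_map i \<gamma> has_derivative (\<lambda>h. coord_map i (\<lambda>_. \<gamma>' h) h)) (at x within S)"
proof -
  have "((\<lambda>x. coord_map i \<gamma> x $ k) has_derivative (\<lambda>h. coord_map i (\<lambda>_. \<gamma>' h) h $ k)) (at x within S)" for k
    using assms by (cases "k = i") (auto simp: coord_map_def intro!: bounded_linear_imp_has_derivative bounded_linear_vec_nth)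
  then show ?thesis
    unfolding has_derivative_componentwise_within[of "coord_map i \<gamma>"]
    by (auto simp: Basis_vec_def inner_axis)
qed

text \<open>Differentiability is asked within \<open>S\<close> only, and injectivity only where
  integrals are transformed. The same locale thus serves the degenerate set, by Sard's lemma, and
  the set where the map is injective.\<close>

locale coord_change =
  fixes i :: "'n::finite" and \<gamma> :: "real^'n \<Rightarrow> real" and \<gamma>' :: "real^'n \<Rightarrow> real^'n \<Rightarrow> real" and S :: "(real^'n) set"
  assumes S: "S \<in> sets borel"
    and der: "\<And>x. x \<in> S \<Longrightarrow> (\<gamma> has_derivative \<gamma>' x) (at x within S)"
begin

definition gw :: "real^('n wo) \<Rightarrow> real^('n wo)" where
  "gw x = to_wo (coord_map i \<gamma> (of_wo x))"

definition gw' :: "real^('n wo) \<Rightarrow> real^('n wo) \<Rightarrow> real^('n wo)" where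
  "gw' x h = to_wo (coord_map i (\<lambda>_. \<gamma>' (of_wo x) (of_wo h)) (of_wo h))"

lemma gw_derivative:
  assumes "x \<in> to_wo ` S"
  shows "(gw has_derivative gw' x) (at x within to_wo ` S)"
proof -
  have x: "of_wo x \<in> S" using assms by auto
  have im: "of_wo ` to_wo ` S = S" by (auto simp: image_iff)
  have 1: "(of_wo has_derivative of_wo) (at x within to_wo ` S)"
    by (rule bounded_linear_imp_has_derivative[OF linear_conv_bounded_linear[THEN iffD1, OF linear_of_wo]])
  have 2: "(to_wo has_derivative to_wo) (at y within T)" for y :: "real^'n" and T
    by (rule bounded_linear_imp_has_derivative[OF linear_conv_bounded_linear[THEN iffD1, OF linear_to_wo]])
  have 3: "(coord_map i \<gamma> has_derivative (\<lambda>h. coord_map i (\<lambda>_. \<gamma>' (of_wo x) h) h)) (at (of_wo x) within S)"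
    by (rule has_derivative_coord_map[OF der[OF x]])
  have "((\<lambda>y. to_wo (coord_map i \<gamma> (of_wo y))) has_derivative gw' x) (at x within to_wo ` S)"
    unfolding gw'_def
  proof (rule has_derivative_in_compose[OF _ 2])
    show "((\<lambda>y. coord_map i \<gamma> (of_wo y)) has_derivative (\<lambda>h. coord_map i (\<lambda>_. \<gamma>' (of_wo x) (of_wo h)) (of_wo h))) (at x within to_wo ` S)"
      by (rule has_derivative_in_compose[OF 1]) (simp only: im 3)
  qed
  then show ?thesis by (simp add: gw_def[abs_def])
qed

lemma det_gw':
  assumes "x \<in> S"
  shows "det (matrix (gw' (to_wo x))) = \<gamma>' x (axis i 1)"
proof -
  have ax: "of_wo (axis l 1) = (axis (Rep_wo l) 1 :: real^'n)" for l :: "'n wo"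
    by (auto simp: of_wo_def axis_def vec_eq_iff Rep_wo_inverse Abs_wo_inverse)
  have rep: "Rep_wo k = i \<longleftrightarrow> k = Abs_wo i" for k by (metis Abs_wo_inverse Rep_wo_inverse UNIV_I)
  have gw': "gw' (to_wo x) h = to_wo (coord_map i (\<lambda>_. \<gamma>' x (of_wo h)) (of_wo h))" for h
    by (simp add: gw'_def)
  have gw'k: "gw' (to_wo x) h $ k = (if k = Abs_wo i then \<gamma>' x (of_wo h) else h $ k)" for h k
    unfolding gw' by (simp add: to_wo_def of_wo_def coord_map_def rep Rep_wo_inverse)
  have "matrix (gw' (to_wo x)) = (\<chi> k l. if k = Abs_wo i then (\<chi> l. \<gamma>' x (axis (Rep_wo l) 1)) $ l else if k = l then 1 else 0)"
    unfolding matrix_def gw'k ax by (simp add: vec_eq_iff axis_def)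
  then show ?thesis by (simp only: det_replace_row) (simp add: Abs_wo_inverse)
qed

lemma to_wo_S: "to_wo ` S \<in> sets lebesgue"
proof -
  have "to_wo ` S = of_wo -` S \<inter> space borel"
    by (auto simp: image_iff) (metis to_of_wo)
  moreover have "(of_wo :: real^('n wo) \<Rightarrow> real^'n) \<in> borel_measurable borel"
    using linear_of_wo by (intro borel_measurable_continuous_onI linear_continuous_on) (simp add: linear_conv_bounded_linear)
  ultimately have "to_wo ` S \<in> sets borel" using S measurable_sets by metis
  then show ?thesis by simp
qed

lemma gw_image: "gw ` to_wo ` S = to_wo ` coord_map i \<gamma> ` S"
  by (simp add: gw_def image_image)

text \<open>A vanishing \<open>i\<close>-th partial derivative of \<open>\<gamma>\<close> makes the
  Jacobian determinant zero, so the rank drops and Sard's lemma applies.\<close>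

lemma negligible_image:
  assumes 0: "\<And>x. x \<in> S \<Longrightarrow> \<gamma>' x (axis i 1) = 0"
  shows "negligible (coord_map i \<gamma> ` S)"
proof -
  have "negligible (gw ` to_wo ` S)"
  proof (rule baby_Sard)
    fix x assume x: "x \<in> to_wo ` S"
    then show "(gw has_derivative gw' x) (at x within to_wo ` S)" by (rule gw_derivative)
    show "rank (matrix (gw' x)) < CARD('n wo)"
      using x 0 det_gw' det_eq_0_rank by (metis image_iff)
  qed simp
  then show ?thesis by (simp add: gw_image negligible_wo)
qed

lemma has_absolute_integral:
  fixes f :: "real^'n \<Rightarrow> real"
  assumes inj: "inj_on (coord_map i \<gamma>) S"
  shows "(\<lambda>x. \<bar>\<gamma>' x (axis i 1)\<bar> * f (coord_map i \<gamma> x)) absolutely_integrable_on S \<and>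
      integral S (\<lambda>x. \<bar>\<gamma>' x (axis i 1)\<bar> * f (coord_map i \<gamma> x)) = b
    \<longleftrightarrow> f absolutely_integrable_on (coord_map i \<gamma> ` S) \<and> integral (coord_map i \<gamma> ` S) f = b"
proof -
  have injw: "inj_on gw (to_wo ` S)"
    using inj unfolding inj_on_def gw_def by (metis image_iff of_to_wo)
  have 1: "g absolutely_integrable_on to_wo ` S \<and> integral (to_wo ` S) g = b
     \<longleftrightarrow> h absolutely_integrable_on to_wo ` S \<and> integral (to_wo ` S) h = b"
    if "\<And>x. x \<in> to_wo ` S \<Longrightarrow> g x = h x" for g h :: "real^('n wo) \<Rightarrow> real"
    using Henstock_Kurzweil_Integration.integral_cong[of "to_wo ` S" g h, OF that]
      set_integrable_cong[of lebesgue lebesgue "to_wo ` S" "to_wo ` S" g h] that by simp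
  \<comment> \<open>The change-of-variables theorem is about vector-valued integrands; scalars are
    passed through \<open>real^1\<close>.\<close>
  have "(\<lambda>x. \<bar>det (matrix (gw' x))\<bar> *\<^sub>R vec (f (of_wo (gw x))) :: real^1) absolutely_integrable_on (to_wo ` S) \<and>
      integral (to_wo ` S) (\<lambda>x. \<bar>det (matrix (gw' x))\<bar> *\<^sub>R vec (f (of_wo (gw x)))) = (vec b :: real^1)
    \<longleftrightarrow> (\<lambda>x. vec (f (of_wo x)) :: real^1) absolutely_integrable_on (gw ` to_wo ` S) \<and>
      integral (gw ` to_wo ` S) (\<lambda>x. vec (f (of_wo x))) = (vec b :: real^1)"
    by (rule has_absolute_integral_change_of_variables[OF to_wo_S gw_derivative injw])
  then have *: "(\<lambda>x. \<bar>det (matrix (gw' x))\<bar> * f (of_wo (gw x))) absolutely_integrable_on (to_wo ` S) \<and>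
      integral (to_wo ` S) (\<lambda>x. \<bar>det (matrix (gw' x))\<bar> * f (of_wo (gw x))) = b
    \<longleftrightarrow> (\<lambda>x. f (of_wo x)) absolutely_integrable_on (gw ` to_wo ` S) \<and>
      integral (gw ` to_wo ` S) (\<lambda>x. f (of_wo x)) = b"
    by (simp add: absolutely_integrable_on_1_iff integral_on_1_eq)
  have **: "\<bar>det (matrix (gw' x))\<bar> * f (of_wo (gw x)) = \<bar>\<gamma>' (of_wo x) (axis i 1)\<bar> * f (coord_map i \<gamma> (of_wo x))"
    if "x \<in> to_wo ` S" for x
    using that by (auto simp: det_gw' gw_def)
  show ?thesis
    using * 1[OF **] absolutely_integrable_wo_on[of _ f] integral_wo_on[of _ f]
      absolutely_integrable_wo_on[of S "\<lambda>x. \<bar>\<gamma>' x (axis i 1)\<bar> * f (coord_map i \<gamma> x)"]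
      integral_wo_on[of S "\<lambda>x. \<bar>\<gamma>' x (axis i 1)\<bar> * f (coord_map i \<gamma> x)"]
    unfolding gw_image by simp
qed

end

section \<open>Test functions\<close>

text \<open>A syntactic class that is closed under partial derivatives by induction. The rule
  \<open>comp\<close> takes a whole sequence \<open>D\<close> of successive derivatives, because
  differentiating \<open>D m\<close> composed with \<open>f\<close> produces
  \<open>D (Suc m)\<close>, which must again be admissible.\<close>

inductive smooth_alg :: "(real^'n \<Rightarrow> real) \<Rightarrow> bool" where
  coord: "smooth_alg (\<lambda>x. x $ k)"
| const: "smooth_alg (\<lambda>x. c)"
| add: "smooth_alg f \<Longrightarrow> smooth_alg g \<Longrightarrow> smooth_alg (\<lambda>x. f x + g x)"
| mult: "smooth_alg f \<Longrightarrow> smooth_alg g \<Longrightarrow> smooth_alg (\<lambda>x. f x * g x)"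
| comp: "smooth_alg f \<Longrightarrow> (\<And>m t. (D m has_real_derivative D (Suc m) t) (at t)) \<Longrightarrow>
    smooth_alg (\<lambda>x. D (m::nat) (f x))"

lemma partial_deriv_eqI:
  assumes "\<And>x. (f has_derivative f' x) (at x)"
  shows "partial_deriv i f = (\<lambda>x. f' x (axis i 1))"
proof
  fix x
  show "partial_deriv i f x = f' x (axis i 1)"
    using frechet_derivative_at[OF assms, of x] by (simp add: partial_deriv_def)
qed

lemma smooth_alg_step:
  fixes f :: "real^'n \<Rightarrow> real"
  assumes "smooth_alg f"
  shows "(\<forall>x. f differentiable at x) \<and> (\<forall>i. smooth_alg (partial_deriv i f))"
  using assms
proof induction
  case (coord k)
  have d: "((\<lambda>x. x $ k) has_derivative (\<lambda>h. h $ k)) (at x)" for x :: "real^'n"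
    by (rule bounded_linear_imp_has_derivative[OF bounded_linear_vec_nth])
  show ?case
    using d by (auto simp: partial_deriv_eqI[OF d] differentiable_def intro: smooth_alg.const)
next
  case (const c)
  have d: "((\<lambda>x. c) has_derivative (\<lambda>h. 0)) (at x)" for x :: "real^'n"
    by (rule has_derivative_const)
  show ?case
    using d by (auto simp: partial_deriv_eqI[OF d] intro: smooth_alg.const)
next
  case (add f g)
  then have d: "(f has_derivative frechet_derivative f (at x)) (at x)"
      "(g has_derivative frechet_derivative g (at x)) (at x)" for x
    by (auto simp: frechet_derivative_works)
  note D = has_derivative_add[OF d]
  have "partial_deriv i (\<lambda>x. f x + g x) = (\<lambda>x. partial_deriv i f x + partial_deriv i g x)" for i
    unfolding partial_deriv_eqI[OF D] by (simp add: partial_deriv_def)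
  moreover have "(\<lambda>x. f x + g x) differentiable at x" for x using D unfolding differentiable_def by blast
  ultimately show ?case using add.IH by (auto intro: smooth_alg.add)
next
  case (mult f g)
  then have d: "(f has_derivative frechet_derivative f (at x)) (at x)"
      "(g has_derivative frechet_derivative g (at x)) (at x)" for x
    by (auto simp: frechet_derivative_works)
  note D = has_derivative_mult[OF d]
  have "partial_deriv i (\<lambda>x. f x * g x) = (\<lambda>x. f x * partial_deriv i g x + partial_deriv i f x * g x)" for i
    unfolding partial_deriv_eqI[OF D] by (simp add: partial_deriv_def)
  moreover have "(\<lambda>x. f x * g x) differentiable at x" for x using D unfolding differentiable_def by blast
  ultimately show ?case using mult by (auto intro!: smooth_alg.add smooth_alg.mult)
next
  case (comp f D m)
  then have d: "(f has_derivative frechet_derivative f (at x)) (at x)" for x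
    by (auto simp: frechet_derivative_works)
  have D: "((\<lambda>x. D m (f x)) has_derivative (\<lambda>h. D (Suc m) (f x) * frechet_derivative f (at x) h)) (at x)" for x
    using has_derivative_compose[OF d comp(2)[of m, unfolded has_field_derivative_def]] .
  have "partial_deriv i (\<lambda>x. D m (f x)) = (\<lambda>x. D (Suc m) (f x) * partial_deriv i f x)" for i
    unfolding partial_deriv_eqI[OF D] by (simp add: partial_deriv_def)
  moreover have "(\<lambda>x. D m (f x)) differentiable at x" for x using D unfolding differentiable_def by blast
  moreover have "smooth_alg (\<lambda>x. D (Suc m) (f x))" by (rule smooth_alg.comp[where D=D, OF comp(1,2)])
  ultimately show ?case using comp.IH by (auto intro!: smooth_alg.mult)
qed

lemma smooth_alg_smooth:
  assumes "smooth_alg f"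
  shows "smooth f"
proof -
  have "smooth_alg (partial_derivs is f)" for "is"
    using assms smooth_alg_step by (induction "is") auto
  then show ?thesis
    unfolding smooth_def using smooth_alg_step by blast
qed

lemma smooth_alg_sum: "finite I \<Longrightarrow> (\<And>k. k \<in> I \<Longrightarrow> smooth_alg (f k)) \<Longrightarrow> smooth_alg (\<lambda>x. \<Sum>k\<in>I. f k x)"
  by (induction I rule: finite_induct) (auto intro: smooth_alg.intros)

lemma smooth_alg_prod: "finite I \<Longrightarrow> (\<And>k. k \<in> I \<Longrightarrow> smooth_alg (f k)) \<Longrightarrow> smooth_alg (\<lambda>x. \<Prod>k\<in>I. f k x)"
  by (induction I rule: finite_induct) (auto intro: smooth_alg.intros)

section \<open>Flat exponentials and bump functions\<close>

text \<open>For \<open>k = 0\<close> this is the classical smooth function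
  \<open>exp (- (1 / t))\<close> that is flat at 0. The powers of \<open>1 / t\<close> are the
  factors that differentiation produces.\<close>

definition flat_exp :: "nat \<Rightarrow> real \<Rightarrow> real" where
  "flat_exp k t = (if t > 0 then (1 / t) ^ k * exp (- (1 / t)) else 0)"

lemma flat_exp_lim: "((\<lambda>t. flat_exp k t) \<longlongrightarrow> 0) (at 0)"
proof -
  have "((\<lambda>t. (1 / t) ^ k * exp (- (1 / t))) \<longlongrightarrow> 0) (at_right (0::real))"
  proof -
    have "((\<lambda>x. x ^ k / exp x) \<longlongrightarrow> 0) (at_top :: real filter)"
      by (rule tendsto_power_div_exp_0)
    then have "((\<lambda>t. (inverse t) ^ k / exp (inverse t)) \<longlongrightarrow> 0) (at_right (0::real))"
      by (rule filterlim_compose[OF _ filterlim_inverse_at_top_right])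
    then show ?thesis by (simp add: exp_minus field_simps)
  qed
  then have "(flat_exp k \<longlongrightarrow> 0) (at_right 0)"
    by (rule Lim_transform_eventually)
       (auto simp: flat_exp_def eventually_at_right_field intro!: exI[of _ 1])
  moreover have "(flat_exp k \<longlongrightarrow> 0) (at_left 0)"
    by (rule Lim_transform_eventually[OF tendsto_const])
       (auto simp: flat_exp_def eventually_at_left_field intro!: exI[of _ "-1"])
  ultimately show ?thesis by (simp add: filterlim_at_split)
qed

lemma flat_exp_deriv:
  "(flat_exp k has_real_derivative flat_exp (k + 2) t - real k * flat_exp (k + 1) t) (at t)"
proof -
  consider "t > 0" | "t < 0" | "t = 0" by linarith
  then show ?thesis
  proof cases
    case 1
    have d: "((\<lambda>t. 1 / t) has_real_derivative - ((1 / t)\<^sup>2)) (at t)"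
      using 1 by (auto intro!: derivative_eq_intros simp: power2_eq_square field_simps)
    have alg: "e * - (- s\<^sup>2) * s ^ k + real k * (- s\<^sup>2 * s ^ (k - Suc 0)) * e
        = s ^ (k + 2) * e - real k * (s ^ (k + 1) * e)" for s e :: real
      by (cases k) (simp_all add: algebra_simps power2_eq_square)
    have "((\<lambda>t. (1 / t) ^ k * exp (- (1 / t))) has_real_derivative
        flat_exp (k + 2) t - real k * flat_exp (k + 1) t) (at t)"
      using DERIV_mult[OF DERIV_power[OF d, of k] DERIV_fun_exp[OF DERIV_minus[OF d]]] 1
        alg[of "exp (- (1 / t))" "1 / t"]
      by (simp add: flat_exp_def)
    then show ?thesis
      by (rule has_field_derivative_transform_within_open[of _ _ _ "{0<..}"])
         (use 1 in \<open>auto simp: flat_exp_def\<close>)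
  next
    case 2
    have "((\<lambda>t. 0) has_real_derivative flat_exp (k + 2) t - real k * flat_exp (k + 1) t) (at t)"
      using 2 by (simp add: flat_exp_def)
    then show ?thesis
      by (rule has_field_derivative_transform_within_open[of _ _ _ "{..<0}"])
         (use 2 in \<open>auto simp: flat_exp_def\<close>)
  next
    case 3
    \<comment> \<open>The difference quotient at 0 is \<open>flat_exp (k + 1)\<close>, which tends
      to 0.\<close>
    have "((\<lambda>h. (flat_exp k (0 + h) - flat_exp k 0) / h) \<longlongrightarrow> 0) (at 0)"
      by (rule Lim_transform_eventually[OF flat_exp_lim[of "k+1"]])
         (auto simp: flat_exp_def eventually_at_filter)
    then show ?thesis
      using 3 by (simp add: DERIV_def flat_exp_def)
  qed
qed

text \<open>A pair \<open>(k, c)\<close> stands for the summand \<open>c * flat_exp k\<close>, and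
  list \<open>m\<close> encodes the \<open>m\<close>-th derivative of \<open>flat_exp 0\<close>.
  This yields the single sequence of functions that the rule \<open>comp\<close> of
  \<open>smooth_alg\<close> expects.\<close>

fun flat_exp_comb :: "nat \<Rightarrow> (nat \<times> real) list" where
  "flat_exp_comb 0 = [(0, 1)]"
| "flat_exp_comb (Suc m) = concat (map (\<lambda>(k, c). [(k + 2, c), (k + 1, - c * real k)]) (flat_exp_comb m))"

definition flat_exp_derivs :: "nat \<Rightarrow> real \<Rightarrow> real" where
  "flat_exp_derivs m t = (\<Sum>(k, c)\<leftarrow>flat_exp_comb m. c * flat_exp k t)"

lemma flat_exp_derivs:
  "(flat_exp_derivs m has_real_derivative flat_exp_derivs (Suc m) t) (at t)"
proof -
  have "((\<lambda>t. \<Sum>(k, c)\<leftarrow>xs. c * flat_exp k t) has_real_derivative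
      (\<Sum>(k, c)\<leftarrow>concat (map (\<lambda>(k, c). [(k + 2, c), (k + 1, - c * real k)]) xs). c * flat_exp k t)) (at t)" for xs
  proof (induction xs)
    case (Cons a xs)
    obtain k c where a: "a = (k, c)" by force
    have "((\<lambda>t. c * flat_exp k t) has_real_derivative c * (flat_exp (k + 2) t - real k * flat_exp (k + 1) t)) (at t)"
      by (rule DERIV_cmult[OF flat_exp_deriv])
    from DERIV_add[OF this Cons] show ?case by (simp add: a algebra_simps)
  qed simp
  then show ?thesis by (simp add: flat_exp_derivs_def[abs_def])
qed

lemma smooth_alg_flat_exp:
  assumes "smooth_alg f"
  shows "smooth_alg (\<lambda>x. flat_exp 0 (f x))"
proof -
  have "smooth_alg (\<lambda>x. flat_exp_derivs 0 (f x))"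
    by (rule smooth_alg.comp[where D=flat_exp_derivs and m=0, OF assms flat_exp_derivs])
  then show ?thesis by (simp add: flat_exp_derivs_def)
qed

lemma smooth_alg_exp: "smooth_alg f \<Longrightarrow> smooth_alg (\<lambda>x. exp (f x))"
  using smooth_alg.comp[of f "\<lambda>_. exp" 0] DERIV_exp by simp

definition box_bump :: "real^'n \<Rightarrow> real^'n \<Rightarrow> real^'n \<Rightarrow> real" where
  "box_bump a b x = (\<Prod>k\<in>UNIV. flat_exp 0 (x $ k - a $ k) * flat_exp 0 (b $ k - x $ k))"

lemma smooth_alg_box_bump: "smooth_alg (box_bump a b)"
proof -
  have "smooth_alg (\<lambda>x. x $ k + - (a $ k))" "smooth_alg (\<lambda>x. b $ k + (-1) * x $ k)" for k
    by (intro smooth_alg.intros)+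
  then have "smooth_alg (\<lambda>x. flat_exp 0 (x $ k - a $ k) * flat_exp 0 (b $ k - x $ k))" for k
    by (intro smooth_alg.mult smooth_alg_flat_exp) simp_all
  then show ?thesis
    unfolding box_bump_def[abs_def] by (intro smooth_alg_prod) auto
qed

lemma box_bump_nonneg: "box_bump a b x \<ge> 0"
  by (auto simp: box_bump_def flat_exp_def intro!: prod_nonneg mult_nonneg_nonneg)

lemma box_bump_pos: "box_bump a b x > 0 \<longleftrightarrow> x \<in> box a b"
proof
  assume "box_bump a b x > 0"
  then have "box_bump a b x \<noteq> 0" by simp
  then have nz: "flat_exp 0 (x $ k - a $ k) * flat_exp 0 (b $ k - x $ k) \<noteq> 0" for k
    by (simp add: box_bump_def)
  have "a $ k < x $ k \<and> x $ k < b $ k" for k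
    using nz[of k] by (auto simp: flat_exp_def split: if_splits)
  then show "x \<in> box a b" by (simp add: mem_box_cart)
next
  assume "x \<in> box a b"
  then show "box_bump a b x > 0"
    by (auto simp: box_bump_def flat_exp_def mem_box_cart intro!: prod_pos)
qed

lemma smooth_imp_continuous: "smooth_alg f \<Longrightarrow> continuous_on S f"
  using smooth_alg_step by (meson continuous_at_imp_continuous_on differentiable_imp_continuous_within)

text \<open>A finite sum of box bumps is bounded below by some \<open>c > 0\<close> on the compact
  set \<open>N\<close>; a smooth saturation brings it into the unit interval without enlarging the
  support.\<close>

lemma test_function_exists:
  fixes N U :: "(real^'n) set"
  assumes N: "compact N" and U: "open U" "N \<subseteq> U"
  obtains \<phi> where "\<phi> \<in> test_functions U" "\<And>x. 0 \<le> \<phi> x" "\<And>x. \<phi> x \<le> 1" "\<And>x. x \<in> N \<Longrightarrow> 1 / 2 \<le> \<phi> x"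
    "smooth_alg \<phi>"
proof -
  have "\<exists>a b. x \<in> box a b \<and> cbox a b \<subseteq> U" if "x \<in> N" for x
    using open_contains_cbox[of U] U that by (metis subsetD)
  then obtain a b where ab: "\<And>x. x \<in> N \<Longrightarrow> x \<in> box (a x) (b x) \<and> cbox (a x) (b x) \<subseteq> U" by metis
  have "\<exists>F\<subseteq>N. finite F \<and> N \<subseteq> (\<Union>x\<in>F. box (a x) (b x))"
    by (rule compactE_image[OF N, of N "\<lambda>x. box (a x) (b x)"]) (use ab in auto)
  then obtain F where F: "F \<subseteq> N" "finite F" "N \<subseteq> (\<Union>x\<in>F. box (a x) (b x))" by blast
  define \<sigma> where "\<sigma> x = (\<Sum>z\<in>F. box_bump (a z) (b z) x)" for x
  have s: "smooth_alg \<sigma>"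
    unfolding \<sigma>_def[abs_def] by (intro smooth_alg_sum F smooth_alg_box_bump)
  have nn: "\<sigma> x \<ge> 0" for x
    unfolding \<sigma>_def by (intro sum_nonneg box_bump_nonneg)
  have pos: "\<sigma> x > 0" if x: "x \<in> N" for x
  proof -
    obtain z where "z \<in> F" "x \<in> box (a z) (b z)" using F(3) x by blast
    then show ?thesis
      unfolding \<sigma>_def using F(2) by (intro sum_pos2[of _ z]) (auto simp: box_bump_pos box_bump_nonneg)
  qed
  obtain c where c: "c > 0" "\<And>x. x \<in> N \<Longrightarrow> c \<le> \<sigma> x"
  proof (cases "N = {}")
    case False
    obtain x where "x \<in> N" "\<And>y. y \<in> N \<Longrightarrow> \<sigma> x \<le> \<sigma> y"
      using continuous_attains_inf[OF N False smooth_imp_continuous[OF s]] by blast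
    then show ?thesis by (intro that[of "\<sigma> x"] pos)
  qed (use that[of 1] in auto)
  \<comment> \<open>The function \<open>1 - exp (- s / c)\<close> vanishes at 0, stays below 1 and
    is at least \<open>1 - exp (- 1) \<ge> 1/2\<close> for \<open>s \<ge> c\<close>. It is spelled
    with sums and products to match the rules of \<open>smooth_alg\<close>.\<close>
  define \<phi> where "\<phi> x = 1 + (-1) * exp ((- 1 / c) * \<sigma> x)" for x
  have sphi: "smooth_alg \<phi>"
    unfolding \<phi>_def[abs_def] by (intro smooth_alg.add smooth_alg.mult smooth_alg.const smooth_alg_exp s)
  define K where "K = (\<Union>z\<in>F. cbox (a z) (b z))"
  have K: "compact K" "K \<subseteq> U"
  proof -
    show "compact K" unfolding K_def by (intro compact_UN F) simp
    show "K \<subseteq> U" unfolding K_def using ab[THEN conjunct2] subsetD[OF F(1)] by (intro UN_least) simp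
  qed
  have supp: "{x. \<phi> x \<noteq> 0} \<subseteq> K"
  proof
    fix x assume "x \<in> {x. \<phi> x \<noteq> 0}"
    then have "\<sigma> x \<noteq> 0" by (auto simp: \<phi>_def)
    then obtain z where "z \<in> F" "box_bump (a z) (b z) x \<noteq> 0"
      unfolding \<sigma>_def by (rule sum.not_neutral_contains_not_neutral)
    then have "x \<in> box (a z) (b z)"
      using box_bump_nonneg[of "a z" "b z" x] box_bump_pos[of "a z" "b z" x] by linarith
    then show "x \<in> K" using \<open>z \<in> F\<close> box_subset_cbox by (auto simp: K_def)
  qed
  then have cl: "closure {x. \<phi> x \<noteq> 0} \<subseteq> K"
    using K by (simp add: closure_minimal compact_imp_closed)
  then have "compact (closure {x. \<phi> x \<noteq> 0})"
    using bounded_subset[OF compact_imp_bounded[OF K(1)] supp] by simp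
  then have "\<phi> \<in> test_functions U"
    using cl K smooth_alg_smooth[OF sphi] by (auto simp: test_functions_def)
  moreover have "1 / 2 \<le> \<phi> x" if "x \<in> N" for x
  proof -
    have "(- 1 / c) * \<sigma> x \<le> - 1" using c(1) c(2)[OF that] by (simp add: field_simps)
    then have "exp ((- 1 / c) * \<sigma> x) \<le> exp (- 1)" by simp
    also have "\<dots> \<le> 1 / 2"
      using exp_ge_add_one_self[of 1] by (simp add: exp_minus field_simps)
    finally show ?thesis by (simp add: \<phi>_def)
  qed
  ultimately show ?thesis
    using that[of \<phi>] nn c(1) sphi by (auto simp: \<phi>_def)
qed

section \<open>Integration by parts for compact support\<close>

text \<open>Every difference quotient in direction \<open>e\<close> has integral 0 by translation
  invariance. The mean value theorem bounds the quotients by the supremum of \<open>F'\<close>, and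
  dominated convergence passes to the derivative.\<close>

lemma integral_derivative_compact_support:
  fixes F F' :: "real^'n \<Rightarrow> real"
  assumes der: "\<And>x. ((\<lambda>t. F (x + t *\<^sub>R e)) has_real_derivative F' x) (at 0)"
    and cont: "continuous_on UNIV F" "continuous_on UNIV F'"
    and K: "compact K" "\<And>x. x \<notin> K \<Longrightarrow> F x = 0"
  shows "(\<integral>x. F' x \<partial>lborel) = 0"
proof -
  have der_t: "((\<lambda>t. F (x + t *\<^sub>R e)) has_real_derivative F' (x + s *\<^sub>R e)) (at s)" for x s
  proof -
    have "((\<lambda>t. F (x + s *\<^sub>R e + (t - s) *\<^sub>R e)) has_real_derivative F' (x + s *\<^sub>R e) * 1) (at s)"
      by (rule DERIV_chain2[of "\<lambda>t. F (x + s *\<^sub>R e + t *\<^sub>R e)"]) (use der in \<open>auto intro!: derivative_eq_intros\<close>)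
    then show ?thesis by (simp add: algebra_simps)
  qed
  have F'0: "F' x = 0" if "x \<notin> K" for x
  proof -
    have "open ((\<lambda>t. x + t *\<^sub>R e) -` (- K))"
      using K by (intro open_vimage) (auto intro!: continuous_intros compact_imp_closed)
    then have "((\<lambda>t. 0) has_real_derivative F' x) (at 0)"
      by (intro has_field_derivative_transform_within_open[OF der[of x]]) (use that K in auto)
    then show ?thesis using DERIV_unique DERIV_const by blast
  qed
  obtain C where C: "\<And>x. x \<in> K \<Longrightarrow> \<bar>F' x\<bar> \<le> C" "C \<ge> 0"
  proof -
    have "bounded (F' ` K)"
      by (intro compact_imp_bounded compact_continuous_image K continuous_on_subset[OF cont(2)]) auto
    then obtain C where "C > 0" "\<And>x. x \<in> K \<Longrightarrow> norm (F' x) \<le> C" unfolding bounded_pos by auto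
    then show ?thesis using that by (metis real_norm_def less_imp_le)
  qed
  have Cb: "\<bar>F' x\<bar> \<le> C" for x using C F'0 by (cases "x \<in> K") auto
  define G where "G n x = (F (x + (1 / real (Suc n)) *\<^sub>R e) - F x) * real (Suc n)" for n x
  obtain r where r: "\<And>x. x \<in> K \<Longrightarrow> norm x \<le> r"
    using K(1) compact_imp_bounded bounded_iff by metis
  \<comment> \<open>Steps of length at most \<open>norm e\<close> move the support out of the ball
    of radius \<open>r\<close> by no more than that length, so one ball serves all
    quotients.\<close>
  define L where "L = cball (0::real^'n) (r + norm e)"
  have GL: "G n x = 0" if "x \<notin> L" for n x
  proof -
    have nx: "norm x > r + norm e" using that by (auto simp: L_def)
    have "norm ((1 / real (Suc n)) *\<^sub>R e) \<le> norm e"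
      by (simp add: field_simps mult_left_le)
    moreover have "norm x \<le> norm (x + (1 / real (Suc n)) *\<^sub>R e) + norm ((1 / real (Suc n)) *\<^sub>R e)"
      using norm_diff_ineq[of x "(1 / real (Suc n)) *\<^sub>R e"] by linarith
    ultimately have "norm (x + (1 / real (Suc n)) *\<^sub>R e) > r" "norm x > r"
      using nx norm_ge_zero[of e] by linarith+
    then have "x + (1 / real (Suc n)) *\<^sub>R e \<notin> K" "x \<notin> K" using r by force+
    then show ?thesis using K(2) by (simp add: G_def)
  qed
  have GC: "\<bar>G n x\<bar> \<le> C" for n x
  proof -
    have "\<exists>z. 0 < z \<and> z < 1 / real (Suc n) \<and> F (x + (1 / real (Suc n)) *\<^sub>R e) - F (x + 0 *\<^sub>R e) = (1 / real (Suc n) - 0) * F' (x + z *\<^sub>R e)"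
      by (rule MVT2) (use der_t in auto)
    then obtain z where "F (x + (1 / real (Suc n)) *\<^sub>R e) - F x = (1 / real (Suc n)) * F' (x + z *\<^sub>R e)" by auto
    then have "G n x = F' (x + z *\<^sub>R e)" by (simp add: G_def)
    then show ?thesis using Cb by simp
  qed
  have lim: "(\<lambda>n. G n x) \<longlonglongrightarrow> F' x" for x
  proof -
    have "((\<lambda>h. (F (x + h *\<^sub>R e) - F x) / h) \<longlongrightarrow> F' x) (at 0)"
      using der[of x] by (simp add: DERIV_def)
    moreover have "filterlim (\<lambda>n. 1 / real (Suc n)) (at 0) sequentially"
      unfolding filterlim_at using LIMSEQ_inverse_real_of_nat by (auto simp: inverse_eq_divide)
    ultimately have "((\<lambda>n. (F (x + (1 / real (Suc n)) *\<^sub>R e) - F x) / (1 / real (Suc n))) \<longlonglongrightarrow> F' x)"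
      by (rule filterlim_compose)
    then show ?thesis by (simp add: G_def)
  qed
  have Fm: "F \<in> borel_measurable lborel" using borel_measurable_continuous_onI[OF cont(1)] by simp
  have F'm: "F' \<in> borel_measurable lborel" using borel_measurable_continuous_onI[OF cont(2)] by simp
  have intF: "integrable lborel F"
  proof -
    have "integrable lborel (\<lambda>x. indicator K x *\<^sub>R F x)"
      by (rule borel_integrable_compact[OF K(1)]) (use cont in \<open>auto intro: continuous_on_subset\<close>)
    moreover have "(\<lambda>x. indicator K x *\<^sub>R F x) = F" using K by (auto simp: indicator_def fun_eq_iff)
    ultimately show ?thesis by simp
  qed
  have tr: "integrable lborel (\<lambda>x. F (x + c))" "(\<integral>x. F (x + c) \<partial>lborel) = (\<integral>x. F x \<partial>lborel)" for c
  proof -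
    have "(\<lambda>x. x + c) = (+) c" by (auto simp: add.commute)
    then have "distr lborel borel (\<lambda>x. x + c) = lborel" by (simp add: lborel_distr_plus)
    then show "integrable lborel (\<lambda>x. F (x + c))" "(\<integral>x. F (x + c) \<partial>lborel) = (\<integral>x. F x \<partial>lborel)"
      using integrable_distr_eq[of "\<lambda>x. x + c" lborel borel F] integral_distr[of "\<lambda>x. x + c" lborel borel F]
        intF Fm by simp_all
  qed
  have G0: "(\<integral>x. G n x \<partial>lborel) = 0" for n
    unfolding G_def using tr intF by simp
  have Gm: "G n \<in> borel_measurable lborel" for n
    unfolding G_def using borel_measurable_integrable[OF tr(1)] Fm by (intro borel_measurable_times borel_measurable_diff) auto
  have dom: "integrable lborel (\<lambda>x. indicator L x *\<^sub>R C)"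
    by (rule borel_integrable_compact) (auto simp: L_def)
  have bd: "AE x in lborel. norm (G n x) \<le> indicator L x *\<^sub>R C" for n
    using GC GL by (auto simp: indicator_def)
  have limAE: "AE x in lborel. (\<lambda>n. G n x) \<longlonglongrightarrow> F' x"
    using lim by simp
  have "(\<lambda>n. \<integral>x. G n x \<partial>lborel) \<longlonglongrightarrow> (\<integral>x. F' x \<partial>lborel)"
    by (rule integral_dominated_convergence[OF F'm Gm dom limAE bd])
  then show "(\<integral>x. F' x \<partial>lborel) = 0" using G0 LIMSEQ_const_iff[of 0 "\<integral>x. F' x \<partial>lborel"] by simp
qed

section \<open>Cutoffs and spikes\<close>

lemma antiderivative_exists:
  fixes f :: "real \<Rightarrow> real"
  assumes "continuous_on UNIV f"
  shows "\<exists>F. \<forall>x. (F has_real_derivative f x) (at x)"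
proof (intro exI allI)
  fix x :: real
  define a b where "a = min 0 x - 1" and "b = max 0 x + 1"
  have "((\<lambda>u. LBINT y=ereal 0..ereal u. f y) has_vector_derivative f x) (at x within {a..b})"
    using continuous_on_subset[OF assms, of "{a..b}"]
    by (intro interval_integral_FTC2) (auto simp: a_def b_def)
  then have "((\<lambda>u. LBINT y=ereal 0..ereal u. f y) has_vector_derivative f x) (at x)"
    by (subst (asm) at_within_interior) (auto simp: a_def b_def)
  then show "((\<lambda>u. LBINT y=ereal 0..ereal u. f y) has_real_derivative f x) (at x)"
    by (simp add: has_real_derivative_iff_has_vector_derivative)
qed

lemma deriv_imp_continuous:
  fixes f :: "real \<Rightarrow> real"
  assumes "\<And>x. (f has_real_derivative f' x) (at x)"
  shows "continuous_on S f"
  using DERIV_isCont[OF assms] by (simp add: continuous_at_imp_continuous_on)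

lemma deriv_zero_imp_eq:
  fixes f :: "real \<Rightarrow> real"
  assumes "\<And>t. (f has_real_derivative f' t) (at t)" "\<And>t. a \<le> t \<Longrightarrow> t \<le> b \<Longrightarrow> f' t = 0"
    "a \<le> x" "x \<le> b" "a \<le> y" "y \<le> b"
  shows "f x = f y"
proof -
  have *: "f x = f y" if xy: "a \<le> x" "x < y" "y \<le> b" for x y
  proof -
    have "\<exists>z. x < z \<and> z < y \<and> f y - f x = (y - x) * f' z"
      by (rule MVT2[OF xy(2), of f f']) (rule assms(1))
    then obtain z where z: "x < z" "z < y" "f y - f x = (y - x) * f' z" by (elim exE conjE)
    have "f' z = 0" by (rule assms(2)) (use z xy in linarith)+
    then show ?thesis using z(3) by auto
  qed
  consider "x < y" | "y < x" | "x = y" by linarith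
  then show ?thesis
  proof cases
    case 1
    show ?thesis by (rule *[OF assms(3) 1 assms(6)])
  next
    case 2
    show ?thesis by (rule *[OF assms(5) 2 assms(4), symmetric])
  qed simp
qed

lemma pos_part_sq_deriv:
  "((\<lambda>t::real. (max 0 t)\<^sup>2) has_real_derivative 2 * max 0 t) (at t)"
proof -
  consider "t > 0" | "t < 0" | "t = 0" by linarith
  then show ?thesis
  proof cases
    case 1
    have "((\<lambda>t. t\<^sup>2) has_real_derivative 2 * max 0 t) (at t)"
      using 1 by (auto intro!: derivative_eq_intros)
    then show ?thesis
      by (rule has_field_derivative_transform_within_open[of _ _ _ "{0<..}"]) (use 1 in auto)
  next
    case 2
    have "((\<lambda>t. 0) has_real_derivative 2 * max 0 t) (at t)"
      using 2 by simp
    then show ?thesis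
      by (rule has_field_derivative_transform_within_open[of _ _ _ "{..<0}"]) (use 2 in auto)
  next
    case 3
    have "((\<lambda>h::real. (max 0 h)\<^sup>2 / h) \<longlongrightarrow> 0) (at 0)"
    proof (rule Lim_null_comparison)
      show "\<forall>\<^sub>F h in at 0. norm ((max 0 h)\<^sup>2 / h) \<le> \<bar>h\<bar>"
        by (rule always_eventually) (auto simp: max_def power2_eq_square)
      show "((\<lambda>h::real. \<bar>h\<bar>) \<longlongrightarrow> 0) (at 0)"
        by (auto intro!: tendsto_eq_intros)
    qed
    then show ?thesis using 3 by (simp add: DERIV_def)
  qed
qed

text \<open>\<open>\<theta>\<close> is a reversed, normalised antiderivative of a bump on
  \<open>[1/2, 1]\<close>. The bump is a product of squared positive parts, so that it is
  continuously differentiable and \<open>\<theta>2\<close> is continuous.\<close>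

lemma cutoff_exists:
  obtains \<theta> \<theta>1 \<theta>2 :: "real \<Rightarrow> real" and C where
    "\<And>s. (\<theta> has_real_derivative \<theta>1 s) (at s)" "\<And>s. (\<theta>1 has_real_derivative \<theta>2 s) (at s)"
    "continuous_on UNIV \<theta>2"
    "\<And>s. 0 \<le> \<theta> s" "\<And>s. \<theta> s \<le> 1" "\<And>s. s \<le> 1/2 \<Longrightarrow> \<theta> s = 1" "\<And>s. s \<ge> 1 \<Longrightarrow> \<theta> s = 0"
    "\<And>s. s \<le> 1/2 \<or> s \<ge> 1 \<Longrightarrow> \<theta>1 s = 0 \<and> \<theta>2 s = 0"
    "C \<ge> 1" "\<And>s. \<bar>\<theta>1 s\<bar> \<le> C" "\<And>s. \<bar>\<theta>2 s\<bar> \<le> C"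
proof -
  define g :: "real \<Rightarrow> real" where "g s = (max 0 (s - 1/2))\<^sup>2 * (max 0 (1 - s))\<^sup>2" for s
  define g1 :: "real \<Rightarrow> real" where
    "g1 s = 2 * max 0 (s - 1/2) * (max 0 (1 - s))\<^sup>2 - (max 0 (s - 1/2))\<^sup>2 * (2 * max 0 (1 - s))" for s
  have cg: "continuous_on UNIV g" "continuous_on UNIV g1"
    unfolding g_def[abs_def] g1_def[abs_def] by (intro continuous_intros)+
  have dg: "(g has_real_derivative g1 s) (at s)" for s
  proof -
    have 1: "((\<lambda>s. (max 0 (s - 1/2))\<^sup>2) has_real_derivative 2 * max 0 (s - 1/2) * 1) (at s)"
      by (rule DERIV_chain2[OF pos_part_sq_deriv]) (auto intro!: derivative_eq_intros)
    have 2: "((\<lambda>s. (max 0 (1 - s))\<^sup>2) has_real_derivative 2 * max 0 (1 - s) * (- 1)) (at s)"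
      by (rule DERIV_chain2[OF pos_part_sq_deriv]) (auto intro!: derivative_eq_intros)
    show ?thesis unfolding g_def[abs_def] g1_def
      by (rule DERIV_cong[OF DERIV_mult[OF 1 2]]) (simp add: algebra_simps)
  qed
  obtain G where G: "\<And>x. (G has_real_derivative g x) (at x)" using antiderivative_exists[OF cg(1)] by blast
  have gnn: "g s \<ge> 0" for s by (simp add: g_def)
  have mono: "G s \<le> G t" if "s \<le> t" for s t
    by (rule DERIV_nonneg_imp_nondecreasing[OF that]) (use G gnn in blast)
  have lt: "G (1/2) < G 1"
  proof (rule DERIV_pos_imp_increasing_open[of "1/2" 1 G])
    show "\<exists>y. DERIV G x :> y \<and> 0 < y" if "1/2 < x" "x < 1" for x
      using that G[of x] by (intro exI[of _ "g x"]) (auto simp: g_def)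
    show "continuous_on {1/2..1} G"
      by (rule deriv_imp_continuous[OF G])
  qed simp
  have lo: "G s = G (1/2)" if "s \<le> 1/2" for s
    by (rule deriv_zero_imp_eq[OF G, of s "1/2"]) (use that in \<open>auto simp: g_def\<close>)
  have hi: "G s = G 1" if "s \<ge> 1" for s
    by (rule deriv_zero_imp_eq[OF G, of 1 s]) (use that in \<open>auto simp: g_def\<close>)
  define d where "d = G 1 - G (1/2)"
  have d: "d > 0" using lt by (simp add: d_def)
  define \<theta> where "\<theta> s = (G 1 - G s) / d" for s
  have rng: "G (1/2) \<le> G s \<and> G s \<le> G 1" for s
    using mono[of "1/2" s] mono[of s 1] lo[of s] hi[of s] lt by (cases "s \<le> 1/2"; cases "s \<ge> 1") auto
  have bnd: "\<exists>C. \<forall>s. \<bar>f s\<bar> \<le> C" if "continuous_on UNIV f" "\<And>s. s \<le> 1/2 \<or> s \<ge> 1 \<Longrightarrow> f s = 0" for f :: "real \<Rightarrow> real"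
  proof -
    have "bounded (f ` {1/2..1})"
      by (intro compact_imp_bounded compact_continuous_image continuous_on_subset[OF that(1)]) auto
    then obtain C where C: "C > 0" "\<And>s. s \<in> {1/2..1} \<Longrightarrow> \<bar>f s\<bar> \<le> C"
      unfolding bounded_pos by auto
    have "\<bar>f s\<bar> \<le> C" for s using C that(2)[of s] by (cases "s \<in> {1/2..1}") auto
    then show ?thesis by blast
  qed
  have z: "g s = 0 \<and> g1 s = 0" if "s \<le> 1/2 \<or> s \<ge> 1" for s
  proof -
    have "max 0 (s - 1/2) = 0 \<or> max 0 (1 - s) = 0" using that by auto
    then show ?thesis by (auto simp: g_def g1_def)
  qed
  have "\<exists>C. \<forall>s. \<bar>- g s / d\<bar> \<le> C" "\<exists>C. \<forall>s. \<bar>- g1 s / d\<bar> \<le> C"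
    by (rule bnd; use z d in \<open>auto intro!: continuous_intros cg\<close>)+
  then obtain C1 C2 where C: "\<And>s. \<bar>- g s / d\<bar> \<le> C1" "\<And>s. \<bar>- g1 s / d\<bar> \<le> C2"
    by (elim exE) (metis)
  show ?thesis
  proof (rule that[of \<theta> "\<lambda>s. - g s / d" "\<lambda>s. - g1 s / d" "max 1 (max C1 C2)"])
    show "(\<theta> has_real_derivative - g s / d) (at s)" for s
      unfolding \<theta>_def[abs_def] using G[of s] d by (auto intro!: derivative_eq_intros)
    show "((\<lambda>s. - g s / d) has_real_derivative - g1 s / d) (at s)" for s
      using dg[of s] d by (auto intro!: derivative_eq_intros)
    show "continuous_on UNIV (\<lambda>s. - g1 s / d)" using cg d by (auto intro!: continuous_intros)
    show "0 \<le> \<theta> s" "\<theta> s \<le> 1" for s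
      using rng[of s] d by (auto simp: \<theta>_def d_def)
    show "\<theta> s = 1" if "s \<le> 1/2" for s using lo[OF that] d by (simp add: \<theta>_def d_def)
    show "\<theta> s = 0" if "s \<ge> 1" for s using hi[OF that] d by (simp add: \<theta>_def d_def)
    show "- g s / d = 0 \<and> - g1 s / d = 0" if "s \<le> 1/2 \<or> s \<ge> 1" for s using z[OF that] by simp
    show "\<bar>- g s / d\<bar> \<le> max 1 (max C1 C2)" "\<bar>- g1 s / d\<bar> \<le> max 1 (max C1 C2)" for s
      using C[of s] by auto
  qed simp
qed

text \<open>For \<open>0 < \<epsilon> < 1/2\<close> this is positive exactly within distance
  \<open>\<epsilon>\<close> of an integer. Truncating a cosine gives a continuous periodic function
  without any gluing.\<close>

definition spike_hat :: "real \<Rightarrow> real \<Rightarrow> real" where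
  "spike_hat \<epsilon> x = max 0 (cos (2 * pi * x) - cos (2 * pi * \<epsilon>))"

lemma spike_hat_near_int:
  assumes "0 < \<epsilon>" "\<epsilon> < 1/2" "spike_hat \<epsilon> x > 0"
  shows "\<exists>k::int. \<bar>x - k\<bar> < \<epsilon>"
proof (rule exI[of _ "round x"], rule ccontr)
  define y where "y = \<bar>x - round x\<bar>"
  assume "\<not> \<bar>x - round x\<bar> < \<epsilon>"
  then have y: "\<epsilon> \<le> y" by (simp add: y_def)
  have y2: "y \<le> 1/2" using of_int_round_abs_le[of x] by (simp add: y_def abs_minus_commute)
  have "cos (2 * pi * x) = cos (2 * pi * (x - round x))"
    unfolding right_diff_distrib cos_diff cos_int_2pin sin_int_2pin by simp
  also have "\<dots> = cos (2 * pi * y)"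
    using cos_abs_real[of "2 * pi * (x - round x)"] by (simp add: y_def abs_mult)
  also have "\<dots> \<le> cos (2 * pi * \<epsilon>)"
    using y y2 assms(1) by (intro cos_monotone_0_pi_le) auto
  finally show False using assms(3) by (simp add: spike_hat_def)
qed

lemma periodic_bound:
  fixes f :: "real \<Rightarrow> real"
  assumes per: "\<And>x. f (x + 1) = f x" and b: "\<And>x. 0 \<le> x \<Longrightarrow> x \<le> 1 \<Longrightarrow> \<bar>f x\<bar> \<le> C"
  shows "\<bar>f x\<bar> \<le> C"
proof -
  have n: "f (x + real m) = f x" for x m
  proof (induction m)
    case (Suc m)
    have "x + real (Suc m) = (x + real m) + 1" by simp
    then show ?case by (simp only: per Suc)
  qed simp
  have i: "f (x + of_int k) = f x" for x k
  proof (cases "k \<ge> 0")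
    case True
    then show ?thesis using n[of x "nat k"] by simp
  next
    case False
    then show ?thesis using n[of "x + of_int k" "nat (- k)"] by simp
  qed
  have "f x = f (frac x)" using i[of "frac x" "\<lfloor>x\<rfloor>"] by (simp add: frac_def)
  then show ?thesis using b[of "frac x"] frac_ge_0[of x] frac_lt_1[of x] by simp
qed

text \<open>A periodic density of mean 1, minus 1, has a periodic antiderivative; after its own mean
  is removed, this one has a periodic antiderivative too. Hence \<open>\<beta> - 1\<close> is the
  second derivative of a \<open>k\<close> that is bounded together with \<open>k1\<close>.\<close>

lemma periodic_spikes:
  assumes e: "0 < \<epsilon>" "\<epsilon> < 1/2"
  obtains B \<beta> k k1 where "B \<ge> 1" "\<And>x. (k has_real_derivative k1 x) (at x)"
    "\<And>x. (k1 has_real_derivative \<beta> x - 1) (at x)" "continuous_on UNIV \<beta>"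
    "\<And>x. 0 \<le> \<beta> x" "\<And>x. \<beta> x \<le> B" "\<And>x. \<bar>k x\<bar> \<le> B" "\<And>x. \<bar>k1 x\<bar> \<le> B"
    "\<And>x. \<beta> x > 0 \<Longrightarrow> \<exists>m::int. \<bar>x - m\<bar> < \<epsilon>" "\<And>m::int. \<beta> m > 0"
proof -
  have per_sh: "spike_hat \<epsilon> (x + 1) = spike_hat \<epsilon> x" for x
    by (simp add: spike_hat_def distrib_left)
  have ch: "continuous_on UNIV (spike_hat \<epsilon>)"
    unfolding spike_hat_def[abs_def] by (intro continuous_intros)
  obtain H where H: "\<And>x. (H has_real_derivative spike_hat \<epsilon> x) (at x)" using antiderivative_exists[OF ch] by blast
  have shint: "spike_hat \<epsilon> (of_int m) > 0" for m :: int
  proof -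
    have "cos (2 * pi * \<epsilon>) < cos 0" using e by (intro cos_monotone_0_pi) auto
    then show ?thesis using cos_int_2pin[of m] by (simp add: spike_hat_def)
  qed
  define M where "M = H 1 - H 0"
  have Hmono: "H s \<le> H t" if "s \<le> t" for s t
  proof (rule DERIV_nonneg_imp_nondecreasing[OF that])
    show "\<exists>y. DERIV H x :> y \<and> 0 \<le> y" for x
      by (rule exI[of _ "spike_hat \<epsilon> x"], rule conjI, rule H) (simp add: spike_hat_def)
  qed
  \<comment> \<open>Otherwise the nondecreasing \<open>H\<close> would be constant on the unit
    interval and its derivative zero inside, against the positive value at 0 and continuity.\<close>
  have M: "M > 0"
  proof (rule ccontr)
    assume "\<not> M > 0"
    then have le: "H 1 \<le> H 0" by (simp add: M_def)
    have const: "H 0 = H s" if "0 \<le> s" "s \<le> 1" for s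
      using Hmono[OF that(1)] Hmono[OF that(2)] le by linarith
    define f where "f = spike_hat \<epsilon>"
    have z: "f x = 0" if "0 < x" "x < 1" for x
    proof -
      have "((\<lambda>_. H 0) has_real_derivative f x) (at x)"
      proof (rule has_field_derivative_transform_within_open[OF H[of x, folded f_def], of "{0<..<1}"])
        show "H y = H 0" if "y \<in> {0<..<1}" for y
          using const[of y] that by simp
      qed (use that in auto)
      then show ?thesis using DERIV_unique[OF _ DERIV_const] by blast
    qed
    have "(f \<longlongrightarrow> f 0) (at_right 0)"
      using ch unfolding f_def by (simp add: continuous_on_eq_continuous_at isCont_def filterlim_at_split)
    moreover have "(f \<longlongrightarrow> 0) (at_right 0)"
      by (rule Lim_transform_eventually[OF tendsto_const])
         (auto simp: eventually_at_right_field z intro!: exI[of _ 1])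
    ultimately have "f 0 = 0" using tendsto_unique trivial_limit_at_right_real by blast
    then show False using shint[of 0] by (simp add: f_def)
  qed
  define \<beta> where "\<beta> x = spike_hat \<epsilon> x / M" for x
  define h where "h x = H x / M - x" for x
  have dh: "(h has_real_derivative \<beta> x - 1) (at x)" for x
    unfolding h_def[abs_def] \<beta>_def using H[of x] M by (auto intro!: derivative_eq_intros)
  have c\<beta>: "continuous_on UNIV \<beta>" unfolding \<beta>_def[abs_def] using ch M by (auto intro!: continuous_intros)
  have dconst: "f x = f 0" if "\<And>t. (f has_real_derivative 0) (at t)" for f :: "real \<Rightarrow> real" and x
    using DERIV_isconst_all[of f x 0] that by blast
  have perh: "h (x + 1) = h x" for x
  proof -
    have this_deriv: "((\<lambda>x. h (x + 1) - h x) has_real_derivative 0) (at t)" for t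
    proof -
      have "((\<lambda>x. h (x + 1)) has_real_derivative (\<beta> (t + 1) - 1) * 1) (at t)"
        by (rule DERIV_chain2[OF dh]) (auto intro!: derivative_eq_intros)
      from DERIV_diff[OF this dh[of t]] show ?thesis by (simp add: \<beta>_def per_sh)
    qed
    have "h 1 - h 0 = (H 1 - H 0) / M - 1" by (simp add: h_def diff_divide_distrib)
    then have "h 1 - h 0 = 0" using M by (simp flip: M_def)
    then show ?thesis using dconst[OF this_deriv, of x] by simp
  qed
  have ch: "continuous_on UNIV h" by (rule deriv_imp_continuous[OF dh])
  obtain L where L: "\<And>x. (L has_real_derivative h x) (at x)" using antiderivative_exists[OF ch] by blast
  \<comment> \<open>The mean of \<open>h\<close> over one period; subtracting it makes the next
    antiderivative periodic.\<close>
  define c where "c = L 1 - L 0"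
  define k where "k x = L x - c * x" for x
  define k1 where "k1 x = h x - c" for x
  have dk: "(k has_real_derivative k1 x) (at x)" "(k1 has_real_derivative \<beta> x - 1) (at x)" for x
    unfolding k_def[abs_def] k1_def[abs_def] using L[of x] dh[of x] by (auto intro!: derivative_eq_intros)
  have perk1: "k1 (x + 1) = k1 x" for x by (simp add: k1_def perh)
  have perk: "k (x + 1) = k x" for x
  proof -
    have "((\<lambda>x. k (x + 1) - k x) has_real_derivative 0) (at t)" for t
    proof -
      have "((\<lambda>x. k (x + 1)) has_real_derivative k1 (t + 1) * 1) (at t)"
        by (rule DERIV_chain2[OF dk(1)]) (auto intro!: derivative_eq_intros)
      from DERIV_diff[OF this dk(1)[of t]] show ?thesis by (simp add: perk1)
    qed
    from dconst[OF this, of x] show ?thesis by (simp add: k_def c_def)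
  qed
  have bd: "\<exists>C. \<forall>x. \<bar>f x\<bar> \<le> C" if "continuous_on UNIV f" "\<And>x. f (x + 1) = f x" for f :: "real \<Rightarrow> real"
  proof -
    have "bounded (f ` {0..1})"
      by (intro compact_imp_bounded compact_continuous_image continuous_on_subset[OF that(1)]) auto
    then obtain C where C: "\<forall>x\<in>{0..1}. \<bar>f x\<bar> \<le> C" unfolding bounded_iff by auto
    have "\<bar>f x\<bar> \<le> C" for x
      by (rule periodic_bound) (use C that(2) in auto)
    then show ?thesis by blast
  qed
  have ck: "continuous_on UNIV k" "continuous_on UNIV k1"
    by (rule deriv_imp_continuous[OF dk(1)], rule deriv_imp_continuous[OF dk(2)])
  have "\<beta> (x + 1) = \<beta> x" for x by (simp add: \<beta>_def per_sh)
  then have "\<exists>C. \<forall>x. \<bar>\<beta> x\<bar> \<le> C" "\<exists>C. \<forall>x. \<bar>k x\<bar> \<le> C" "\<exists>C. \<forall>x. \<bar>k1 x\<bar> \<le> C"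
    using bd[OF c\<beta>] bd[OF ck(1) perk] bd[OF ck(2) perk1] by blast+
  then obtain C1 C2 C3 where C: "\<forall>x. \<bar>\<beta> x\<bar> \<le> C1" "\<forall>x. \<bar>k x\<bar> \<le> C2" "\<forall>x. \<bar>k1 x\<bar> \<le> C3"
    by blast
  show ?thesis
  proof (rule that[of "max 1 (max C1 (max C2 C3))" k k1 \<beta>])
    show "0 \<le> \<beta> x" for x using M by (simp add: \<beta>_def spike_hat_def)
    show "\<beta> x \<le> max 1 (max C1 (max C2 C3))" "\<bar>k x\<bar> \<le> max 1 (max C1 (max C2 C3))" "\<bar>k1 x\<bar> \<le> max 1 (max C1 (max C2 C3))" for x
      using C[rule_format, of x] by auto
    show "\<exists>m::int. \<bar>x - m\<bar> < \<epsilon>" if "\<beta> x > 0" for x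
      using spike_hat_near_int[OF e, of x] that M by (auto simp: \<beta>_def zero_less_divide_iff)
    show "\<beta> (of_int m) > 0" for m using shint M by (simp add: \<beta>_def)
  qed (use dk c\<beta> in auto)
qed

section \<open>Termwise differentiation and continuity of dominated series\<close>

lemma has_derivative_suminf2:
  fixes f A B :: "nat \<Rightarrow> real \<times> real \<Rightarrow> real"
  assumes der: "\<And>n z. (f n has_derivative (\<lambda>h. A n z * fst h + B n z * snd h)) (at z)"
    and f: "\<And>n z. \<bar>f n z\<bar> \<le> m n" and A: "\<And>n z. \<bar>A n z\<bar> \<le> m n" and B: "\<And>n z. \<bar>B n z\<bar> \<le> m n"
    and m: "summable m"
  shows "((\<lambda>z. \<Sum>n. f n z) has_derivative (\<lambda>h. (\<Sum>n. A n z) * fst h + (\<Sum>n. B n z) * snd h)) (at z)"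
proof -
  have sm: "summable (\<lambda>n. f n z)" "summable (\<lambda>n. A n z)" "summable (\<lambda>n. B n z)" for z
    by (rule summable_comparison_test'[OF m, of 0], use f A B in simp)+
  have ev: "\<forall>\<^sub>F n in sequentially. \<forall>z\<in>UNIV. \<forall>h. norm ((\<Sum>i<n. A i z * fst h + B i z * snd h)
      - ((\<Sum>n. A n z) * fst h + (\<Sum>n. B n z) * snd h)) \<le> e * norm h" if e: "e > 0" for e
  proof -
    have u: "uniform_limit UNIV (\<lambda>n z. \<Sum>i<n. g i z) (\<lambda>z. suminf (\<lambda>i. g i z)) sequentially"
      if "\<And>n z. \<bar>g n z\<bar> \<le> m n" for g :: "nat \<Rightarrow> real \<times> real \<Rightarrow> real"
      by (rule Weierstrass_m_test[OF _ m]) (use that in auto)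
    have uA: "uniform_limit UNIV (\<lambda>n z. \<Sum>i<n. A i z) (\<lambda>z. \<Sum>i. A i z) sequentially"
      and uB: "uniform_limit UNIV (\<lambda>n z. \<Sum>i<n. B i z) (\<lambda>z. \<Sum>i. B i z) sequentially"
      by (rule u, rule A, rule u, rule B)
    have "\<forall>\<^sub>F n in sequentially. (\<forall>z. \<bar>(\<Sum>i<n. A i z) - (\<Sum>i. A i z)\<bar> < e/2) \<and> (\<forall>z. \<bar>(\<Sum>i<n. B i z) - (\<Sum>i. B i z)\<bar> < e/2)"
      using uniform_limitD[OF uA, of "e/2"] uniform_limitD[OF uB, of "e/2"] e
      by (simp add: dist_real_def eventually_conj_iff)
    then show ?thesis
    proof eventually_elim
      case (elim n)
      show ?case
      proof (intro ballI allI)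
        fix z h :: "real \<times> real"
        have "(\<Sum>i<n. A i z * fst h + B i z * snd h) - ((\<Sum>n. A n z) * fst h + (\<Sum>n. B n z) * snd h)
          = ((\<Sum>i<n. A i z) - (\<Sum>i. A i z)) * fst h + ((\<Sum>i<n. B i z) - (\<Sum>i. B i z)) * snd h"
          by (simp add: sum.distrib sum_distrib_right left_diff_distrib)
        also have "norm \<dots> \<le> e/2 * norm (fst h) + e/2 * norm (snd h)"
        proof (rule norm_triangle_mono)
          have ab: "\<bar>(\<Sum>i<n. A i z) - (\<Sum>i. A i z)\<bar> \<le> e/2" "\<bar>(\<Sum>i<n. B i z) - (\<Sum>i. B i z)\<bar> \<le> e/2"
            using elim[THEN conjunct1, rule_format, of z] elim[THEN conjunct2, rule_format, of z] by simp_all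
          show "norm (((\<Sum>i<n. A i z) - (\<Sum>i. A i z)) * fst h) \<le> e/2 * norm (fst h)"
            "norm (((\<Sum>i<n. B i z) - (\<Sum>i. B i z)) * snd h) \<le> e/2 * norm (snd h)"
            unfolding real_norm_def abs_mult 
            by (rule mult_right_mono[OF ab(1) abs_ge_zero], rule mult_right_mono[OF ab(2) abs_ge_zero])
        qed
        also have "\<dots> \<le> e/2 * norm h + e/2 * norm h"
          using e norm_fst_le[of "fst h" "snd h"] norm_snd_le[of "snd h" "fst h"]
          by (intro add_mono mult_left_mono) auto
        finally show "norm ((\<Sum>i<n. A i z * fst h + B i z * snd h) - ((\<Sum>n. A n z) * fst h + (\<Sum>n. B n z) * snd h)) \<le> e * norm h"
          by simp
      qed
    qed
  qed
  have "\<exists>g. \<forall>z\<in>UNIV. (\<lambda>n. f n z) sums g z \<and> (g has_derivative (\<lambda>h. (\<Sum>n. A n z) * fst h + (\<Sum>n. B n z) * snd h)) (at z within UNIV)"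
    by (rule has_derivative_series[OF convex_UNIV _ ev, where f=f and x=0 and l="\<Sum>n. f n 0"]) (rule der | rule summable_sums[OF sm(1)] | simp)+
  then obtain g where g: "\<And>z. (\<lambda>n. f n z) sums g z" "\<And>z. (g has_derivative (\<lambda>h. (\<Sum>n. A n z) * fst h + (\<Sum>n. B n z) * snd h)) (at z)"
    by auto
  have "g = (\<lambda>z. \<Sum>n. f n z)" using g(1) by (auto simp: sums_iff)
  then show ?thesis using g(2) by simp
qed

lemma continuous_suminf:
  fixes f :: "nat \<Rightarrow> 'a::topological_space \<Rightarrow> real"
  assumes "\<And>n. continuous_on UNIV (f n)" "\<And>n z. \<bar>f n z\<bar> \<le> m n" "summable m"
  shows "continuous_on UNIV (\<lambda>z. \<Sum>n. f n z)"
proof (rule uniform_limit_theorem)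
  show "uniform_limit UNIV (\<lambda>n z. \<Sum>i<n. f i z) (\<lambda>z. \<Sum>n. f n z) sequentially"
    by (rule Weierstrass_m_test[OF _ assms(3)]) (use assms(2) in auto)
  show "\<forall>\<^sub>F n in sequentially. continuous_on UNIV (\<lambda>z. \<Sum>i<n. f i z)"
    using assms(1) by (intro always_eventually allI continuous_on_sum) auto
qed simp

section \<open>Partial Legendre transforms\<close>

text \<open>The inequality at \<open>X\<close> makes the first-order remainder nonnegative, and the
  one at \<open>Y\<close> bounds it by \<open>(g Y - g X) \<bullet> (Y - X)\<close>.
  Differentiability thus comes without second derivatives of \<open>u\<close>.\<close>

lemma subgradient_imp_has_derivative:
  fixes u :: "'a::euclidean_space \<Rightarrow> real"
  assumes sub: "\<And>X Y. u Y \<ge> u X + g X \<bullet> (Y - X)" and g: "continuous_on UNIV g"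
  shows "(u has_derivative (\<lambda>h. g X \<bullet> h)) (at X)"
proof (rule has_derivativeI_sandwich[where e=1 and H="\<lambda>Y. norm (g Y - g X)"])
  show "bounded_linear (\<lambda>h. g X \<bullet> h)" by (rule bounded_linear_inner_right)
  show "norm (u Y - u X - g X \<bullet> (Y - X)) / norm (Y - X) \<le> norm (g Y - g X)" if "Y \<noteq> X" for Y
  proof -
    have 1: "u Y - u X - g X \<bullet> (Y - X) \<ge> 0" using sub[of X Y] by simp
    have "u Y - u X - g X \<bullet> (Y - X) \<le> (g Y - g X) \<bullet> (Y - X)"
      using sub[of Y X] by (simp add: inner_diff_left inner_diff_right)
    also have "\<dots> \<le> norm (g Y - g X) * norm (Y - X)" by (rule norm_cauchy_schwarz)
    finally show ?thesis using 1 that by (simp add: divide_le_eq)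
  qed
  show "((\<lambda>Y. norm (g Y - g X)) \<longlongrightarrow> 0) (at X)"
    using g by (intro tendsto_norm_zero LIM_zero) (simp add: continuous_on_eq_continuous_at isCont_def)
qed simp

lemma subgradient_imp_convex_on:
  fixes u :: "'a::euclidean_space \<Rightarrow> real"
  assumes sub: "\<And>X Y. u Y \<ge> u X + g X \<bullet> (Y - X)"
  shows "convex_on UNIV u"
proof (rule convex_onI)
  fix t :: real and X Y :: 'a
  assume t: "0 < t" "t < 1"
  define Z where "Z = (1 - t) *\<^sub>R X + t *\<^sub>R Y"
  have "(1 - t) * u X + t * u Y \<ge> (1 - t) * (u Z + g Z \<bullet> (X - Z)) + t * (u Z + g Z \<bullet> (Y - Z))"
    using t by (intro add_mono mult_left_mono sub) auto
  also have "(1 - t) * (u Z + g Z \<bullet> (X - Z)) + t * (u Z + g Z \<bullet> (Y - Z))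
      = u Z + g Z \<bullet> (((1 - t) *\<^sub>R X + t *\<^sub>R Y) - Z)"
    by (simp add: inner_diff_right inner_add_right algebra_simps)
  finally show "u ((1 - t) *\<^sub>R X + t *\<^sub>R Y) \<le> (1 - t) * u X + t * u Y"
    by (simp add: Z_def)
qed simp

text \<open>Subtracting the linear function of a subgradient \<open>p\<close> leaves a minimum over
  the open set \<open>S\<close> at \<open>X\<close>, so the derivative, which is given by
  \<open>g X - p\<close>, vanishes.\<close>

lemma subdifferential_eq_gradient:
  fixes u :: "real^'n \<Rightarrow> real"
  assumes sub: "\<And>X Y. u Y \<ge> u X + g X \<bullet> (Y - X)" and g: "continuous_on UNIV g"
    and S: "open S" "X \<in> S"
  shows "subdifferential S u X = {g X}"
proof
  show "{g X} \<subseteq> subdifferential S u X" using sub by (simp add: subdifferential_def)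
  show "subdifferential S u X \<subseteq> {g X}"
  proof
    fix p assume "p \<in> subdifferential S u X"
    then have p: "\<forall>Y\<in>S. u X - p \<bullet> X \<le> u Y - p \<bullet> Y" by (auto simp: subdifferential_def inner_diff_right)
    have "((\<lambda>Y. u Y - p \<bullet> Y) has_derivative (\<lambda>h. g X \<bullet> h - p \<bullet> h)) (at X)"
      by (intro has_derivative_diff subgradient_imp_has_derivative[OF sub g]
          bounded_linear_imp_has_derivative bounded_linear_inner_right)
    then have "(\<lambda>h. g X \<bullet> h - p \<bullet> h) = (\<lambda>v. 0)"
      by (rule differential_zero_maxmin[OF S(2,1)]) (use p in blast)
    then have "g X \<bullet> (g X - p) - p \<bullet> (g X - p) = 0" by (rule fun_cong)
    then have "(g X - p) \<bullet> (g X - p) = 0" by (simp add: inner_diff_left)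
    then show "p \<in> {g X}" by simp
  qed
qed

lemma above_tangent:
  fixes f :: "real \<Rightarrow> real"
  assumes f: "\<And>t. (f has_real_derivative f' t) (at t)" and f': "\<And>t. (f' has_real_derivative f'' t) (at t)"
    and nn: "\<And>t. f'' t \<ge> 0"
  shows "f b \<ge> f a + f' a * (b - a)"
proof -
  have "convex_on UNIV f"
    by (rule f''_ge0_imp_convex[where f'=f' and f''=f'']) (use assms in auto)
  then have "f b - f a \<ge> f' a * (b - a)"
    by (rule convex_on_imp_above_tangent) (use f in auto)
  then show ?thesis by simp
qed

text \<open>
  \<open>w (p, y)\<close> is the Legendre transform of the solution in the coordinate \<open>x = X $ i\<close> alone, with
  \<open>y = X $ j\<close> kept; the other coordinates enter the solution through half the sum of their squares.
  \<open>\<Phi>\<close> sends \<open>(p, y)\<close> to \<open>(x, y)\<close>, and \<open>\<Psi>\<close> sends it to the gradient. Their Jacobians are \<open>wpp\<close> and \<open>- wyy\<close>,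
  whose quotient is the density \<open>\<rho>\<close>.
\<close>
locale partial_legendre =
  fixes i j :: "'n::finite" and w wp wy wpp wpy wyp wyy :: "real \<times> real \<Rightarrow> real" and M C c :: real
    and S0 :: "(real^'n) set"
  assumes ij: "i \<noteq> j"
    and dw: "\<And>z. (w has_derivative (\<lambda>h. wp z * fst h + wy z * snd h)) (at z)"
    and dwp: "\<And>z. (wp has_derivative (\<lambda>h. wpp z * fst h + wpy z * snd h)) (at z)"
    and dwy: "\<And>z. (wy has_derivative (\<lambda>h. wyp z * fst h + wyy z * snd h)) (at z)"
    and cont: "continuous_on UNIV wpp" "continuous_on UNIV wyy"
    and wpp_nonneg: "\<And>z. wpp z \<ge> 0" and wyy_nonpos: "\<And>z. wyy z \<le> 0" and det_le: "\<And>z. - wyy z \<le> wpp z"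
    and wp_mono: "\<And>p q y. p < q \<Longrightarrow> wp (p, y) < wp (q, y)"
    and wp_surj: "\<And>x y. \<exists>p. wp (p, y) = x"
    and Mc: "M > 0" "c > 0" and growth: "\<And>p y. w (p, y) \<le> M / 2 * p\<^sup>2 + C - c * \<bar>y\<bar>"
    and S0: "compact S0" "\<not> negligible S0" "\<And>P. P \<in> S0 \<Longrightarrow> wpp (P $ i, P $ j) = 0"
begin

abbreviation zz :: "real^'n \<Rightarrow> real \<times> real" where "zz P \<equiv> (P $ i, P $ j)"

definition \<Phi> where "\<Phi> = coord_map i (\<lambda>P. wp (zz P))"
definition \<Psi> where "\<Psi> = coord_map j (\<lambda>P. - wy (zz P))"
text \<open>Coordinate \<open>i\<close> of \<open>G X\<close> is the value of \<open>p\<close> that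
  maximises \<open>X $ i * p - w (p, X $ j)\<close>, and hence the partial derivative of the
  solution in direction \<open>i\<close>.\<close>

definition G where "G = inv \<Phi>"

lemma Phi_nth: "\<Phi> P $ k = (if k = i then wp (zz P) else P $ k)"
  and Psi_nth: "\<Psi> P $ k = (if k = j then - wy (zz P) else P $ k)"
  by (simp_all add: \<Phi>_def \<Psi>_def coord_map_def)

lemma continuous_basic: "continuous_on S wp" "continuous_on S wy"
  using dwp dwy by (meson has_derivative_continuous continuous_at_imp_continuous_on)+

lemma continuous_zz: "continuous_on S zz"
  by (intro continuous_intros)

lemma continuous_comp_zz:
  assumes "continuous_on UNIV f"
  shows "continuous_on S (\<lambda>P. f (zz P))"
  by (rule continuous_on_compose2[OF assms continuous_zz]) auto

lemma continuous_Phi: "continuous_on S \<Phi>" and continuous_Psi: "continuous_on S \<Psi>"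
proof -
  have "continuous_on S (\<lambda>P. if k = i then wp (zz P) else P $ k)"
    "continuous_on S (\<lambda>P. if k = j then - wy (zz P) else P $ k)" for k
    by (cases "k = i"; simp add: continuous_comp_zz[OF continuous_basic(1)] continuous_on_component)
       (cases "k = j"; simp add: continuous_comp_zz[OF continuous_basic(2)] continuous_on_component continuous_on_minus)
  then show "continuous_on S \<Phi>" "continuous_on S \<Psi>"
    unfolding \<Phi>_def \<Psi>_def coord_map_def[abs_def] by (intro continuous_on_vec_lambda; simp)+
qed

lemma wp_inj: "wp (p, y) = wp (q, y) \<Longrightarrow> p = q"
  using wp_mono[of p q y] wp_mono[of q p y] by (metis less_irrefl linorder_less_linear)

lemma bij_Phi: "bij \<Phi>"
proof (rule bijI)
  show "inj \<Phi>"
  proof (rule injI)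
    fix P Q assume "\<Phi> P = \<Phi> Q"
    then have eq: "\<Phi> P $ k = \<Phi> Q $ k" for k by simp
    have j: "P $ k = Q $ k" if "k \<noteq> i" for k using eq[of k] that by (simp add: Phi_nth)
    have "wp (zz P) = wp (zz Q)" using eq[of i] by (simp add: Phi_nth)
    then have "P $ i = Q $ i" using j[of j] ij by (auto intro: wp_inj)
    then show "P = Q" using j by (metis vec_eq_iff)
  qed
  show "surj \<Phi>"
    unfolding surj_def
  proof
    fix X
    obtain p where p: "wp (p, X $ j) = X $ i" using wp_surj by blast
    have "\<Phi> (\<chi> k. if k = i then p else X $ k) = X"
      using p ij by (auto simp: vec_eq_iff Phi_nth)
    then show "\<exists>P. X = \<Phi> P" by metis
  qed
qed

lemma G_Phi [simp]: "G (\<Phi> P) = P" and Phi_G [simp]: "\<Phi> (G X) = X"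
  using bij_Phi by (simp_all add: G_def bij_is_inj bij_is_surj surj_f_inv_f)

lemma G_vimage: "G -` S = \<Phi> ` S"
  by (auto simp: image_iff) (metis Phi_G)

text \<open>The Jacobian \<open>wpp\<close> of \<open>\<Phi>\<close> vanishes on \<open>S0\<close>,
  where the inverse function theorem says nothing. Invariance of domain still makes a continuous
  bijection of the space a homeomorphism.\<close>

lemma continuous_G: "continuous_on S G"
proof -
  have "open (G -` T)" if "open T" for T
    unfolding G_vimage
    by (rule invariance_of_domain[OF continuous_Phi that]) (use bij_Phi in \<open>auto simp: bij_def inj_on_def\<close>)
  then have "continuous_on UNIV G" by (simp add: continuous_on_open_vimage)
  then show ?thesis using continuous_on_subset by blast
qed

lemma G_nth: "k \<noteq> i \<Longrightarrow> G X $ k = X $ k"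
  using Phi_nth[of "G X" k] by simp

lemma wp_G: "wp (zz (G X)) = X $ i"
  using Phi_nth[of "G X" i] by simp

definition quad :: "real^'n \<Rightarrow> real" where "quad X = (\<Sum>k\<in>UNIV - {i, j}. (X $ k)\<^sup>2 / 2)"

definition U :: "real^'n \<Rightarrow> real" where "U X = X $ i * G X $ i - w (zz (G X)) + quad X"

lemma deriv_p: 
  "((\<lambda>p. w (p, y)) has_real_derivative wp (p, y)) (at p)"
  "((\<lambda>p. wp (p, y)) has_real_derivative wpp (p, y)) (at p)"
proof -
  have "((\<lambda>p. (p, y)) has_derivative (\<lambda>h. (h, 0))) (at p)"
    by (intro derivative_intros)
  from has_derivative_compose[OF this dw] has_derivative_compose[OF this dwp]
  show "((\<lambda>p. w (p, y)) has_real_derivative wp (p, y)) (at p)"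
    "((\<lambda>p. wp (p, y)) has_real_derivative wpp (p, y)) (at p)"
    by (simp_all add: has_field_derivative_def)
qed

lemma deriv_y:
  "((\<lambda>y. w (p, y)) has_real_derivative wy (p, y)) (at y)"
  "((\<lambda>y. wy (p, y)) has_real_derivative wyy (p, y)) (at y)"
proof -
  have "((\<lambda>y. (p, y)) has_derivative (\<lambda>h. (0, h))) (at y)"
    by (intro derivative_intros)
  from has_derivative_compose[OF this dw] has_derivative_compose[OF this dwy]
  show "((\<lambda>y. w (p, y)) has_real_derivative wy (p, y)) (at y)"
    "((\<lambda>y. wy (p, y)) has_real_derivative wyy (p, y)) (at y)"
    by (simp_all add: has_field_derivative_def)
qed

text \<open>\<open>w\<close> is convex in \<open>p\<close> and its slope at \<open>G X $ i\<close>
  is \<open>X $ i\<close>, so the supremum in the Legendre transform is attained there.\<close>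

lemma fenchel: "X $ i * G X $ i - w (zz (G X)) \<ge> X $ i * p - w (p, X $ j)"
proof -
  have "w (p, X $ j) \<ge> w (G X $ i, X $ j) + wp (G X $ i, X $ j) * (p - G X $ i)"
    by (rule above_tangent[OF deriv_p wpp_nonneg])
  moreover have "wp (G X $ i, X $ j) = X $ i" using wp_G[of X] G_nth[of j X] ij by simp
  moreover have "G X $ j = X $ j" using G_nth[of j X] ij by simp
  ultimately show ?thesis by (simp add: algebra_simps)
qed

lemma concave_y: "w (p, y') \<le> w (p, y) + wy (p, y) * (y' - y)"
proof -
  have "- w (p, y') \<ge> - w (p, y) + - wy (p, y) * (y' - y)"
    by (rule above_tangent[where f''="\<lambda>y. - wyy (p, y)"])
       (auto intro!: DERIV_minus deriv_y simp: wyy_nonpos)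
  then show ?thesis by simp
qed

lemma sum_split_ij: "(\<Sum>k\<in>UNIV. f k) = f i + f j + (\<Sum>k\<in>UNIV - {i, j}. f k)" for f :: "'n \<Rightarrow> real"
proof -
  have "(\<Sum>k\<in>UNIV. f k) = f i + (\<Sum>k\<in>UNIV - {i}. f k)" by (rule sum.remove) auto
  also have "(\<Sum>k\<in>UNIV - {i}. f k) = f j + (\<Sum>k\<in>UNIV - {i} - {j}. f k)"
    by (rule sum.remove) (use ij in auto)
  also have "UNIV - {i} - {j} = UNIV - {i, j}" by auto
  finally show ?thesis by simp
qed

text \<open>For fixed \<open>p\<close> the function \<open>x * p - w (p, y)\<close> is affine in
  \<open>x\<close> and, by \<open>wyy_nonpos\<close>, convex in \<open>y\<close>. A supremum of such
  functions over \<open>p\<close> is jointly convex, and the maximising \<open>p\<close> supplies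
  the subgradient.\<close>

lemma U_subgradient: "U Y \<ge> U X + \<Psi> (G X) \<bullet> (Y - X)"
proof -
  have inner: "\<Psi> (G X) \<bullet> (Y - X) = G X $ i * (Y $ i - X $ i) - wy (zz (G X)) * (Y $ j - X $ j)
      + (\<Sum>k\<in>UNIV - {i, j}. X $ k * (Y $ k - X $ k))"
  proof -
    have "(\<Sum>k\<in>UNIV - {i, j}. \<Psi> (G X) $ k * (Y $ k - X $ k)) = (\<Sum>k\<in>UNIV - {i, j}. X $ k * (Y $ k - X $ k))"
      by (intro sum.cong) (auto simp: Psi_nth G_nth)
    then show ?thesis
      using ij by (simp add: inner_vec_def sum_split_ij Psi_nth)
  qed
  have "quad Y - quad X \<ge> (\<Sum>k\<in>UNIV - {i, j}. X $ k * (Y $ k - X $ k))"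
    unfolding quad_def sum_subtractf[symmetric]
  proof (rule sum_mono)
    fix k
    have "0 \<le> (Y $ k - X $ k)\<^sup>2" by simp
    then show "X $ k * (Y $ k - X $ k) \<le> (Y $ k)\<^sup>2 / 2 - (X $ k)\<^sup>2 / 2"
      by (simp add: power2_eq_square algebra_simps)
  qed
  moreover have "Y $ i * G Y $ i - w (zz (G Y)) \<ge> Y $ i * G X $ i - w (G X $ i, Y $ j)" by (rule fenchel)
  moreover have "w (G X $ i, Y $ j) \<le> w (zz (G X)) + wy (zz (G X)) * (Y $ j - X $ j)"
    using concave_y[of "G X $ i" "Y $ j" "X $ j"] G_nth[of j X] ij by simp
  ultimately show ?thesis unfolding U_def inner by (simp add: algebra_simps)
qed

lemma continuous_grad: "continuous_on S (\<lambda>X. \<Psi> (G X))"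
  by (rule continuous_on_compose2[OF continuous_Psi[of UNIV] continuous_G]) auto

lemma continuous_U: "continuous_on S U"
proof -
  have "continuous_on UNIV U"
    by (intro has_derivative_continuous_on[where f'="\<lambda>X h. \<Psi> (G X) \<bullet> h"])
       (use subgradient_imp_has_derivative[OF U_subgradient continuous_grad] in simp)
  then show ?thesis using continuous_on_subset by blast
qed

text \<open>The test value \<open>p = x / M\<close> is the maximiser that belongs to the quadratic
  upper bound in \<open>growth\<close>.\<close>

lemma U_lower: "U X \<ge> (X $ i)\<^sup>2 / (2 * M) - C + c * \<bar>X $ j\<bar> + quad X"
proof -
  have "X $ i * (X $ i / M) - (M / 2 * (X $ i / M)\<^sup>2) = (X $ i)\<^sup>2 / (2 * M)"
    using Mc by (simp add: power2_eq_square field_simps)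
  then show ?thesis
    using fenchel[of X "X $ i / M"] growth[of "X $ i / M" "X $ j"] unfolding U_def by linarith
qed

section \<open>The domain as a sublevel set\<close>

text \<open>Some level above the values of \<open>U\<close> on the compact image of
  \<open>S0\<close>; it places the carrier of the singular part inside the domain.\<close>

definition L :: real where "L = (SOME L. \<forall>X\<in>\<Phi> ` S0. U X < L)"

lemma compact_N: "compact (\<Phi> ` S0)"
  using S0 by (intro compact_continuous_image continuous_Phi)

lemma S0_nonempty: "S0 \<noteq> {}"
  using S0(2) by auto

lemma L: "X \<in> \<Phi> ` S0 \<Longrightarrow> U X < L"
proof -
  have "bounded (U ` \<Phi> ` S0)"
    by (intro compact_imp_bounded compact_continuous_image continuous_U compact_N)
  then obtain B where "\<forall>x\<in>U ` \<Phi> ` S0. norm x \<le> B" unfolding bounded_iff by blast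
  then have "\<forall>X\<in>\<Phi> ` S0. U X < B + 1" by force
  then have "\<forall>X\<in>\<Phi> ` S0. U X < L" unfolding L_def by (rule someI)
  then show "X \<in> \<Phi> ` S0 \<Longrightarrow> U X < L" by blast
qed

definition \<Omega> where "\<Omega> = {X. U X < L}"
definition u where "u X = U X - L"

lemma open_Omega: "open \<Omega>"
  unfolding \<Omega>_def using continuous_U[of UNIV] by (intro open_Collect_less) auto

lemma N_subset: "\<Phi> ` S0 \<subseteq> \<Omega>"
  using L by (auto simp: \<Omega>_def)

lemma convex_U: "convex_on UNIV U"
  by (rule subgradient_imp_convex_on[OF U_subgradient])

lemma convex_Omega: "convex \<Omega>"
proof (rule convexI)
  fix X Y and s t :: real assume *: "X \<in> \<Omega>" "Y \<in> \<Omega>" "0 \<le> s" "0 \<le> t" "s + t = 1"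
  have "U (s *\<^sub>R X + t *\<^sub>R Y) \<le> s * U X + t * U Y"
    using convex_U * by (auto simp: convex_on_def)
  also have "\<dots> < L"
    using * by (intro convex_bound_lt) (auto simp: \<Omega>_def)
  finally show "s *\<^sub>R X + t *\<^sub>R Y \<in> \<Omega>" by (simp add: \<Omega>_def)
qed

lemma quad_nonneg: "quad X \<ge> 0"
  by (auto simp: quad_def intro!: sum_nonneg)

lemma bounded_Omega: "bounded \<Omega>"
proof -
  define D where "D = \<bar>L + C\<bar>"
  have sq: "\<bar>t\<bar> \<le> 1 + A" if "t\<^sup>2 \<le> A" for t A :: real
  proof -
    have "0 \<le> (\<bar>t\<bar> - 1)\<^sup>2" by simp
    then have "2 * \<bar>t\<bar> \<le> 1 + t\<^sup>2" by (simp add: power2_eq_square algebra_simps)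
    then show ?thesis using that by (smt (verit) zero_le_power2)
  qed
  define b where "b = (1 + 2 * M * D) + D / c + (1 + 2 * D)"
  have b: "1 + 2 * M * D \<le> b" "D / c \<le> b" "1 + 2 * D \<le> b"
    using Mc by (auto simp: b_def D_def)
  have "\<bar>X $ k\<bar> \<le> b" if X: "X \<in> \<Omega>" for X k
  proof -
    have le: "(X $ i)\<^sup>2 / (2 * M) + c * \<bar>X $ j\<bar> + quad X \<le> D"
      using U_lower[of X] X by (simp add: \<Omega>_def D_def)
    have n: "(X $ i)\<^sup>2 / (2 * M) \<ge> 0" "c * \<bar>X $ j\<bar> \<ge> 0" "quad X \<ge> 0" using Mc quad_nonneg by auto
    consider "k = i" | "k = j" | "k \<notin> {i, j}" by blast
    then show ?thesis
    proof cases
      case 1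
      have "(X $ i)\<^sup>2 / (2 * M) \<le> D" using le n by linarith
      then have "(X $ i)\<^sup>2 \<le> 2 * M * D" using Mc by (simp add: field_simps)
      then show ?thesis using sq[of "X $ i"] b 1 by fastforce
    next
      case 2
      have "c * \<bar>X $ j\<bar> \<le> D" using le n by linarith
      then have "\<bar>X $ j\<bar> \<le> D / c" using Mc by (simp add: field_simps)
      then show ?thesis using b 2 by simp
    next
      case 3
      have "(X $ k)\<^sup>2 / 2 \<le> quad X"
        unfolding quad_def using 3 by (intro member_le_sum) auto
      then have "(X $ k)\<^sup>2 \<le> 2 * D" using le n by linarith
      then show ?thesis using sq[of "X $ k"] b by fastforce
    qed
  qed
  then have "norm X \<le> (\<Sum>k\<in>(UNIV :: 'n set). b)" if "X \<in> \<Omega>" for X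
    using norm_le_l1_cart[of X] sum_mono[of UNIV "\<lambda>k. \<bar>X $ k\<bar>" "\<lambda>k. b"] that by fastforce
  then show ?thesis unfolding bounded_iff by blast
qed

lemma frontier_Omega: "X \<in> frontier \<Omega> \<Longrightarrow> u X = 0"
proof -
  assume X: "X \<in> frontier \<Omega>"
  have "closure \<Omega> \<subseteq> {X. U X \<le> L}"
    by (rule closure_minimal) (auto simp: \<Omega>_def intro!: closed_Collect_le continuous_U)
  then show "u X = 0"
    using X open_Omega by (auto simp: frontier_def interior_open \<Omega>_def u_def)
qed

lemma subdifferential_u: "X \<in> \<Omega> \<Longrightarrow> subdifferential \<Omega> u X = {\<Psi> (G X)}"
  by (rule subdifferential_eq_gradient[OF _ continuous_grad[of UNIV] open_Omega])
     (use U_subgradient in \<open>auto simp: u_def algebra_simps\<close>)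

section \<open>The density and the Monge-Ampere measure\<close>

text \<open>Where \<open>wpp\<close> vanishes, \<open>det_le\<close> and \<open>wyy_nonpos\<close>
  force \<open>wyy\<close> to vanish as well. With the value 0 there,
  \<open>wpp (zz P) * \<rho> (\<Phi> P) = - wyy (zz P)\<close> holds at every point.\<close>

definition \<rho> where "\<rho> X = (if wpp (zz (G X)) = 0 then 0 else - wyy (zz (G X)) / wpp (zz (G X)))"

lemma rho_bounds: "0 \<le> \<rho> X" "\<rho> X \<le> 1"
  using wpp_nonneg[of "zz (G X)"] wyy_nonpos[of "zz (G X)"] det_le[of "zz (G X)"]
  by (auto simp: \<rho>_def divide_nonpos_nonneg le_divide_eq)

lemma continuous_comp_G:
  assumes "continuous_on UNIV f"
  shows "continuous_on S (\<lambda>X. f (zz (G X)))"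
  using continuous_on_compose2[OF continuous_comp_zz[OF assms, of UNIV] continuous_G] by simp

lemma rho_measurable: "\<rho> \<in> borel_measurable borel"
proof -
  have "(\<lambda>X. wpp (zz (G X))) \<in> borel_measurable borel" "(\<lambda>X. wyy (zz (G X))) \<in> borel_measurable borel"
    using continuous_comp_G cont by (auto intro!: borel_measurable_continuous_onI)
  then show ?thesis unfolding \<rho>_def[abs_def] by measurable
qed

lemma deriv_wp_zz:
  "((\<lambda>P. wp (zz P)) has_derivative (\<lambda>h. wpp (zz P) * h $ i + wpy (zz P) * h $ j)) (at P within S)"
  and deriv_wy_zz:
  "((\<lambda>P. - wy (zz P)) has_derivative (\<lambda>h. - (wyp (zz P) * h $ i + wyy (zz P) * h $ j))) (at P within S)"
proof -
  have z: "(zz has_derivative zz) (at P within S)"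
    by (intro has_derivative_Pair bounded_linear_imp_has_derivative bounded_linear_vec_nth)
  show "((\<lambda>P. wp (zz P)) has_derivative (\<lambda>h. wpp (zz P) * h $ i + wpy (zz P) * h $ j)) (at P within S)"
    using has_derivative_compose[OF z dwp] by simp
  show "((\<lambda>P. - wy (zz P)) has_derivative (\<lambda>h. - (wyp (zz P) * h $ i + wyy (zz P) * h $ j))) (at P within S)"
    using has_derivative_minus[OF has_derivative_compose[OF z dwy]] by simp
qed

lemma coord_change_Phi:
  "S \<in> sets borel \<Longrightarrow> coord_change (\<lambda>P. wp (zz P)) (\<lambda>P h. wpp (zz P) * h $ i + wpy (zz P) * h $ j) S"
  by unfold_locales (auto intro: deriv_wp_zz)

lemma coord_change_Psi:
  "S \<in> sets borel \<Longrightarrow> coord_change (\<lambda>P. - wy (zz P)) (\<lambda>P h. - (wyp (zz P) * h $ i + wyy (zz P) * h $ j)) S"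
  by (rule coord_change.intro) (simp, rule deriv_wy_zz)

lemma axis_ij [simp]: "axis i (1::real) $ j = 0" "axis j (1::real) $ i = 0"
  using ij by (simp_all add: axis_def)

lemma Phi_change_of_variables:
  assumes "S \<in> sets borel"
  shows "(\<lambda>P. wpp (zz P) * f (\<Phi> P)) absolutely_integrable_on S \<and> integral S (\<lambda>P. wpp (zz P) * f (\<Phi> P)) = b
    \<longleftrightarrow> f absolutely_integrable_on (\<Phi> ` S) \<and> integral (\<Phi> ` S) f = b"
proof -
  have inj: "inj_on (coord_map i (\<lambda>P. wp (zz P))) S"
    using bij_Phi unfolding \<Phi>_def bij_def by (rule inj_on_subset[OF conjunct1]) simp
  show ?thesis
    using coord_change.has_absolute_integral[OF coord_change_Phi[OF assms] inj, of f b]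
    by (simp add: \<Phi>_def wpp_nonneg)
qed

lemma negligible_Phi:
  assumes "S \<in> sets borel" "\<And>P. P \<in> S \<Longrightarrow> wpp (zz P) = 0"
  shows "negligible (\<Phi> ` S)"
  unfolding \<Phi>_def by (rule coord_change.negligible_image[OF coord_change_Phi]) (use assms in auto)

lemma negligible_Psi:
  assumes "S \<in> sets borel" "\<And>P. P \<in> S \<Longrightarrow> wyy (zz P) = 0"
  shows "negligible (\<Psi> ` S)"
  unfolding \<Psi>_def by (rule coord_change.negligible_image[OF coord_change_Psi]) (use assms in auto)

lemma wy_antimono: "y1 \<le> y2 \<Longrightarrow> wy (p, y2) \<le> wy (p, y1)"
proof (rule DERIV_nonpos_imp_nonincreasing[of y1 y2 "\<lambda>y. wy (p, y)"])
  show "\<exists>d. ((\<lambda>y. wy (p, y)) has_real_derivative d) (at y) \<and> d \<le> 0" for y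
    by (rule exI[of _ "wyy (p, y)"]) (simp add: deriv_y(2) wyy_nonpos)
qed

text \<open>The negative derivative at \<open>y1\<close> gives a strict drop just to the right,
  which the nonincreasing \<open>wy\<close> never regains.\<close>

lemma wy_strict:
  assumes "y1 < y2" "wyy (p, y1) < 0"
  shows "wy (p, y2) < wy (p, y1)"
proof -
  obtain d where d: "d > 0" "\<forall>h>0. h < d \<longrightarrow> wy (p, y1 + h) < wy (p, y1)"
    using DERIV_neg_dec_right[OF deriv_y(2) assms(2)] by blast
  define h where "h = min (d / 2) (y2 - y1)"
  have h: "h > 0" "h < d" "y1 + h \<le> y2" using d(1) assms(1) by (auto simp: h_def)
  have "wy (p, y2) \<le> wy (p, y1 + h)" using h by (intro wy_antimono)
  also have "\<dots> < wy (p, y1)" using d(2) h by blast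
  finally show ?thesis .
qed

lemma inj_Psi: "inj_on \<Psi> {P. wyy (zz P) < 0}"
proof (rule inj_onI)
  fix P Q assume P: "P \<in> {P. wyy (zz P) < 0}" and Q: "Q \<in> {P. wyy (zz P) < 0}" and "\<Psi> P = \<Psi> Q"
  then have eq: "\<Psi> P $ k = \<Psi> Q $ k" for k by simp
  have k: "P $ k = Q $ k" if "k \<noteq> j" for k using eq[of k] that by (simp add: Psi_nth)
  have i: "P $ i = Q $ i" using k ij by simp
  have wy: "wy (P $ i, P $ j) = wy (P $ i, Q $ j)" using eq[of j] i by (simp add: Psi_nth)
  have "\<not> P $ j < Q $ j" using wy_strict[of "P $ j" "Q $ j" "P $ i"] P wy by auto
  moreover have "\<not> Q $ j < P $ j" using wy_strict[of "Q $ j" "P $ j" "P $ i"] Q wy i by auto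
  ultimately have "P $ j = Q $ j" by simp
  then show "P = Q" using k by (metis vec_eq_iff)
qed

lemma absolutely_integrable_bounded_borel:
  fixes f :: "real^'n \<Rightarrow> real"
  assumes "continuous_on UNIV f" "S \<in> sets borel" "bounded S"
  shows "f absolutely_integrable_on S"
proof -
  obtain a where a: "S \<subseteq> cbox (- a) a" using bounded_subset_cbox_symmetric[OF assms(3)] .
  have ai: "f absolutely_integrable_on cbox (- a) a"
    by (rule absolutely_integrable_continuous) (rule continuous_on_subset[OF assms(1)], simp)
  have "S \<in> sets lebesgue" using assms(2) by simp
  then show ?thesis by (rule set_integrable_subset[OF ai _ a])
qed

text \<open>\<open>\<Psi>\<close> may collapse segments on which \<open>wy\<close> is constant in
  \<open>y\<close>. Where \<open>wyy < 0\<close> it is injective and the change of variables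
  applies; the set \<open>wyy = 0\<close> has a null image by Sard's lemma.\<close>

lemma emeasure_Psi:
  assumes B: "B \<in> sets borel" "bounded B"
  shows "emeasure lebesgue (\<Psi> ` B) = ennreal (integral B (\<lambda>P. - wyy (zz P)))"
proof -
  define B1 where "B1 = B \<inter> {P. wyy (zz P) < 0}"
  define B0 where "B0 = B \<inter> {P. wyy (zz P) = 0}"
  have m: "(\<lambda>P. wyy (zz P)) \<in> borel_measurable borel"
    by (rule borel_measurable_continuous_onI[OF continuous_comp_zz[OF cont(2)]])
  then have B1: "B1 \<in> sets borel" and B0: "B0 \<in> sets borel"
    using B by (auto simp: B1_def B0_def intro!: sets.Int)
  have c: "continuous_on UNIV (\<lambda>P. - wyy (zz P))"
    by (intro continuous_on_minus continuous_comp_zz[OF cont(2)])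
  have ai: "(\<lambda>P. - wyy (zz P)) absolutely_integrable_on B1"
    by (rule absolutely_integrable_bounded_borel[OF c B1]) (use B bounded_subset B1_def in blast)
  have inj: "inj_on (coord_map j (\<lambda>P. - wy (zz P))) B1"
    using inj_on_subset[OF inj_Psi, of B1] by (auto simp: B1_def \<Psi>_def)
  define b where "b = integral B1 (\<lambda>P. - wyy (zz P))"
  have "(\<lambda>P. 1::real) absolutely_integrable_on (\<Psi> ` B1) \<and> integral (\<Psi> ` B1) (\<lambda>P. 1) = b"
    using coord_change.has_absolute_integral[OF coord_change_Psi[OF B1] inj, of "\<lambda>_. 1" b] ai
    by (simp add: \<Psi>_def b_def wyy_nonpos abs_of_nonpos)
  then have lm: "\<Psi> ` B1 \<in> lmeasurable" and mb: "measure lebesgue (\<Psi> ` B1) = b"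
    by (auto simp: lmeasurable_iff_integrable_on lmeasure_integral set_lebesgue_integral_eq_integral)
  have neg: "negligible (\<Psi> ` B0)"
    by (rule negligible_Psi[OF B0]) (auto simp: B0_def)
  have "B = B1 \<union> B0" using wyy_nonpos by (auto simp: B1_def B0_def order_le_less)
  then have "emeasure lebesgue (\<Psi> ` B) = emeasure lebesgue (\<Psi> ` B1 \<union> \<Psi> ` B0)" by (simp add: image_Un)
  also have "\<dots> = emeasure lebesgue (\<Psi> ` B1)"
    using neg lm by (intro emeasure_Un_null_set) (auto simp: negligible_iff_null_sets fmeasurable_def)
  also have "\<dots> = ennreal b" using emeasure_eq_measure2[OF lm] mb by simp
  also have "b = integral B (\<lambda>P. - wyy (zz P))"
  proof -
    have "(\<lambda>P. if P \<in> B1 then - wyy (zz P) else 0) = (\<lambda>P. if P \<in> B then - wyy (zz P) else 0)"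
      using wyy_nonpos by (auto simp: B1_def fun_eq_iff order_le_less)
    then show ?thesis
      using integral_restrict_UNIV[of B1 "\<lambda>P. - wyy (zz P)"] integral_restrict_UNIV[of B "\<lambda>P. - wyy (zz P)"]
      by (simp add: b_def)
  qed
  finally show ?thesis .
qed

text \<open>If \<open>E\<close> is the image of \<open>B\<close> under \<open>\<Phi>\<close>, its
  gradient image is the image of \<open>B\<close> under \<open>\<Psi>\<close>. Both sides equal the
  integral of \<open>- wyy\<close> over \<open>B\<close>: the left one through the Jacobian of
  \<open>\<Psi>\<close>, the right one through that of \<open>\<Phi>\<close>, which is
  \<open>wpp\<close>.\<close>

lemma monge_ampere_u:
  assumes E: "E \<in> sets borel" "E \<subseteq> \<Omega>"
  shows "monge_ampere_measure \<Omega> u E = (\<integral>\<^sup>+x\<in>E. ennreal (\<rho> x) \<partial>lebesgue)"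
proof -
  define B where "B = \<Phi> -` E"
  have PB: "\<Phi> ` B = E" using bij_Phi by (simp add: B_def surj_image_vimage_eq bij_is_surj)
  have GE: "G ` E = B" unfolding PB[symmetric] by (simp add: image_image)
  have "\<Phi> \<in> borel_measurable borel" by (rule borel_measurable_continuous_onI[OF continuous_Phi])
  from measurable_sets[OF this E(1)] have B: "B \<in> sets borel" by (simp add: B_def)
  have "compact (G ` closure \<Omega>)"
    using bounded_Omega by (intro compact_continuous_image continuous_G) simp
  then have "bounded B"
    by (rule bounded_subset[OF compact_imp_bounded]) (use E(2) closure_subset GE in blast)
  have "(\<Union>x\<in>E. subdifferential \<Omega> u x) = (\<Union>x\<in>E. {\<Psi> (G x)})"
    using E(2) subdifferential_u by (intro SUP_cong) auto
  also have "\<dots> = \<Psi> ` B" unfolding GE[symmetric] by auto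
  finally have ma: "monge_ampere_measure \<Omega> u E = ennreal (integral B (\<lambda>P. - wyy (zz P)))"
    unfolding monge_ampere_measure_def using emeasure_Psi[OF B \<open>bounded B\<close>] by simp
  have c: "continuous_on UNIV (\<lambda>P. - wyy (zz P))"
    by (intro continuous_on_minus continuous_comp_zz[OF cont(2)])
  have eq: "wpp (zz P) * \<rho> (\<Phi> P) = - wyy (zz P)" for P
    using wyy_nonpos[of "zz P"] det_le[of "zz P"] by (auto simp: \<rho>_def)
  have "(\<lambda>P. wpp (zz P) * \<rho> (\<Phi> P)) absolutely_integrable_on B"
    unfolding eq by (rule absolutely_integrable_bounded_borel[OF c B \<open>bounded B\<close>])
  then have "\<rho> absolutely_integrable_on E \<and> integral E \<rho> = integral B (\<lambda>P. - wyy (zz P))"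
    using Phi_change_of_variables[OF B, of \<rho> "integral B (\<lambda>P. - wyy (zz P))"] unfolding PB eq by simp
  then have ai: "set_integrable lebesgue E \<rho>" and int: "(LINT x:E|lebesgue. \<rho> x) = integral B (\<lambda>P. - wyy (zz P))"
    using set_lebesgue_integral_eq_integral(2)[of E \<rho>] by auto
  have "(\<integral>\<^sup>+x\<in>E. ennreal (\<rho> x) \<partial>lebesgue) = (\<integral>\<^sup>+x. ennreal (indicator E x *\<^sub>R \<rho> x) \<partial>lebesgue)"
    by (intro nn_integral_cong) (simp add: indicator_def)
  also have "\<dots> = ennreal (\<integral>x. indicator E x *\<^sub>R \<rho> x \<partial>lebesgue)"
    using ai rho_bounds unfolding set_integrable_def by (intro nn_integral_eq_integral) (auto simp: indicator_def)
  also have "\<dots> = monge_ampere_measure \<Omega> u E"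
    unfolding ma int[symmetric] set_lebesgue_integral_def ..
  finally show ?thesis ..
qed

section \<open>The distributional second derivative in direction \<open>i\<close>\<close>

definition deriv_i where "deriv_i = (partial_deriv i :: (real^'n \<Rightarrow> real) \<Rightarrow> real^'n \<Rightarrow> real)"

lemma directional:
  assumes "smooth_alg \<phi>"
  shows "((\<lambda>t. \<phi> (x + t *\<^sub>R axis i 1)) has_real_derivative deriv_i \<phi> x) (at 0)"
proof -
  have d: "(\<phi> has_derivative frechet_derivative \<phi> (at x)) (at x)"
    using smooth_alg_step[OF assms] by (auto simp: frechet_derivative_works)
  have "((\<lambda>t. x + t *\<^sub>R axis i 1) has_derivative (\<lambda>t. t *\<^sub>R axis i (1::real))) (at 0)"
    by (auto intro!: derivative_eq_intros)
  from has_derivative_compose[OF this, of \<phi> "frechet_derivative \<phi> (at x)"] d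
  have "((\<lambda>t. \<phi> (x + t *\<^sub>R axis i 1)) has_derivative (\<lambda>t. frechet_derivative \<phi> (at x) (t *\<^sub>R axis i 1))) (at 0)"
    by simp
  moreover have "frechet_derivative \<phi> (at x) (t *\<^sub>R axis i 1) = deriv_i \<phi> x * t" for t
    using linear_cmul[OF has_derivative_linear[OF d], of t "axis i 1"] by (simp add: deriv_i_def partial_deriv_def)
  ultimately show ?thesis by (simp add: has_field_derivative_def)
qed

lemma U_directional: "((\<lambda>t. u (x + t *\<^sub>R axis i 1)) has_real_derivative G x $ i) (at 0)"
proof -
  have "(U has_derivative (\<lambda>h. \<Psi> (G x) \<bullet> h)) (at (x + 0 *\<^sub>R axis i 1))"
    using subgradient_imp_has_derivative[OF U_subgradient continuous_grad, of x] by simp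
  moreover have "((\<lambda>t. x + t *\<^sub>R axis i 1) has_derivative (\<lambda>t. t *\<^sub>R axis i (1::real))) (at 0)"
    by (auto intro!: derivative_eq_intros)
  ultimately have "((\<lambda>t. U (x + t *\<^sub>R axis i 1)) has_derivative (\<lambda>t. \<Psi> (G x) \<bullet> (t *\<^sub>R axis i 1))) (at 0)"
    by (rule has_derivative_compose[rotated])
  then have "((\<lambda>t. U (x + t *\<^sub>R axis i 1) - L) has_derivative (\<lambda>t. \<Psi> (G x) \<bullet> (t *\<^sub>R axis i 1) - 0)) (at 0)"
    by (intro has_derivative_diff has_derivative_const)
  moreover have "(\<lambda>t. \<Psi> (G x) \<bullet> (t *\<^sub>R axis i 1) - 0) = (*) (G x $ i)"
    using ij by (simp add: inner_axis Psi_nth fun_eq_iff)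
  ultimately show ?thesis by (simp only: has_field_derivative_def u_def)
qed

lemma Phi_shift: "\<Phi> (P + t *\<^sub>R axis i 1) = \<Phi> P + (wp (P $ i + t, P $ j) - wp (zz P)) *\<^sub>R axis i 1"
  using ij by (auto simp: vec_eq_iff Phi_nth) (auto simp: axis_def)

text \<open>Since \<open>\<partial>\<^sub>i u (\<Phi> P) = P $ i\<close>, integrating by parts once in \<open>x\<close> and once in \<open>p\<close> gives the identity.\<close>
lemma hessian_pushforward:
  assumes phi: "smooth_alg \<phi>" and K: "compact K" "\<And>x. x \<notin> K \<Longrightarrow> \<phi> x = 0"
  shows "(\<integral>x. u x * deriv_i (deriv_i \<phi>) x \<partial>lborel) = (\<integral>P. \<phi> (\<Phi> P) \<partial>lborel)"
    and "integrable lborel (\<lambda>P. \<phi> (\<Phi> P))" and "x \<notin> K \<Longrightarrow> deriv_i (deriv_i \<phi>) x = 0"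
proof -
  define \<phi>1 \<phi>2 where "\<phi>1 = deriv_i \<phi>" and "\<phi>2 = deriv_i \<phi>1"
  have s1: "smooth_alg \<phi>1" and s2: "smooth_alg \<phi>2"
    using smooth_alg_step[OF phi] smooth_alg_step[of \<phi>1] by (auto simp: \<phi>1_def \<phi>2_def deriv_i_def)
  note cs = smooth_imp_continuous[OF phi] smooth_imp_continuous[OF s1] smooth_imp_continuous[OF s2]
  have z: "deriv_i f x = 0" if "smooth_alg f" "\<And>x. x \<notin> K \<Longrightarrow> f x = 0" "x \<notin> K" for f x
  proof -
    have "open ((\<lambda>t. x + t *\<^sub>R axis i 1) -` (- K))"
      using K by (intro open_vimage) (auto intro!: continuous_intros compact_imp_closed)
    then have "((\<lambda>t. 0) has_real_derivative deriv_i f x) (at 0)"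
      by (intro has_field_derivative_transform_within_open[OF directional[OF that(1), of x]]) (use that in auto)
    then show ?thesis using DERIV_unique[OF _ DERIV_const] by blast
  qed
  have z1: "\<phi>1 x = 0" if "x \<notin> K" for x unfolding \<phi>1_def by (rule z[OF phi K(2) that])
  have z2: "\<phi>2 x = 0" if "x \<notin> K" for x unfolding \<phi>2_def by (rule z[OF s1 z1 that])
  then show "x \<notin> K \<Longrightarrow> deriv_i (deriv_i \<phi>) x = 0" by (simp add: \<phi>2_def \<phi>1_def)
  have cu: "continuous_on UNIV u" unfolding u_def[abs_def] by (intro continuous_intros continuous_U)
  have cGi: "continuous_on UNIV (\<lambda>x. G x $ i)" by (intro continuous_on_component continuous_G)
  have ci: "integrable lborel f" if "continuous_on UNIV f" "\<And>x. x \<notin> K' \<Longrightarrow> f x = 0" "compact K'" for f :: "real^'n \<Rightarrow> real" and K'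
  proof -
    have "integrable lborel (\<lambda>x. indicator K' x *\<^sub>R f x)"
      by (rule borel_integrable_compact[OF that(3)]) (rule continuous_on_subset[OF that(1)], simp)
    moreover have "(\<lambda>x. indicator K' x *\<^sub>R f x) = f" using that(2) by (auto simp: indicator_def fun_eq_iff)
    ultimately show ?thesis by simp
  qed
  have dA: "((\<lambda>t. u (x + t *\<^sub>R axis i 1) * \<phi>1 (x + t *\<^sub>R axis i 1)) has_real_derivative (G x $ i * \<phi>1 x + u x * \<phi>2 x)) (at 0)" for x
    using DERIV_mult[OF U_directional directional[OF s1]] by (simp add: \<phi>2_def algebra_simps)
  have A: "(\<integral>x. G x $ i * \<phi>1 x + u x * \<phi>2 x \<partial>lborel) = 0"
    by (rule integral_derivative_compact_support[OF dA _ _ K(1)])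
       (auto intro!: continuous_intros cu cs cGi simp: z1)
  have iA: "integrable lborel (\<lambda>x. G x $ i * \<phi>1 x)" "integrable lborel (\<lambda>x. u x * \<phi>2 x)"
    by (rule ci[OF _ _ K(1)]; auto intro!: continuous_intros cu cs cGi simp: z1 z2)+
  have cPhi: "continuous_on UNIV (\<lambda>P. \<phi> (\<Phi> P))" "continuous_on UNIV (\<lambda>P. \<phi>1 (\<Phi> P))"
    using continuous_on_compose2[OF cs(1)[of UNIV] continuous_Phi[of UNIV]]
      continuous_on_compose2[OF cs(2)[of UNIV] continuous_Phi[of UNIV]] by auto
  have KG: "compact (G ` K)" using K by (intro compact_continuous_image continuous_G)
  have inK: "\<Phi> P \<notin> K" if "P \<notin> G ` K" for P
    using that by (metis G_Phi imageI)
  have sh: "((\<lambda>t. \<phi> (\<Phi> (P + t *\<^sub>R axis i 1))) has_real_derivative \<phi>1 (\<Phi> P) * wpp (zz P)) (at 0)" for P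
  proof -
    have 1: "((\<lambda>t. wp (P $ i + t, P $ j) - wp (zz P)) has_real_derivative wpp (zz P)) (at 0)"
    proof -
      have "((\<lambda>t. wp (P $ i + t, P $ j)) has_real_derivative wpp (zz P) * 1) (at 0)"
        by (rule DERIV_chain2[where f="\<lambda>p. wp (p, P $ j)"]) (use deriv_p(2) in \<open>auto intro!: derivative_eq_intros\<close>)
      from DERIV_diff[OF this DERIV_const] show ?thesis by simp
    qed
    have "((\<lambda>t. \<phi> (\<Phi> P + (wp (P $ i + t, P $ j) - wp (zz P)) *\<^sub>R axis i 1)) has_real_derivative \<phi>1 (\<Phi> P) * wpp (zz P)) (at 0)"
      by (rule DERIV_chain2[OF _ 1, where f="\<lambda>t. \<phi> (\<Phi> P + t *\<^sub>R axis i 1)"])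
         (use directional[OF phi, of "\<Phi> P"] in \<open>simp add: \<phi>1_def\<close>)
    then show ?thesis by (simp only: Phi_shift)
  qed
  have Pi: "((\<lambda>t. (P + t *\<^sub>R axis i 1) $ i) has_real_derivative 1) (at 0)" for P :: "real^'n"
    by (auto intro!: derivative_eq_intros)
  \<comment> \<open>The factor \<open>wpp\<close> in the second term is the Jacobian of
    \<open>\<Phi>\<close>, so that this term integrates to the integral of
    \<open>G x $ i * \<phi>1 x\<close>, which also occurs in the identity \<open>A\<close>.\<close>
  have dC: "((\<lambda>t. (P + t *\<^sub>R axis i 1) $ i * \<phi> (\<Phi> (P + t *\<^sub>R axis i 1))) has_real_derivative
      (\<phi> (\<Phi> P) + wpp (zz P) * (P $ i * \<phi>1 (\<Phi> P)))) (at 0)" for P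
    using DERIV_mult[OF Pi sh[of P]] by (simp add: algebra_simps)
  have C: "(\<integral>P. \<phi> (\<Phi> P) + wpp (zz P) * (P $ i * \<phi>1 (\<Phi> P)) \<partial>lborel) = 0"
    by (rule integral_derivative_compact_support[OF dC _ _ KG])
       (auto intro!: continuous_intros cPhi continuous_comp_zz cont simp: K(2) inK)
  show iC: "integrable lborel (\<lambda>P. \<phi> (\<Phi> P))"
    by (rule ci[OF cPhi(1) _ KG]) (simp add: K(2) inK)
  have iC2: "integrable lborel (\<lambda>P. wpp (zz P) * (P $ i * \<phi>1 (\<Phi> P)))"
    by (rule ci[OF _ _ KG]) (auto intro!: continuous_intros cPhi continuous_comp_zz cont simp: z1 inK)
  have leb: "f absolutely_integrable_on UNIV \<and> integral UNIV f = (\<integral>x. f x \<partial>lborel)"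
    if "integrable lborel f" for f :: "real^'n \<Rightarrow> real"
  proof -
    have *: "integrable lebesgue f" "(\<integral>x. f x \<partial>lebesgue) = (\<integral>x. f x \<partial>lborel)"
      using that by (auto simp: integrable_completion integral_completion)
    then have "f absolutely_integrable_on UNIV" by (simp add: set_integrable_def)
    then show ?thesis using set_lebesgue_integral_eq_integral(2)[of UNIV f] * by (simp add: set_lebesgue_integral_def)
  qed
  have "(\<integral>P. wpp (zz P) * (P $ i * \<phi>1 (\<Phi> P)) \<partial>lborel) = (\<integral>x. G x $ i * \<phi>1 x \<partial>lborel)"
  proof -
    have "\<Phi> ` UNIV = UNIV" using bij_Phi by (simp add: bij_is_surj)
    then show ?thesis
      using Phi_change_of_variables[of UNIV "\<lambda>x. G x $ i * \<phi>1 x" "\<integral>P. wpp (zz P) * (P $ i * \<phi>1 (\<Phi> P)) \<partial>lborel"]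
        leb[OF iC2] leb[OF iA(1)] by simp
  qed
  then show "(\<integral>x. u x * deriv_i (deriv_i \<phi>) x \<partial>lborel) = (\<integral>P. \<phi> (\<Phi> P) \<partial>lborel)"
    using A C iA iC iC2 by (simp add: \<phi>1_def \<phi>2_def)
qed

text \<open>Cutoffs that shrink to the null set \<open>N\<close> make the integrals against
  \<open>H\<close> tend to 0. By \<open>hessian_pushforward\<close> the same numbers are integrals
  of the cutoffs composed with \<open>\<Phi>\<close>, which remain at least half the measure of
  \<open>S0\<close>.\<close>

lemma not_W21: "\<not> W21_loc \<Omega> u"
proof
  assume "W21_loc \<Omega> u"
  then obtain H :: "real^'n \<Rightarrow> real^'n^'n" where H: "locally_integrable \<Omega> H" "represents_distributional_hessian \<Omega> u H"
    unfolding W21_loc_def by blast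
  define N where "N = \<Phi> ` S0"
  have N: "compact N" "N \<subseteq> \<Omega>" "N \<noteq> {}"
    using compact_N N_subset S0_nonempty by (auto simp: N_def)
  have "negligible N"
    unfolding N_def by (rule negligible_Phi) (use S0 in \<open>auto intro: borel_compact\<close>)
  then have Nnull: "AE x in lebesgue. x \<notin> N"
    by (auto simp: negligible_iff_null_sets AE_iff_null_sets[symmetric] intro: AE_not_in)
  obtain e where e: "e > 0" "(\<Union>x\<in>N. cball x e) \<subseteq> \<Omega>"
    using compact_subset_open_imp_cball_epsilon_subset[OF N(1) open_Omega N(2)] .
  define K where "K = {x. infdist x N \<le> e}"
  have KO: "K \<subseteq> \<Omega>"
  proof
    fix x assume x: "x \<in> K"
    obtain y where "y \<in> N" "infdist x N = dist x y"
      using infdist_attains_inf[OF compact_imp_closed[OF N(1)] N(3)] by blast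
    then have "x \<in> cball y e" using x by (simp add: K_def dist_commute)
    then show "x \<in> \<Omega>" using e(2) \<open>y \<in> N\<close> by blast
  qed
  have cid: "continuous_on UNIV (\<lambda>x. infdist x N)" by (intro continuous_intros)
  have "closed K" unfolding K_def using cid by (intro closed_Collect_le) auto
  then have K: "compact K"
    using bounded_subset[OF bounded_Omega KO] by (simp add: compact_eq_bounded_closed)
  \<comment> \<open>The neighbourhoods shrink to \<open>N\<close> inside one compact subset
    \<open>K\<close> of the domain, on which the integrability of \<open>H\<close> supplies a
    dominating function.\<close>
  define V where "V m = {x. infdist x N < e / real (Suc m)}" for m
  have V: "open (V m)" "N \<subseteq> V m" "V m \<subseteq> K" for m
  proof -
    show "open (V m)" unfolding V_def using cid by (intro open_Collect_less) auto
    show "N \<subseteq> V m" using e by (auto simp: V_def)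
    have "e / real (Suc m) \<le> e" using e by (simp add: field_simps)
    then show "V m \<subseteq> K" by (auto simp: V_def K_def)
  qed
  have "\<exists>\<phi>. \<phi> \<in> test_functions (V m) \<and> (\<forall>x. 0 \<le> \<phi> x \<and> \<phi> x \<le> 1) \<and> (\<forall>x\<in>N. 1/2 \<le> \<phi> x) \<and> smooth_alg \<phi>" for m
    by (rule test_function_exists[OF N(1) V(1)[of m] V(2)[of m]]) auto
  then obtain \<phi> where phi: "\<And>m. \<phi> m \<in> test_functions (V m)" "\<And>m x. 0 \<le> \<phi> m x" "\<And>m x. \<phi> m x \<le> 1"
    "\<And>m x. x \<in> N \<Longrightarrow> 1/2 \<le> \<phi> m x" "\<And>m. smooth_alg (\<phi> m)"
    by metis
  have supp: "\<phi> m x = 0" if "x \<notin> V m" for m x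
    using phi(1)[of m] that closure_subset[of "{x. \<phi> m x \<noteq> 0}"] by (auto simp: test_functions_def)
  have suppK: "\<phi> m x = 0" if "x \<notin> K" for m x
    using supp[of x m] V(3)[of m] that by blast
  have test: "\<phi> m \<in> test_functions \<Omega>" for m
    using phi(1)[of m] V(3)[of m] KO by (auto simp: test_functions_def)
  have ident: "(\<integral>P. \<phi> m (\<Phi> P) \<partial>lborel) = (LINT x:\<Omega>|lebesgue. H x $ i $ i * \<phi> m x)" for m
  proof -
    note hp = hessian_pushforward[OF phi(5) K suppK]
    have ind: "indicat_real \<Omega> x *\<^sub>R (u x * deriv_i (deriv_i (\<phi> m)) x) = u x * deriv_i (deriv_i (\<phi> m)) x" for x
      using hp(3)[of x m] KO by (cases "x \<in> K") (auto simp: indicator_def)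
    have "(LINT x:\<Omega>|lebesgue. u x * deriv_i (deriv_i (\<phi> m)) x) = (\<integral>x. u x * deriv_i (deriv_i (\<phi> m)) x \<partial>lebesgue)"
      by (simp only: set_lebesgue_integral_def ind)
    also have "\<dots> = (\<integral>x. u x * deriv_i (deriv_i (\<phi> m)) x \<partial>lborel)"
    proof (rule integral_completion)
      have "smooth_alg (deriv_i (deriv_i (\<phi> m)))"
        using phi(5)[of m] smooth_alg_step by (auto simp: deriv_i_def)
      then have "continuous_on UNIV (\<lambda>x. u x * deriv_i (deriv_i (\<phi> m)) x)"
        unfolding u_def[abs_def] by (intro continuous_intros continuous_U smooth_imp_continuous)
      then show "(\<lambda>x. u x * deriv_i (deriv_i (\<phi> m)) x) \<in> borel_measurable lborel"
        using borel_measurable_continuous_onI by simp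
    qed
    also have "\<dots> = (\<integral>P. \<phi> m (\<Phi> P) \<partial>lborel)" by (rule hp(1))
    finally show ?thesis
      using H(2) test[of m] unfolding represents_distributional_hessian_def deriv_i_def by simp
  qed
  have HK: "integrable lebesgue (\<lambda>x. indicator K x * H x $ i $ i)"
  proof -
    have "integrable lebesgue (\<lambda>x. indicator K x *\<^sub>R H x)"
      using H(1) K KO unfolding locally_integrable_def set_integrable_def by blast
    then have "integrable lebesgue (\<lambda>x. (indicator K x *\<^sub>R H x) $ i $ i)"
      by (intro integrable_bounded_linear[OF bounded_linear_vec_nth])
    then show ?thesis by simp
  qed
  have prod: "indicator \<Omega> x *\<^sub>R (H x $ i $ i * \<phi> m x) = (indicator K x * H x $ i $ i) * \<phi> m x" for x m
    using suppK[of x m] KO by (auto simp: indicator_def)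
  have "(\<lambda>m. \<integral>x. (indicator K x * H x $ i $ i) * \<phi> m x \<partial>lebesgue) \<longlonglongrightarrow> (\<integral>x. 0 \<partial>(lebesgue :: (real^'n) measure))"
  proof (rule integral_dominated_convergence[where w="\<lambda>x. norm (indicator K x * H x $ i $ i)"])
    show "integrable lebesgue (\<lambda>x. norm (indicator K x * H x $ i $ i))" using HK by (rule integrable_norm)
    show "(\<lambda>x. (indicator K x * H x $ i $ i) * \<phi> m x) \<in> borel_measurable lebesgue" for m
    proof (rule borel_measurable_times)
      show "(\<lambda>x. indicator K x * H x $ i $ i) \<in> borel_measurable lebesgue" using HK by (rule borel_measurable_integrable)
      have "\<phi> m \<in> borel_measurable borel"
        by (rule borel_measurable_continuous_onI[OF smooth_imp_continuous[OF phi(5)]])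
      then show "\<phi> m \<in> borel_measurable lebesgue" by (simp add: measurable_completion)
    qed
    show "AE x in lebesgue. norm (indicator K x * H x $ i $ i * \<phi> m x) \<le> norm (indicator K x * H x $ i $ i)" for m
      using phi(2,3)[of m] by (auto simp: abs_mult intro!: mult_left_le AE_I2)
    show "AE x in lebesgue. (\<lambda>m. indicator K x * H x $ i $ i * \<phi> m x) \<longlonglongrightarrow> 0"
      using Nnull
    proof eventually_elim
      case (elim x)
      have pos: "infdist x N > 0"
        using elim N by (metis compact_imp_closed in_closed_iff_infdist_zero infdist_nonneg order_le_less)
      have "(\<lambda>m. e * inverse (real (Suc m))) \<longlonglongrightarrow> e * 0"
        by (intro tendsto_mult tendsto_const LIMSEQ_inverse_real_of_nat)
      then have "\<forall>\<^sub>F m in sequentially. e * inverse (real (Suc m)) < infdist x N"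
        using pos by (intro order_tendstoD(2)) auto
      then have "\<forall>\<^sub>F m in sequentially. indicator K x * H x $ i $ i * \<phi> m x = 0"
      proof eventually_elim
        case (elim m)
        then have "x \<notin> V m" by (simp add: V_def divide_inverse)
        then show ?case by (simp add: supp)
      qed
      then show ?case by (rule tendsto_eventually)
    qed
  qed simp
  then have lim: "(\<lambda>m. \<integral>P. \<phi> m (\<Phi> P) \<partial>lborel) \<longlonglongrightarrow> 0"
    unfolding ident set_lebesgue_integral_def prod by simp
  have S0m: "emeasure lborel S0 < \<infinity>" "S0 \<in> sets borel"
    using S0(1) emeasure_bounded_finite[OF compact_imp_bounded[OF S0(1)]] by (auto intro: borel_compact)
  have "measure lborel S0 / 2 \<le> (\<integral>P. \<phi> m (\<Phi> P) \<partial>lborel)" for m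
  proof -
    have "measure lborel S0 / 2 = (\<integral>P. indicator S0 P * (1/2) \<partial>lborel)" using S0m by simp
    also have "\<dots> \<le> (\<integral>P. \<phi> m (\<Phi> P) \<partial>lborel)"
    proof (rule integral_mono)
      show "integrable lborel (\<lambda>P. \<phi> m (\<Phi> P))"
        by (rule hessian_pushforward(2)[OF phi(5) K suppK])
      show "integrable lborel (\<lambda>P. indicator S0 P * (1/2::real))" using S0m by simp
      show "indicator S0 P * (1/2) \<le> \<phi> m (\<Phi> P)" for P
        using phi(2)[of m "\<Phi> P"] phi(4)[of "\<Phi> P" m] by (auto simp: indicator_def N_def)
    qed
    finally show ?thesis .
  qed
  then have "measure lborel S0 / 2 \<le> 0"
    by (intro LIMSEQ_le_const[OF lim]) auto
  then have "measure lborel S0 = 0" using measure_nonneg[of lborel S0] by linarith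
  then have "emeasure lborel S0 = 0" using S0m by (auto simp: measure_def enn2real_eq_0_iff)
  then have "negligible S0"
    using S0m by (auto simp: negligible_iff_null_sets null_sets_def)
  then show False using S0(2) by simp
qed

theorem counterexample:
  "open \<Omega> \<and> convex \<Omega> \<and> bounded \<Omega> \<and> \<Omega> \<noteq> {} \<and>
   \<rho> \<in> borel_measurable (lebesgue_on \<Omega>) \<and> (\<forall>x\<in>\<Omega>. 0 \<le> \<rho> x \<and> \<rho> x \<le> 1) \<and>
   convex_on \<Omega> u \<and> continuous_on (closure \<Omega>) u \<and>
   alexandrov_solution \<Omega> \<rho> u \<and> (\<forall>x\<in>frontier \<Omega>. u x = 0) \<and> \<not> W21_loc \<Omega> u"
proof (intro conjI ballI)
  show "\<Omega> \<noteq> {}" using N_subset S0_nonempty by blast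
  show "\<rho> \<in> borel_measurable (lebesgue_on \<Omega>)"
    using rho_measurable by (simp add: measurable_completion measurable_restrict_space1)
  have "convex_on UNIV u"
    unfolding u_def[abs_def] using U_subgradient
    by (intro subgradient_imp_convex_on[where g="\<lambda>X. \<Psi> (G X)"]) (simp add: algebra_simps)
  then show "convex_on \<Omega> u" by (rule convex_on_subset) (auto simp: convex_Omega)
  show "continuous_on (closure \<Omega>) u" unfolding u_def[abs_def] by (intro continuous_intros continuous_U)
  show "alexandrov_solution \<Omega> \<rho> u" unfolding alexandrov_solution_def using monge_ampere_u by blast
qed (auto simp: open_Omega convex_Omega bounded_Omega rho_bounds frontier_Omega not_W21)

end

section \<open>The construction\<close>

text \<open>Compressing by the factor \<open>N\<close> divides \<open>k1\<close> by \<open>N\<close>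
  and \<open>k\<close> by the square of \<open>N\<close> but leaves the range of
  \<open>\<beta>\<close> unchanged. The height \<open>B\<close> therefore depends on
  \<open>\<epsilon>\<close> alone and is quantified before \<open>\<delta>\<close>, so that later
  \<open>\<delta> n\<close> may refer to \<open>B (Suc n)\<close>.\<close>

lemma scaled_spikes:
  assumes e: "0 < \<epsilon>" "\<epsilon> < 1/2"
  shows "\<exists>B\<ge>1. \<forall>\<delta>>0. \<exists>(N::nat) \<beta> k k1. N \<ge> 1 \<and> (\<forall>x. (k has_real_derivative k1 x) (at x)) \<and>
    (\<forall>x. (k1 has_real_derivative \<beta> x - 1) (at x)) \<and> continuous_on UNIV \<beta> \<and>
    (\<forall>x. 0 \<le> \<beta> x \<and> \<beta> x \<le> B) \<and> (\<forall>x. \<bar>k x\<bar> \<le> \<delta> \<and> \<bar>k1 x\<bar> \<le> \<delta>) \<and>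
    (\<forall>x y. y - x > \<delta> \<longrightarrow> (\<exists>z. x < z \<and> z < y \<and> \<beta> z > 0)) \<and>
    (\<forall>x. \<beta> x > 0 \<longrightarrow> (\<exists>m::int. \<bar>x - m / N\<bar> < \<epsilon> / N))"
proof -
  obtain B \<beta> k k1 where 1: "B \<ge> 1" "\<And>x. (k has_real_derivative k1 x) (at x)"
    "\<And>x. (k1 has_real_derivative \<beta> x - 1) (at x)" "continuous_on UNIV \<beta>"
    "\<And>x. 0 \<le> \<beta> x" "\<And>x. \<beta> x \<le> B" "\<And>x. \<bar>k x\<bar> \<le> B" "\<And>x. \<bar>k1 x\<bar> \<le> B"
    "\<And>x. \<beta> x > 0 \<Longrightarrow> \<exists>m::int. \<bar>x - m\<bar> < \<epsilon>" "\<And>m::int. \<beta> m > 0"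
    by (rule periodic_spikes[OF e], rule that)
  have "\<exists>(N::nat) \<beta> k k1. N \<ge> 1 \<and> (\<forall>x. (k has_real_derivative k1 x) (at x)) \<and>
    (\<forall>x. (k1 has_real_derivative \<beta> x - 1) (at x)) \<and> continuous_on UNIV \<beta> \<and>
    (\<forall>x. 0 \<le> \<beta> x \<and> \<beta> x \<le> B) \<and> (\<forall>x. \<bar>k x\<bar> \<le> \<delta> \<and> \<bar>k1 x\<bar> \<le> \<delta>) \<and>
    (\<forall>x y. y - x > \<delta> \<longrightarrow> (\<exists>z. x < z \<and> z < y \<and> \<beta> z > 0)) \<and>
    (\<forall>x. \<beta> x > 0 \<longrightarrow> (\<exists>m::int. \<bar>x - m / N\<bar> < \<epsilon> / N))" if d: "\<delta> > 0" for \<delta>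
  proof -
    obtain N0 :: nat where N0: "real N0 > B / \<delta>" using reals_Archimedean2 by blast
    define N where "N = Suc N0"
    have N: "N \<ge> 1" "real N \<ge> 1" "B / real N \<le> \<delta>"
      using N0 d 1(1) by (auto simp: N_def field_simps)
    have lin: "((\<lambda>x. real N * x) has_real_derivative real N) (at x)" for x
      by (auto intro!: derivative_eq_intros)
    have k1: "((\<lambda>x. k1 (N * x) / N) has_real_derivative \<beta> (N * x) - 1) (at x)" for x :: real
      by (rule DERIV_cong[OF DERIV_cdivide[OF DERIV_chain2[OF 1(3) lin]]]) (use N in simp)
    have k: "((\<lambda>x. k (N * x) / N\<^sup>2) has_real_derivative k1 (N * x) / N) (at x)" for x :: real
      by (rule DERIV_cong[OF DERIV_cdivide[OF DERIV_chain2[OF 1(2) lin]]]) (use N in \<open>simp add: power2_eq_square\<close>)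
    have b1: "\<bar>k1 (N * x) / N\<bar> \<le> \<delta>" for x :: real
    proof -
      have "\<bar>k1 (N * x)\<bar> / N \<le> B / N" using 1(8) N by (intro divide_right_mono) auto
      then show ?thesis using N by simp
    qed
    have b0: "\<bar>k (N * x) / N\<^sup>2\<bar> \<le> \<delta>" for x :: real
    proof -
      have "\<bar>k (N * x)\<bar> / (real N)\<^sup>2 \<le> B / (real N)\<^sup>2" using 1(7) N by (intro divide_right_mono) auto
      also have "\<dots> \<le> B / real N" using N 1(1) by (intro divide_left_mono) (auto simp: power2_eq_square)
      finally show ?thesis using N by simp
    qed
    have c: "continuous_on UNIV (\<lambda>x::real. \<beta> (N * x))"
      by (rule continuous_on_compose2[OF 1(4)]) (auto intro!: continuous_intros)
    have dense: "\<exists>z::real. x < z \<and> z < y \<and> \<beta> (N * z) > 0" if xy: "y - x > \<delta>" for x y :: real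
    proof -
      \<comment> \<open>The first multiple of \<open>1 / N\<close> beyond \<open>x\<close>; it lies
        before \<open>y\<close> because \<open>1 / N \<le> B / N \<le> \<delta>\<close>.\<close>
      define m where "m = \<lfloor>N * x\<rfloor> + 1"
      have m: "real_of_int m > N * x" "real_of_int m \<le> N * x + 1" unfolding m_def by linarith+
      have "1 / real N \<le> B / real N" using 1(1) N by (intro divide_right_mono) auto
      then have "1 / real N < y - x" using N xy by linarith
      then have "N * x + 1 < N * y" using N by (simp add: field_simps)
      then have "x < m / N" "m / N < y" using m N by (auto simp: field_simps)
      moreover have "\<beta> (N * (m / N)) > 0" using 1(10)[of m] N by simp
      ultimately show ?thesis by blast
    qed
    have near: "\<exists>m::int. \<bar>x - m / N\<bar> < \<epsilon> / N" if pos: "\<beta> (N * x) > 0" for x :: real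
    proof -
      obtain m :: int where m: "\<bar>N * x - m\<bar> < \<epsilon>" using 1(9)[OF pos] by blast
      have "\<bar>x - m / N\<bar> = \<bar>N * x - m\<bar> / N" using N by (simp add: field_simps abs_divide flip: abs_mult)
      also have "\<dots> < \<epsilon> / N" using m N by (intro divide_strict_right_mono) auto
      finally show ?thesis by blast
    qed
    show ?thesis
      by (rule exI[of _ N], rule exI[of _ "\<lambda>x::real. \<beta> (N * x)"], rule exI[of _ "\<lambda>x::real. k (N * x) / N\<^sup>2"],
          rule exI[of _ "\<lambda>x::real. k1 (N * x) / N"])
         (use N(1) k k1 c 1(5,6) b0 b1 dense near in auto)
  qed
  then show ?thesis using 1(1) by blast
qed

lemma has_derivative_product2:
  fixes g h :: "real \<Rightarrow> real"
  assumes g: "\<And>x. (g has_real_derivative g' x) (at x)" and h: "\<And>x. (h has_real_derivative h' x) (at x)"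
  shows "((\<lambda>z. c * h (snd z) * g (fst z)) has_derivative
    (\<lambda>d. c * h (snd z) * g' (fst z) * fst d + c * h' (snd z) * g (fst z) * snd d)) (at z)"
proof -
  have 1: "((\<lambda>z. g (fst z)) has_derivative (\<lambda>d. g' (fst z) * fst d)) (at z)"
    by (rule has_derivative_compose[OF has_derivative_fst[OF has_derivative_ident] g[unfolded has_field_derivative_def]])
  have 2: "((\<lambda>z. h (snd z)) has_derivative (\<lambda>d. h' (snd z) * snd d)) (at z)"
    by (rule has_derivative_compose[OF has_derivative_snd[OF has_derivative_ident] h[unfolded has_field_derivative_def]])
  note * = has_derivative_mult[OF has_derivative_mult_right[OF 2, of c] 1]
  show ?thesis by (rule has_derivative_eq_rhs[OF *]) (simp add: fun_eq_iff algebra_simps)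
qed

text \<open>
  The density \<open>\<beta> n\<close> has mean 1 and period \<open>1 / N n\<close>. The parameter \<open>\<delta> n\<close> has to be small compared
  with the weight of the next scale: this is what absorbs the second derivative of the cutoff \<open>\<psi> n\<close>,
  which lives where \<open>\<psi> (Suc n)\<close> already vanishes.
\<close>
locale spike_data =
  fixes B \<delta> :: "nat \<Rightarrow> real" and N :: "nat \<Rightarrow> nat" and \<beta> k k1 :: "nat \<Rightarrow> real \<Rightarrow> real"
    and \<theta> \<theta>1 \<theta>2 :: "real \<Rightarrow> real" and K :: real
  assumes B1: "\<And>n. B n \<ge> 1"
    and dk: "\<And>n x. (k n has_real_derivative k1 n x) (at x)"
    and dk1: "\<And>n x. (k1 n has_real_derivative \<beta> n x - 1) (at x)"
    and c\<beta>: "\<And>n. continuous_on UNIV (\<beta> n)"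
    and \<beta>0: "\<And>n x. 0 \<le> \<beta> n x" and \<beta>B: "\<And>n x. \<beta> n x \<le> B n"
    and k\<delta>: "\<And>n x. \<bar>k n x\<bar> \<le> \<delta> n" and k1\<delta>: "\<And>n x. \<bar>k1 n x\<bar> \<le> \<delta> n"
    and dense: "\<And>n x y. y - x > \<delta> n \<Longrightarrow> \<exists>z. x < z \<and> z < y \<and> \<beta> n z > 0"
    and near: "\<And>n x. \<beta> n x > 0 \<Longrightarrow> \<exists>m::int. \<bar>x - m / N n\<bar> < (1/2) ^ n / 16 / N n" and N1: "\<And>n. N n \<ge> 1"
    and d\<theta>: "\<And>s. (\<theta> has_real_derivative \<theta>1 s) (at s)" and d\<theta>1: "\<And>s. (\<theta>1 has_real_derivative \<theta>2 s) (at s)"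
    and c\<theta>2: "continuous_on UNIV \<theta>2"
    and \<theta>: "\<And>s. 0 \<le> \<theta> s" "\<And>s. \<theta> s \<le> 1" "\<And>s. s \<le> 1/2 \<Longrightarrow> \<theta> s = 1" "\<And>s. s \<ge> 1 \<Longrightarrow> \<theta> s = 0"
    "\<And>s. s \<le> 1/2 \<or> s \<ge> 1 \<Longrightarrow> \<theta>1 s = 0 \<and> \<theta>2 s = 0"
    and K: "K \<ge> 1" "\<And>s. \<bar>\<theta>1 s\<bar> \<le> K" "\<And>s. \<bar>\<theta>2 s\<bar> \<le> K"
    and \<delta>: "\<And>n. \<delta> n > 0" "\<And>n. \<delta> n \<le> (1/2) ^ n" "\<And>n. 16 * K * 4 ^ n * \<delta> n \<le> 1"
    "\<And>n. 16 * K * 4 ^ n * \<delta> n \<le> (1/2) ^ Suc n / B (Suc n) / 2"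
begin

section \<open>Cutoffs in \<open>y\<close> and the averaged mass\<close>

text \<open>Division by the height \<open>B n\<close> keeps the contribution of scale
  \<open>n\<close> to \<open>wpp\<close> below \<open>(1/2) ^ n\<close>, even on the spikes.\<close>

definition b where "b n = (1/2) ^ n / B n"
text \<open>Equal to 1 up to \<open>y\<^sup>2 = 1 + (1/2) ^ Suc n\<close> and to 0 from
  \<open>y\<^sup>2 = 1 + (1/2) ^ n\<close> on. The transition of \<open>\<psi> n\<close> thus begins
  exactly where that of \<open>\<psi> (Suc n)\<close> has ended.\<close>

definition \<psi> where "\<psi> n y = \<theta> (2 ^ n * (y\<^sup>2 - 1))"
definition \<psi>1 where "\<psi>1 n y = \<theta>1 (2 ^ n * (y\<^sup>2 - 1)) * (2 ^ n * (2 * y))"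
definition \<psi>2 where "\<psi>2 n y = \<theta>2 (2 ^ n * (y\<^sup>2 - 1)) * (2 ^ n * (2 * y))\<^sup>2 + \<theta>1 (2 ^ n * (y\<^sup>2 - 1)) * (2 ^ n * 2)"

lemma b: "b n > 0" "b n \<le> (1/2) ^ n" "b n \<le> 1" "b n * B n = (1/2) ^ n"
proof -
  show 0: "b n > 0" "b n \<le> (1/2) ^ n" "b n * B n = (1/2) ^ n"
    using B1[of n] by (auto simp: b_def divide_le_eq)
  have "(1/2::real) ^ n \<le> 1" by (simp add: power_le_one)
  then show "b n \<le> 1" using 0 by linarith
qed

lemma d\<psi>: "(\<psi> n has_real_derivative \<psi>1 n y) (at y)" "(\<psi>1 n has_real_derivative \<psi>2 n y) (at y)"
proof -
  have s: "((\<lambda>y. 2 ^ n * (y\<^sup>2 - 1)) has_real_derivative 2 ^ n * (2 * y)) (at y)"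
    "((\<lambda>y. 2 ^ n * (2 * y)) has_real_derivative 2 ^ n * 2) (at y)" for y :: real
    by (auto intro!: derivative_eq_intros)
  show "(\<psi> n has_real_derivative \<psi>1 n y) (at y)"
    unfolding \<psi>_def[abs_def] \<psi>1_def by (rule DERIV_chain2[OF d\<theta> s(1)])
  show "(\<psi>1 n has_real_derivative \<psi>2 n y) (at y)"
    unfolding \<psi>1_def[abs_def] \<psi>2_def
    by (rule DERIV_cong[OF DERIV_mult[OF DERIV_chain2[OF d\<theta>1 s(1)] s(2)]])
       (simp add: power2_eq_square algebra_simps)
qed

lemma \<psi>: "0 \<le> \<psi> n y" "\<psi> n y \<le> 1" "y\<^sup>2 \<le> 1 \<Longrightarrow> \<psi> n y = 1" "y\<^sup>2 \<ge> 2 \<Longrightarrow> \<psi> n y = 0"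
proof -
  show "0 \<le> \<psi> n y" "\<psi> n y \<le> 1" using \<theta> by (auto simp: \<psi>_def)
  show "\<psi> n y = 1" if "y\<^sup>2 \<le> 1"
  proof -
    have "2 ^ n * (y\<^sup>2 - 1) \<le> 0" using that by (simp add: mult_nonneg_nonpos)
    then show ?thesis unfolding \<psi>_def by (intro \<theta>(3)) linarith
  qed
  show "\<psi> n y = 0" if "y\<^sup>2 \<ge> 2"
  proof -
    have "1 * 1 \<le> 2 ^ n * (y\<^sup>2 - 1)" using that by (intro mult_mono) auto
    then show ?thesis unfolding \<psi>_def by (intro \<theta>(4)) linarith
  qed
qed

text \<open>The derivatives can be nonzero only if \<open>s = 2 ^ n * (y\<^sup>2 - 1)\<close> lies
  between 1/2 and 1. Then \<open>\<psi> (Suc n)\<close> has the argument \<open>2 * s > 1\<close>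
  and vanishes, so the factor \<open>1 - \<psi> (Suc n) y\<close> equals 1 and ties the error to the
  mass of the next scale.\<close>

lemma \<psi>_bounds: "\<bar>\<psi>1 n y\<bar> \<le> 16 * K * 4 ^ n" "\<bar>\<psi>2 n y\<bar> \<le> 16 * K * 4 ^ n * (1 - \<psi> (Suc n) y)"
proof -
  define s where "s = 2 ^ n * (y\<^sup>2 - 1)"
  have K0: "0 \<le> 16 * K * 4 ^ n" using K by simp
  have "\<bar>\<psi>1 n y\<bar> \<le> 16 * K * 4 ^ n \<and> \<bar>\<psi>2 n y\<bar> \<le> 16 * K * 4 ^ n * (1 - \<psi> (Suc n) y)"
  proof (cases "s \<le> 1/2 \<or> s \<ge> 1")
    case True
    then have "\<psi>1 n y = 0" "\<psi>2 n y = 0" using \<theta>(5) by (auto simp: \<psi>1_def \<psi>2_def s_def)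
    then show ?thesis using K0 \<psi>(2)[of "Suc n" y] by simp
  next
    case False
    then have s: "1/2 < s" "s < 1" by auto
    have "2 ^ Suc n * (y\<^sup>2 - 1) \<ge> 1" using s by (simp add: s_def)
    then have z: "\<psi> (Suc n) y = 0" unfolding \<psi>_def by (rule \<theta>(4))
    have "y\<^sup>2 < 2"
    proof (rule ccontr)
      assume "\<not> y\<^sup>2 < 2"
      then have "1 * 1 \<le> 2 ^ n * (y\<^sup>2 - 1)" by (intro mult_mono) auto
      then show False using s by (simp add: s_def)
    qed
    then have y2: "y\<^sup>2 \<le> 4" by simp
    have y: "\<bar>y\<bar> \<le> 2" by (rule power2_le_imp_le) (use y2 in auto)
    have p2: "(2::real) ^ n \<le> 4 ^ n" by (rule power_mono) auto
    have "\<bar>\<psi>1 n y\<bar> = \<bar>\<theta>1 s\<bar> * (2 ^ n * (2 * \<bar>y\<bar>))" by (simp add: \<psi>1_def s_def abs_mult)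
    also have "\<dots> \<le> K * (4 ^ n * (2 * 2))" using K y p2 by (intro mult_mono) auto
    finally have A: "\<bar>\<psi>1 n y\<bar> \<le> 16 * K * 4 ^ n" using K0 by simp
    have sq: "((2::real) ^ n * (2 * y))\<^sup>2 = 4 ^ n * (4 * y\<^sup>2)"
      by (simp add: power_mult_distrib power_mult[symmetric] mult.commute[of n 2]) (simp add: power_mult)
    have "\<bar>\<psi>2 n y\<bar> \<le> \<bar>\<theta>2 s\<bar> * (2 ^ n * (2 * y))\<^sup>2 + \<bar>\<theta>1 s\<bar> * (2 ^ n * 2)"
      unfolding \<psi>2_def s_def[symmetric] by (rule order_trans[OF abs_triangle_ineq]) (simp add: abs_mult)
    also have "\<dots> \<le> K * (4 ^ n * (4 * 2)) + K * (4 ^ n * 2)"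
      unfolding sq using K p2 \<open>y\<^sup>2 < 2\<close> by (intro add_mono mult_mono) auto
    finally have "\<bar>\<psi>2 n y\<bar> \<le> 16 * K * 4 ^ n" using K0 by simp
    then show ?thesis using A z by simp
  qed
  then show "\<bar>\<psi>1 n y\<bar> \<le> 16 * K * 4 ^ n" "\<bar>\<psi>2 n y\<bar> \<le> 16 * K * 4 ^ n * (1 - \<psi> (Suc n) y)" by auto
qed

lemma summable_half: "summable (\<lambda>n. (1/2::real) ^ n)"
  by (rule summable_geometric) simp

lemma summable_le_half: "(\<And>n. \<bar>f n\<bar> \<le> (1/2) ^ n) \<Longrightarrow> summable f" for f :: "nat \<Rightarrow> real"
  by (rule summable_comparison_test'[OF summable_half, of 0]) simp

text \<open>\<open>M\<close> is the value of \<open>wpp\<close> once all scales are averaged.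
  \<open>R y\<close> is the part already averaged at height \<open>y\<close>: it is 0 for
  \<open>y\<^sup>2 \<le> 1\<close> and \<open>M\<close> for
  \<open>y\<^sup>2 \<ge> 2\<close>.\<close>

definition M where "M = (\<Sum>n. b n)"
definition R where "R y = (\<Sum>n. b n * (1 - \<psi> n y))"

lemma R_term: "0 \<le> b n * (1 - \<psi> n y)" "\<bar>b n * (1 - \<psi> n y)\<bar> \<le> (1/2) ^ n"
proof -
  show 0: "0 \<le> b n * (1 - \<psi> n y)" using b(1)[of n] \<psi>(2)[of n y] by simp
  have "b n * (1 - \<psi> n y) \<le> b n * 1" using b(1)[of n] \<psi>(1)[of n y] by (intro mult_left_mono) auto
  then show "\<bar>b n * (1 - \<psi> n y)\<bar> \<le> (1/2) ^ n" using 0 b(2)[of n] by linarith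
qed

lemma summable_R: "summable (\<lambda>n. b n * (1 - \<psi> n y))" and summable_b: "summable b"
  using summable_le_half[of "\<lambda>n. b n * (1 - \<psi> n y)"] R_term(2) summable_le_half[of b] b(1,2)
  by (auto simp: abs_of_pos)

lemma M_pos: "M > 0"
  unfolding M_def by (rule suminf_pos[OF summable_b]) (use b in auto)

lemma R_nonneg: "R y \<ge> 0"
  unfolding R_def by (intro suminf_nonneg summable_R R_term)

lemma R_eq_M: "y\<^sup>2 \<ge> 2 \<Longrightarrow> R y = M"
  unfolding R_def M_def by (simp add: \<psi>)

lemma continuous_psi: "continuous_on UNIV (\<psi> n)" "continuous_on UNIV (\<psi>1 n)" "continuous_on UNIV (\<psi>2 n)"
proof -
  show "continuous_on UNIV (\<psi> n)" "continuous_on UNIV (\<psi>1 n)"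
    by (rule deriv_imp_continuous[OF d\<psi>(1)], rule deriv_imp_continuous[OF d\<psi>(2)])
  have "continuous_on UNIV \<theta>1" by (rule deriv_imp_continuous[OF d\<theta>1])
  then have "continuous_on UNIV (\<lambda>y::real. \<theta>1 (2 ^ n * (y\<^sup>2 - 1)))"
    by (rule continuous_on_compose2) (auto intro!: continuous_intros)
  moreover have "continuous_on UNIV (\<lambda>y::real. \<theta>2 (2 ^ n * (y\<^sup>2 - 1)))"
    by (rule continuous_on_compose2[OF c\<theta>2]) (auto intro!: continuous_intros)
  ultimately show "continuous_on UNIV (\<psi>2 n)"
    unfolding \<psi>2_def[abs_def] by (intro continuous_intros)
qed

lemma continuous_R: "continuous_on UNIV R"
  unfolding R_def[abs_def]
  by (rule continuous_suminf[OF _ R_term(2) summable_half]) (intro continuous_intros continuous_psi)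

text \<open>Half of \<open>R\<close> goes into the concave term; the other half is kept for the
  cutoff errors in \<open>tyy_sum\<close>. Starting the slope at 0 gives it opposite signs far out
  on the two sides.\<close>

definition \<eta>1 where "\<eta>1 = (SOME F. \<forall>y. (F has_real_derivative R y / 2) (at y) \<and> F 0 = 0)"
definition \<eta> where "\<eta> = (SOME F. \<forall>y. (F has_real_derivative \<eta>1 y) (at y))"

lemma d\<eta>1: "(\<eta>1 has_real_derivative R y / 2) (at y)" and \<eta>1_0: "\<eta>1 0 = 0"
proof -
  have "continuous_on UNIV (\<lambda>y. R y / 2)" using continuous_R by (intro continuous_intros) auto
  then obtain F where F: "\<forall>y. (F has_real_derivative R y / 2) (at y)" using antiderivative_exists by blast
  have "\<forall>y. ((\<lambda>y. F y - F 0) has_real_derivative R y / 2) (at y) \<and> F 0 - F 0 = 0"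
    using F by (auto intro!: derivative_eq_intros)
  then have "\<forall>y. (\<eta>1 has_real_derivative R y / 2) (at y) \<and> \<eta>1 0 = 0"
    unfolding \<eta>1_def by (rule someI[where P="\<lambda>F. \<forall>y. (F has_real_derivative R y / 2) (at y) \<and> F 0 = 0"])
  then show "(\<eta>1 has_real_derivative R y / 2) (at y)" "\<eta>1 0 = 0" by auto
qed

lemma d\<eta>: "(\<eta> has_real_derivative \<eta>1 y) (at y)"
proof -
  have "\<exists>F. \<forall>y. (F has_real_derivative \<eta>1 y) (at y)"
    by (rule antiderivative_exists) (rule deriv_imp_continuous[OF d\<eta>1])
  then have "\<forall>y. (\<eta> has_real_derivative \<eta>1 y) (at y)" unfolding \<eta>_def by (rule someI_ex)
  then show ?thesis by blast
qed

text \<open>\<open>\<eta>\<close> is convex with positive slope at 2 and negative slope at -2, and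
  it lies above its tangents at these two points.\<close>

lemma \<eta>_growth: "\<exists>c>0. \<exists>D. \<forall>y. \<eta> y \<ge> c * \<bar>y\<bar> - D"
proof -
  have tan: "\<eta> y \<ge> \<eta> a + \<eta>1 a * (y - a)" for a y
    by (rule above_tangent[OF d\<eta> d\<eta>1]) (simp add: R_nonneg)
  have mono: "\<eta>1 x \<le> \<eta>1 y" if "x \<le> y" for x y
  proof (rule DERIV_nonneg_imp_nondecreasing[OF that])
    show "\<exists>d. (\<eta>1 has_real_derivative d) (at z) \<and> 0 \<le> d" for z
      by (rule exI[of _ "R z / 2"]) (simp add: d\<eta>1 R_nonneg)
  qed
  \<comment> \<open>From \<open>3/2\<close> on \<open>R\<close> already equals \<open>M\<close>,
    because 9/4 exceeds 2. This leaves an interval of length 1/2 before 2, and its mirror image, on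
    which the slope grows strictly.\<close>
  have big: "z\<^sup>2 \<ge> 2" if "\<bar>z\<bar> \<ge> 3/2" for z :: real
  proof -
    have "(3/2)\<^sup>2 \<le> \<bar>z\<bar>\<^sup>2" using that by (intro power_mono) auto
    then show ?thesis by (simp add: power2_eq_square)
  qed
  have "\<exists>z. 3/2 < z \<and> z < 2 \<and> \<eta>1 2 - \<eta>1 (3/2) = (2 - 3/2) * (R z / 2)"
    by (rule MVT2[of "3/2" 2 \<eta>1 "\<lambda>z. R z / 2"]) (auto simp: d\<eta>1)
  then obtain z where "3/2 < z" "\<eta>1 2 - \<eta>1 (3/2) = (2 - 3/2) * (R z / 2)" by blast
  then have p: "\<eta>1 2 > 0" using R_eq_M[OF big, of z] M_pos mono[of 0 "3/2"] \<eta>1_0 by simp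
  have "\<exists>z. -2 < z \<and> z < -(3/2) \<and> \<eta>1 (-(3/2)) - \<eta>1 (-2) = (-(3/2) - (-2)) * (R z / 2)"
    by (rule MVT2[of "-2" "-(3/2)" \<eta>1 "\<lambda>z. R z / 2"]) (auto simp: d\<eta>1)
  then obtain z' where "z' < -(3/2)" "\<eta>1 (-(3/2)) - \<eta>1 (-2) = (-(3/2) - (-2)) * (R z' / 2)" by blast
  then have n: "\<eta>1 (-2) < 0" using R_eq_M[OF big, of z'] M_pos mono[of "-(3/2)" 0] \<eta>1_0 by simp
  define c where "c = min (\<eta>1 2) (- \<eta>1 (-2))"
  define D where "D = \<bar>\<eta> 2 - \<eta>1 2 * 2\<bar> + \<bar>\<eta> (-2) + \<eta>1 (-2) * 2\<bar>"
  have "\<eta> y \<ge> c * \<bar>y\<bar> - D" for y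
  proof (cases "y \<ge> 0")
    case True
    have "c * y \<le> \<eta>1 2 * y" using True by (intro mult_right_mono) (auto simp: c_def)
    then show ?thesis using tan[of 2 y] True by (simp add: D_def algebra_simps)
  next
    case False
    have "c * (- y) \<le> (- \<eta>1 (-2)) * (- y)" using False by (intro mult_right_mono) (auto simp: c_def)
    then show ?thesis using tan[of "-2" y] False by (simp add: D_def algebra_simps)
  qed
  moreover have "c > 0" using p n by (simp add: c_def)
  ultimately show ?thesis by blast
qed

section \<open>The series for \<open>w\<close> and its derivatives\<close>

text \<open>Since \<open>k n\<close> is a second antiderivative of \<open>\<beta> n - 1\<close>,
  adding this term turns the uniform mass \<open>b n\<close> in the second derivative in
  \<open>p\<close> into spikes wherever \<open>\<psi> n\<close> is 1.\<close>

definition t where "t n z = b n * \<psi> n (snd z) * k n (fst z)"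
definition tp where "tp n z = b n * \<psi> n (snd z) * k1 n (fst z)"
definition ty where "ty n z = b n * \<psi>1 n (snd z) * k n (fst z)"
definition tpp where "tpp n z = b n * \<psi> n (snd z) * (\<beta> n (fst z) - 1)"
definition tpy where "tpy n z = b n * \<psi>1 n (snd z) * k1 n (fst z)"
definition tyy where "tyy n z = b n * \<psi>2 n (snd z) * k n (fst z)"

lemma t_derivs:
  "(t n has_derivative (\<lambda>h. tp n z * fst h + ty n z * snd h)) (at z)"
  "(tp n has_derivative (\<lambda>h. tpp n z * fst h + tpy n z * snd h)) (at z)"
  "(ty n has_derivative (\<lambda>h. tpy n z * fst h + tyy n z * snd h)) (at z)"
  unfolding t_def[abs_def] tp_def[abs_def] ty_def[abs_def] tpp_def tpy_def tyy_def
  by (rule has_derivative_product2[OF dk d\<psi>(1)], rule has_derivative_product2[OF dk1 d\<psi>(1)],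
      rule has_derivative_product2[OF dk d\<psi>(2)])

lemma bound_half: "\<bar>b n * x * y\<bar> \<le> (1/2) ^ n" if "\<bar>x\<bar> * \<bar>y\<bar> \<le> 1"
proof -
  have "\<bar>b n * x * y\<bar> = b n * (\<bar>x\<bar> * \<bar>y\<bar>)" using b(1)[of n] by (simp add: abs_mult)
  also have "\<dots> \<le> b n * 1" using b(1)[of n] that by (intro mult_left_mono) auto
  finally show ?thesis using b(2)[of n] by linarith
qed

lemma \<psi>2_bound: "\<bar>\<psi>2 n y\<bar> \<le> 16 * K * 4 ^ n"
proof -
  have "16 * K * 4 ^ n * (1 - \<psi> (Suc n) y) \<le> 16 * K * 4 ^ n * 1"
    using K \<psi>(1)[of "Suc n" y] by (intro mult_left_mono) auto
  then show ?thesis using \<psi>_bounds(2)[of n y] by linarith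
qed

lemma t_bounds: "\<bar>t n z\<bar> \<le> (1/2) ^ n" "\<bar>tp n z\<bar> \<le> (1/2) ^ n" "\<bar>ty n z\<bar> \<le> (1/2) ^ n"
  "\<bar>tpp n z\<bar> \<le> (1/2) ^ n" "\<bar>tpy n z\<bar> \<le> (1/2) ^ n" "\<bar>tyy n z\<bar> \<le> (1/2) ^ n"
proof -
  have d1: "\<delta> n \<le> 1" using \<delta>(2)[of n] power_le_one[of "1/2::real" n] by simp
  have p: "\<bar>\<psi> n y\<bar> * \<bar>x\<bar> \<le> 1" if "\<bar>x\<bar> \<le> \<delta> n" for x y
  proof -
    have "\<bar>\<psi> n y\<bar> * \<bar>x\<bar> \<le> 1 * 1" using \<psi>(1,2)[of n y] that d1 by (intro mult_mono) auto
    then show ?thesis by simp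
  qed
  have q: "\<bar>f\<bar> * \<bar>x\<bar> \<le> 1" if "\<bar>f\<bar> \<le> 16 * K * 4 ^ n" "\<bar>x\<bar> \<le> \<delta> n" for x f
  proof -
    have "\<bar>f\<bar> * \<bar>x\<bar> \<le> (16 * K * 4 ^ n) * \<delta> n" by (rule mult_mono[OF that]) (use K in auto)
    then show ?thesis using \<delta>(3)[of n] by linarith
  qed
  show "\<bar>t n z\<bar> \<le> (1/2) ^ n" "\<bar>tp n z\<bar> \<le> (1/2) ^ n"
    unfolding t_def tp_def by (rule bound_half, rule p, rule k\<delta>, rule bound_half, rule p, rule k1\<delta>)
  show "\<bar>ty n z\<bar> \<le> (1/2) ^ n" "\<bar>tpy n z\<bar> \<le> (1/2) ^ n" "\<bar>tyy n z\<bar> \<le> (1/2) ^ n"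
    unfolding ty_def tpy_def tyy_def
    by (rule bound_half, rule q, rule \<psi>_bounds, rule k\<delta>, rule bound_half, rule q, rule \<psi>_bounds, rule k1\<delta>,
        rule bound_half, rule q, rule \<psi>2_bound, rule k\<delta>)
  have "\<bar>tpp n z\<bar> = b n * (\<psi> n (snd z) * \<bar>\<beta> n (fst z) - 1\<bar>)"
    using b(1)[of n] \<psi>(1)[of n "snd z"] by (simp add: tpp_def abs_mult)
  also have "\<dots> \<le> b n * (1 * B n)"
    using b(1)[of n] \<psi>(1,2)[of n "snd z"] \<beta>0[of n "fst z"] \<beta>B[of n "fst z"] B1[of n]
    by (intro mult_left_mono mult_mono) auto
  finally show "\<bar>tpp n z\<bar> \<le> (1/2) ^ n" using b(4)[of n] by simp
qed

lemma summable_tpp: "summable (\<lambda>n. tpp n z)"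
  by (rule summable_le_half, rule t_bounds)

lemma t_continuous: "continuous_on UNIV (tpp n)" "continuous_on UNIV (tyy n)"
proof -
  note fs = continuous_on_fst[OF continuous_on_id] continuous_on_snd[OF continuous_on_id]
  have "continuous_on UNIV (\<lambda>z::real \<times> real. \<psi> n (snd z))"
    by (rule continuous_on_compose2[OF continuous_psi(1) fs(2)]) simp
  moreover have "continuous_on UNIV (\<lambda>z::real \<times> real. \<psi>2 n (snd z))"
    by (rule continuous_on_compose2[OF continuous_psi(3) fs(2)]) simp
  moreover have "continuous_on UNIV (\<lambda>z::real \<times> real. \<beta> n (fst z))"
    by (rule continuous_on_compose2[OF c\<beta> fs(1)]) simp
  moreover have "continuous_on UNIV (\<lambda>z::real \<times> real. k n (fst z))"
    by (rule continuous_on_compose2[OF deriv_imp_continuous[OF dk, of UNIV] fs(1)]) simp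
  ultimately show "continuous_on UNIV (tpp n)" "continuous_on UNIV (tyy n)"
    unfolding tpp_def[abs_def] tyy_def[abs_def] by (intro continuous_intros; simp)+
qed

definition w where "w z = M / 2 * (fst z)\<^sup>2 - \<eta> (snd z) + (\<Sum>n. t n z)"
definition wp where "wp z = M * fst z + (\<Sum>n. tp n z)"
definition wy where "wy z = - \<eta>1 (snd z) + (\<Sum>n. ty n z)"
definition wpp where "wpp z = M + (\<Sum>n. tpp n z)"
definition wpy where "wpy z = (\<Sum>n. tpy n z)"
definition wyy where "wyy z = - (R (snd z) / 2) + (\<Sum>n. tyy n z)"

lemma w_derivs:
  "(w has_derivative (\<lambda>h. wp z * fst h + wy z * snd h)) (at z)"
  "(wp has_derivative (\<lambda>h. wpp z * fst h + wpy z * snd h)) (at z)"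
  "(wy has_derivative (\<lambda>h. wpy z * fst h + wyy z * snd h)) (at z)"
proof -
  have e: "((\<lambda>z. f (snd z)) has_derivative (\<lambda>h. f' (snd z) * snd h)) (at z)"
    if "\<And>x. (f has_real_derivative f' x) (at x)" for f f' :: "real \<Rightarrow> real"
    by (rule has_derivative_compose[OF has_derivative_snd[OF has_derivative_ident] that[unfolded has_field_derivative_def]])
  have f: "((\<lambda>z::real \<times> real. M / 2 * (fst z)\<^sup>2) has_derivative (\<lambda>h. M * fst z * fst h)) (at z)"
    "((\<lambda>z::real \<times> real. M * fst z) has_derivative (\<lambda>h. M * fst h)) (at z)"
    by (auto intro!: derivative_eq_intros simp: power2_eq_square)
  show "(w has_derivative (\<lambda>h. wp z * fst h + wy z * snd h)) (at z)"
    unfolding w_def[abs_def]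
    by (rule has_derivative_eq_rhs[OF has_derivative_add[OF has_derivative_diff[OF f(1) e[OF d\<eta>]]
          has_derivative_suminf2[OF t_derivs(1) t_bounds(1-3) summable_half]]])
       (simp add: fun_eq_iff wp_def wy_def algebra_simps)
  show "(wp has_derivative (\<lambda>h. wpp z * fst h + wpy z * snd h)) (at z)"
    unfolding wp_def[abs_def]
    by (rule has_derivative_eq_rhs[OF has_derivative_add[OF f(2)
          has_derivative_suminf2[OF t_derivs(2) t_bounds(2,4,5) summable_half]]])
       (simp add: fun_eq_iff wpp_def wpy_def algebra_simps)
  show "(wy has_derivative (\<lambda>h. wpy z * fst h + wyy z * snd h)) (at z)"
    unfolding wy_def[abs_def]
    by (rule has_derivative_eq_rhs[OF has_derivative_add[OF has_derivative_minus[OF e[OF d\<eta>1]]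
          has_derivative_suminf2[OF t_derivs(3) t_bounds(3,5,6) summable_half]]])
       (simp add: fun_eq_iff wpy_def wyy_def algebra_simps)
qed

text \<open>Distributing \<open>M\<close> over the scales shows each term as \<open>b n\<close>
  times a convex combination of \<open>\<beta> n\<close> and 1; nonnegativity and the zero set can
  be read off.\<close>

lemma wpp_eq: "wpp z = (\<Sum>n. b n * \<psi> n (snd z) * \<beta> n (fst z) + b n * (1 - \<psi> n (snd z)))"
  and summable_wpp: "summable (\<lambda>n. b n * \<psi> n (snd z) * \<beta> n (fst z) + b n * (1 - \<psi> n (snd z)))"
proof -
  have "b n * \<psi> n (snd z) * \<beta> n (fst z) + b n * (1 - \<psi> n (snd z)) = b n + tpp n z" for n
    by (simp add: tpp_def algebra_simps)
  then show "wpp z = (\<Sum>n. b n * \<psi> n (snd z) * \<beta> n (fst z) + b n * (1 - \<psi> n (snd z)))"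
    "summable (\<lambda>n. b n * \<psi> n (snd z) * \<beta> n (fst z) + b n * (1 - \<psi> n (snd z)))"
    using suminf_add[OF summable_b summable_tpp] summable_add[OF summable_b summable_tpp]
    by (simp_all add: wpp_def M_def)
qed

lemma wpp_term: "0 \<le> b n * \<psi> n (snd z) * \<beta> n (fst z)"
  using b(1)[of n] \<psi>(1)[of n "snd z"] \<beta>0[of n "fst z"] by simp

lemma wpp_ge_R: "R (snd z) \<le> wpp z"
  unfolding wpp_eq R_def by (intro suminf_le summable_R summable_wpp) (simp add: wpp_term)

lemma wpp_zero: "wpp z = 0 \<Longrightarrow> \<psi> n (snd z) = 1 \<and> \<beta> n (fst z) = 0"
proof -
  assume "wpp z = 0"
  then have "(\<Sum>n. b n * \<psi> n (snd z) * \<beta> n (fst z) + b n * (1 - \<psi> n (snd z))) = 0" by (simp add: wpp_eq)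
  moreover have nn: "0 \<le> b n * \<psi> n (snd z) * \<beta> n (fst z) + b n * (1 - \<psi> n (snd z))" for n
    by (intro add_nonneg_nonneg wpp_term R_term(1))
  ultimately have "b n * \<psi> n (snd z) * \<beta> n (fst z) + b n * (1 - \<psi> n (snd z)) = 0"
    using suminf_eq_zero_iff[OF summable_wpp nn] by blast
  then have "b n * \<psi> n (snd z) * \<beta> n (fst z) = 0" "b n * (1 - \<psi> n (snd z)) = 0"
    using wpp_term[of n z] R_term(1)[of n "snd z"] by linarith+
  then show "\<psi> n (snd z) = 1 \<and> \<beta> n (fst z) = 0" using b(1)[of n] by auto
qed

text \<open>By the choice of \<open>\<delta> n\<close>, the error of scale \<open>n\<close> is at
  most half of the mass averaged at scale \<open>Suc n\<close>. Summation gives half of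
  \<open>R\<close> without its term of index 0.\<close>

lemma tyy_sum: "\<bar>\<Sum>n. tyy n z\<bar> \<le> R (snd z) / 2"
proof -
  define y where "y = snd z"
  have le: "\<bar>tyy n z\<bar> \<le> b (Suc n) * (1 - \<psi> (Suc n) y) / 2" for n
  proof -
    have "\<bar>tyy n z\<bar> = b n * (\<bar>\<psi>2 n y\<bar> * \<bar>k n (fst z)\<bar>)"
      using b(1)[of n] by (simp add: tyy_def y_def abs_mult)
    also have "\<dots> \<le> 1 * ((16 * K * 4 ^ n * (1 - \<psi> (Suc n) y)) * \<delta> n)"
      using b(1,3)[of n] \<psi>_bounds(2)[of n y] k\<delta>[of n "fst z"] K \<psi>(2)[of "Suc n" y]
      by (intro mult_mono) auto
    also have "\<dots> = (16 * K * 4 ^ n * \<delta> n) * (1 - \<psi> (Suc n) y)" by simp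
    also have "\<dots> \<le> (b (Suc n) / 2) * (1 - \<psi> (Suc n) y)"
      using \<delta>(4)[of n] \<psi>(2)[of "Suc n" y] by (intro mult_right_mono) (auto simp: b_def)
    finally show ?thesis by simp
  qed
  have s: "summable (\<lambda>n. b (Suc n) * (1 - \<psi> (Suc n) y))" using summable_R[of y] by (subst summable_Suc_iff)
  have "\<bar>\<Sum>n. tyy n z\<bar> \<le> (\<Sum>n. \<bar>tyy n z\<bar>)"
    by (rule summable_rabs) (rule summable_le_half, simp only: abs_idempotent t_bounds(6))
  also have "\<dots> \<le> (\<Sum>n. b (Suc n) * (1 - \<psi> (Suc n) y) / 2)"
    by (intro suminf_le le summable_divide s) (rule summable_le_half, simp only: abs_idempotent t_bounds(6))
  also have "\<dots> = (\<Sum>n. b (Suc n) * (1 - \<psi> (Suc n) y)) / 2" by (rule suminf_divide[OF s])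
  also have "\<dots> \<le> R y / 2"
    using suminf_split_head[OF summable_R[of y]] R_term(1)[of 0 y] by (simp add: R_def)
  finally show ?thesis by (simp add: y_def)
qed

text \<open>Equal values at both ends would make \<open>wp\<close> constant in between and
  \<open>wpp\<close> zero there. But some \<open>\<delta> n\<close> is smaller than
  \<open>q - p\<close>, so a spike of that scale meets the interval, which \<open>wpp_zero\<close>
  excludes.\<close>

lemma wp_strict: "p < q \<Longrightarrow> wp (p, y) < wp (q, y)"
proof -
  assume pq: "p < q"
  have d: "((\<lambda>p. wp (p, y)) has_real_derivative wpp (p, y)) (at p)" for p
  proof -
    have "((\<lambda>p. (p, y)) has_derivative (\<lambda>h. (h, 0))) (at p)" by (intro derivative_intros)
    from has_derivative_compose[OF this w_derivs(2)] show ?thesis by (simp add: has_field_derivative_def)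
  qed
  have nn: "wpp z \<ge> 0" for z using wpp_ge_R[of z] R_nonneg[of "snd z"] by linarith
  have mono: "wp (x, y) \<le> wp (x', y)" if "x \<le> x'" for x x'
  proof (rule DERIV_nonneg_imp_nondecreasing[OF that, of "\<lambda>p. wp (p, y)"])
    show "\<exists>d. ((\<lambda>p. wp (p, y)) has_real_derivative d) (at z) \<and> 0 \<le> d" for z
      by (rule exI[of _ "wpp (z, y)"]) (simp add: d nn)
  qed
  show ?thesis
  proof (rule ccontr)
    assume "\<not> wp (p, y) < wp (q, y)"
    then have const: "wp (x, y) = wp (p, y)" if "p \<le> x" "x \<le> q" for x
      using mono[OF that(1)] mono[OF that(2)] by linarith
    obtain n where "(1/2::real) ^ n < q - p" using real_arch_pow_inv[of "q - p" "1/2"] pq by auto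
    then have "\<delta> n < q - p" using \<delta>(2)[of n] by linarith
    then obtain x where x: "p < x" "x < q" "\<beta> n x > 0" using dense[of n q p] by blast
    have "((\<lambda>_. wp (p, y)) has_real_derivative wpp (x, y)) (at x)"
    proof (rule has_field_derivative_transform_within_open[OF d, of "{p<..<q}"])
      show "wp (x', y) = wp (p, y)" if "x' \<in> {p<..<q}" for x' using const[of x'] that by simp
    qed (use x in auto)
    then have "wpp (x, y) = 0" using DERIV_unique[OF _ DERIV_const] by blast
    then show False using wpp_zero[of "(x, y)" n] x(3) by simp
  qed
qed

lemma sum_half_le: "\<bar>\<Sum>n. f n\<bar> \<le> 2" if "\<And>n. \<bar>f n\<bar> \<le> (1/2) ^ n" for f :: "nat \<Rightarrow> real"
proof -
  have "\<bar>\<Sum>n. f n\<bar> \<le> (\<Sum>n. \<bar>f n\<bar>)"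
    by (rule summable_rabs) (rule summable_le_half, simp only: abs_idempotent that)
  also have "\<dots> \<le> (\<Sum>n. (1/2) ^ n)"
    by (intro suminf_le that summable_half) (rule summable_le_half, simp only: abs_idempotent that)
  also have "\<dots> = 2" using suminf_geometric[of "1/2::real"] by simp
  finally show ?thesis .
qed

text \<open>The oscillating series is dominated by a geometric one of sum 2, so \<open>wp\<close>
  stays within distance 2 of \<open>M * p\<close> and the intermediate value theorem
  applies.\<close>

lemma wp_onto: "\<exists>p. wp (p, y) = x"
proof -
  have b: "\<bar>wp (p, y) - M * p\<bar> \<le> 2" for p
    using sum_half_le[of "\<lambda>n. tp n (p, y)"] t_bounds(2) by (simp add: wp_def)
  have c: "continuous_on {(x - 2) / M..(x + 2) / M} (\<lambda>p. wp (p, y))"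
  proof (rule continuous_on_compose2[of UNIV wp _ "\<lambda>p. (p, y)"])
    show "continuous_on UNIV wp"
      by (intro continuous_at_imp_continuous_on ballI has_derivative_continuous[OF w_derivs(2)])
  qed (auto intro!: continuous_intros)
  have "wp ((x - 2) / M, y) \<le> x" "x \<le> wp ((x + 2) / M, y)"
    using b[of "(x - 2) / M"] b[of "(x + 2) / M"] M_pos by (auto simp: abs_le_iff)
  moreover have "(x - 2) / M \<le> (x + 2) / M" using M_pos by (intro divide_right_mono) auto
  ultimately show ?thesis using IVT'[of "\<lambda>p. wp (p, y)", OF _ _ _ c] by blast
qed

lemma wpp_continuous: "continuous_on UNIV wpp" and wyy_continuous: "continuous_on UNIV wyy"
proof -
  show "continuous_on UNIV wpp" unfolding wpp_def[abs_def]
    by (intro continuous_intros continuous_suminf[OF t_continuous(1) t_bounds(4) summable_half])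
  have "continuous_on UNIV (\<lambda>z::real \<times> real. R (snd z))"
    by (rule continuous_on_compose2[OF continuous_R]) (auto intro!: continuous_intros)
  then show "continuous_on UNIV wyy" unfolding wyy_def[abs_def]
    by (intro continuous_intros continuous_suminf[OF t_continuous(2) t_bounds(6) summable_half]) auto
qed

section \<open>The common zero set of the spikes\<close>

text \<open>A fat Cantor set in coordinate \<open>i\<close> times unit intervals in the other
  coordinates. The unit cube lies in the strip \<open>y\<^sup>2 \<le> 1\<close>, where no scale is
  averaged yet, so \<open>wpp\<close> vanishes here.\<close>

definition spike_free :: "'n \<Rightarrow> (real^'n::finite) set" where
  "spike_free i = {P \<in> cbox 0 1. \<forall>n. \<beta> n (P $ i) = 0}"

lemma compact_spike_free:
  fixes i :: "'n::finite"
  shows "compact (spike_free i)"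
proof -
  have "closed {P :: real^'n. \<beta> n (P $ i) = 0}" for n
    by (intro closed_Collect_eq continuous_on_compose2[OF c\<beta>]) (auto intro!: continuous_intros)
  then have "closed (\<Inter>n. {P :: real^'n. \<beta> n (P $ i) = 0})" by (intro closed_INT) auto
  then have "compact (cbox 0 1 \<inter> (\<Inter>n. {P :: real^'n. \<beta> n (P $ i) = 0}))" by (intro compact_Int_closed compact_cbox)
  also have "cbox 0 1 \<inter> (\<Inter>n. {P :: real^'n. \<beta> n (P $ i) = 0}) = spike_free i" by (auto simp: spike_free_def)
  finally show ?thesis .
qed

text \<open>At scale \<open>n\<close> the cube meets at most \<open>N n + 1 \<le> 2 * N n\<close>
  slabs of width \<open>2 * r n\<close>, of total volume at most \<open>(1/2) ^ n / 4\<close>. The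
  sum over all scales is at most 1/2, less than the volume of the cube; the factor 1/16 in the spike
  width is chosen for this.\<close>

lemma not_negligible_spike_free:
  fixes i :: "'n::finite"
  shows "\<not> negligible (spike_free i)"
proof
  assume neg: "negligible (spike_free i :: (real^'n) set)"
  define r where "r n = (1/2) ^ n / 16 / real (N n)" for n
  define Q :: "nat \<Rightarrow> nat \<Rightarrow> (real^'n) set" where
    "Q n m = cbox (\<chi> l. if l = i then m / N n - r n else 0) (\<chi> l. if l = i then m / N n + r n else 1)" for n m
  have r: "r n > 0" "r n * N n = (1/2) ^ n / 16" "r n * N n < 1" for n
  proof -
    show "r n > 0" "r n * N n = (1/2) ^ n / 16" using N1[of n] by (auto simp: r_def)
    then show "r n * N n < 1" using power_le_one[of "1/2::real" n] by simp
  qed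
  have mQ: "emeasure lborel (Q n m) = ennreal (2 * r n)" for n m
  proof -
    have "measure lborel (Q n m) = (\<Prod>l\<in>UNIV. (if l = i then m / N n + r n else 1) - (if l = i then m / N n - r n else 0))"
      unfolding Q_def using r(1)[of n]
      by (subst content_cbox_cart) (auto simp: interval_ne_empty_cart)
    also have "\<dots> = (\<Prod>l\<in>UNIV. if l = i then 2 * r n else 1)"
      by (intro prod.cong) auto
    also have "\<dots> = 2 * r n" by (simp add: prod.delta)
    finally show ?thesis unfolding Q_def by (subst emeasure_eq_ennreal_measure) (auto simp: emeasure_lborel_cbox_eq)
  qed
  \<comment> \<open>Both ends of the unit interval are spike centres, so the index runs from 0 to
    \<open>N n\<close> inclusive.\<close>
  define bad where "bad n = (\<Union>m\<le>N n. Q n m)" for n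
  have mbad: "emeasure lborel (bad n) \<le> ennreal ((1/2) ^ n / 4)" for n
  proof -
    have "emeasure lborel (bad n) \<le> (\<Sum>m\<le>N n. emeasure lborel (Q n m))"
      unfolding bad_def by (rule emeasure_subadditive_finite) (auto simp: Q_def)
    also have "\<dots> = ennreal (real (Suc (N n)) * (2 * r n))"
      using r(1)[of n] by (simp add: mQ ennreal_of_nat_eq_real_of_nat ennreal_mult'')
    also have "\<dots> \<le> ennreal ((1/2) ^ n / 4)"
    proof (rule ennreal_leI)
      have "real (Suc (N n)) * (2 * r n) \<le> (2 * real (N n)) * (2 * r n)"
        using N1[of n] r(1)[of n] by (intro mult_right_mono) auto
      also have "\<dots> = (1/2) ^ n / 4" using r(2)[of n] by (simp add: algebra_simps)
      finally show "real (Suc (N n)) * (2 * r n) \<le> (1/2) ^ n / 4" .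
    qed
    finally show ?thesis .
  qed
  have cover: "cbox 0 (1::real^'n) \<subseteq> spike_free i \<union> (\<Union>n. bad n)"
  proof
    fix P :: "real^'n" assume P: "P \<in> cbox 0 1"
    then have P01: "0 \<le> P $ l \<and> P $ l \<le> 1" for l by (simp add: mem_box_cart)
    show "P \<in> spike_free i \<union> (\<Union>n. bad n)"
    proof (cases "\<forall>n. \<beta> n (P $ i) = 0")
      case False
      then obtain n where n: "\<beta> n (P $ i) > 0" using \<beta>0 by (metis order_le_less)
      obtain m :: int where m: "\<bar>P $ i - m / N n\<bar> < r n" using near[OF n] by (auto simp: r_def)
      have Nn: "real (N n) > 0" using N1[of n] by simp
      have "\<bar>N n * (P $ i) - m\<bar> = N n * \<bar>P $ i - m / N n\<bar>"
        using Nn by (simp add: abs_mult_pos' right_diff_distrib)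
      also have "\<dots> < 1" using m Nn r(3)[of n] by (smt (verit) mult.commute mult_strict_left_mono)
      finally have mm: "\<bar>N n * (P $ i) - m\<bar> < 1" .
      have "0 \<le> N n * (P $ i)" "N n * (P $ i) \<le> N n" using P01[of i] Nn by (auto simp: mult_left_le)
      then have "real_of_int m > -1" "real_of_int m < real (N n) + 1" using mm by linarith+
      then have "0 \<le> m" "nat m \<le> N n" by linarith+
      then have "P \<in> Q n (nat m)" using m P01 by (auto simp: Q_def mem_box_cart abs_less_iff)
      then show ?thesis using \<open>nat m \<le> N n\<close> by (auto simp: bad_def)
    qed (use P in \<open>simp add: spike_free_def\<close>)
  qed
  have bs: "bad n \<in> sets lborel" for n by (auto simp: bad_def Q_def)
  have s0: "emeasure lborel (spike_free i :: (real^'n) set) = 0"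
    using neg borel_compact[OF compact_spike_free[of i]] by (auto simp: negligible_iff_null_sets null_sets_def)
  have e1: "(\<Sum>n. ennreal ((1/2) ^ n / 4)) = ennreal (1/2)"
  proof -
    have s: "(\<lambda>n. (1/2::real) ^ n / 4) sums (1/2)"
      using sums_divide[OF geometric_sums[of "1/2::real"], of 4] by simp
    have "(\<Sum>n. ennreal ((1/2) ^ n / 4)) = ennreal (\<Sum>n. (1/2) ^ n / 4)"
      by (rule suminf_ennreal2[OF _ sums_summable[OF s]]) simp
    also have "(\<Sum>n. (1/2::real) ^ n / 4) = 1/2" by (rule sums_unique[OF s, symmetric])
    finally show ?thesis .
  qed
  have e2: "emeasure lborel (\<Union>n. bad n) \<le> (\<Sum>n. emeasure lborel (bad n))"
    by (rule emeasure_subadditive_countably) (use bs in auto)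
  have e3: "(\<Sum>n. emeasure lborel (bad n)) \<le> (\<Sum>n. ennreal ((1/2) ^ n / 4))"
    by (rule suminf_le[OF mbad]) auto
  have half: "emeasure lborel (\<Union>n. bad n) \<le> ennreal (1/2)"
    by (rule order_trans[OF e2 e3[unfolded e1]])
  have "1 = emeasure lborel (cbox 0 (1::real^'n))"
  proof -
    have "measure lborel (cbox 0 (1::real^'n)) = 1"
      by (subst content_cbox_cart) (auto simp: interval_ne_empty_cart)
    then show ?thesis by (subst emeasure_eq_ennreal_measure) (auto simp: emeasure_lborel_cbox_eq)
  qed
  also have "\<dots> \<le> emeasure lborel (spike_free i \<union> (\<Union>n. bad n))"
    using bs borel_compact[OF compact_spike_free[of i]] by (intro emeasure_mono cover) auto
  also have "\<dots> \<le> emeasure lborel (spike_free i :: (real^'n) set) + emeasure lborel (\<Union>n. bad n)"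
    using bs borel_compact[OF compact_spike_free[of i]] by (intro emeasure_subadditive) auto
  also have "\<dots> \<le> ennreal (1/2)" using s0 half by simp
  finally have "ennreal 1 \<le> ennreal (1/2)" by (simp only: ennreal_1)
  then show False by (subst (asm) ennreal_le_iff) auto
qed

lemma legendre:
  fixes i j :: "'n::finite"
  assumes "i \<noteq> j"
  shows "\<exists>C c. partial_legendre i j w wp wy wpp wpy wpy wyy M C c (spike_free i)"
proof -
  obtain c D where c: "c > 0" "\<And>y. \<eta> y \<ge> c * \<bar>y\<bar> - D" using \<eta>_growth by blast
  \<comment> \<open>The constant adds the loss \<open>D\<close> from the growth of
    \<open>\<eta>\<close> to the bound 2 for the series of \<open>t n\<close>.\<close>
  have "partial_legendre i j w wp wy wpp wpy wpy wyy M (D + 2) c (spike_free i)"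
  proof
    show "i \<noteq> j" by (rule assms)
    show "wpp z \<ge> 0" for z using wpp_ge_R[of z] R_nonneg[of "snd z"] by linarith
    show "wyy z \<le> 0" for z using tyy_sum[of z] by (simp add: wyy_def)
    show "- wyy z \<le> wpp z" for z using tyy_sum[of z] wpp_ge_R[of z] by (simp add: wyy_def)
    show "w (p, y) \<le> M / 2 * p\<^sup>2 + (D + 2) - c * \<bar>y\<bar>" for p y
      using sum_half_le[of "\<lambda>n. t n (p, y)", OF t_bounds(1)] c(2)[of y] by (simp add: w_def)
    show "wpp (P $ i, P $ j) = 0" if P: "P \<in> spike_free i" for P
    proof -
      have "(P $ j)\<^sup>2 \<le> 1" using P by (auto simp: spike_free_def mem_box_cart power_le_one)
      then show ?thesis unfolding wpp_eq using P by (simp add: spike_free_def \<psi>)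
    qed
    show "compact (spike_free i)" by (rule compact_spike_free)
    show "\<not> negligible (spike_free i)" by (rule not_negligible_spike_free)
  qed (use w_derivs wpp_continuous wyy_continuous wp_strict wp_onto M_pos c in auto)
  then show ?thesis by blast
qed

end

section \<open>Choice of the parameters\<close>

lemma spike_data_exists: "\<exists>B \<delta> N \<beta> k k1 \<theta> \<theta>1 \<theta>2 K. spike_data B \<delta> N \<beta> k k1 \<theta> \<theta>1 \<theta>2 K"
proof -
  obtain \<theta> \<theta>1 \<theta>2 :: "real \<Rightarrow> real" and K where th:
    "\<And>s. (\<theta> has_real_derivative \<theta>1 s) (at s)" "\<And>s. (\<theta>1 has_real_derivative \<theta>2 s) (at s)"
    "continuous_on UNIV \<theta>2"
    "\<And>s. 0 \<le> \<theta> s" "\<And>s. \<theta> s \<le> 1" "\<And>s. s \<le> 1/2 \<Longrightarrow> \<theta> s = 1" "\<And>s. s \<ge> 1 \<Longrightarrow> \<theta> s = 0"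
    "\<And>s. s \<le> 1/2 \<or> s \<ge> 1 \<Longrightarrow> \<theta>1 s = 0 \<and> \<theta>2 s = 0"
    "K \<ge> 1" "\<And>s. \<bar>\<theta>1 s\<bar> \<le> K" "\<And>s. \<bar>\<theta>2 s\<bar> \<le> K"
    by (rule cutoff_exists, rule that)
  define P where "P n B \<delta> N \<beta> k k1 \<longleftrightarrow> N \<ge> 1 \<and> (\<forall>x. (k has_real_derivative k1 x) (at x)) \<and>
    (\<forall>x. (k1 has_real_derivative \<beta> x - 1) (at x)) \<and> continuous_on UNIV \<beta> \<and>
    (\<forall>x. 0 \<le> \<beta> x \<and> \<beta> x \<le> B) \<and> (\<forall>x. \<bar>k x\<bar> \<le> \<delta> \<and> \<bar>k1 x\<bar> \<le> \<delta>) \<and>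
    (\<forall>x y. y - x > \<delta> \<longrightarrow> (\<exists>z. x < z \<and> z < y \<and> \<beta> z > 0)) \<and>
    (\<forall>x. \<beta> x > 0 \<longrightarrow> (\<exists>m::int. \<bar>x - m / N\<bar> < (1/2) ^ n / 16 / N))"
    for n :: nat and B \<delta> :: real and N :: nat and \<beta> k k1 :: "real \<Rightarrow> real"
  have "\<forall>n. \<exists>B\<ge>1. \<forall>\<delta>>0. \<exists>N \<beta> k k1. P n B \<delta> N \<beta> k k1"
  proof
    fix n :: nat
    have "(1/2::real) ^ n \<le> 1" by (simp add: power_le_one)
    then show "\<exists>B\<ge>1. \<forall>\<delta>>0. \<exists>N \<beta> k k1. P n B \<delta> N \<beta> k k1"
      using scaled_spikes[of "(1/2) ^ n / 16"] unfolding P_def by simp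
  qed
  then obtain B where B: "\<And>n. B n \<ge> 1" "\<And>n. \<forall>\<delta>>0. \<exists>N \<beta> k k1. P n (B n) \<delta> N \<beta> k k1" by metis
  \<comment> \<open>The last bound refers to the height at the next scale. There is no circularity:
    all heights are fixed by the relative widths before any frequency \<open>N n\<close> is
    chosen.\<close>
  define \<delta> where "\<delta> n = min ((1/2) ^ n) (min (1 / (16 * K * 4 ^ n)) ((1/2) ^ Suc n / B (Suc n) / 2 / (16 * K * 4 ^ n)))" for n
  have A: "16 * K * 4 ^ n > 0" for n using th(9) by simp
  have canc: "a * (x / a) = x" if "a > 0" for a x :: real using that by simp
  have Bpos: "B n > 0" for n using B(1)[of n] by linarith
  have \<delta>: "\<delta> n > 0" "\<delta> n \<le> (1/2) ^ n" "16 * K * 4 ^ n * \<delta> n \<le> 1"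
    "16 * K * 4 ^ n * \<delta> n \<le> (1/2) ^ Suc n / B (Suc n) / 2" for n
  proof -
    show "\<delta> n > 0" using A[of n] Bpos[of "Suc n"] by (simp add: \<delta>_def)
    show "\<delta> n \<le> (1/2) ^ n" by (simp add: \<delta>_def)
    have m: "16 * K * 4 ^ n * \<delta> n \<le> 16 * K * 4 ^ n * x" if "\<delta> n \<le> x" for x
      using that A[of n] by (intro mult_left_mono) auto
    have "16 * K * 4 ^ n * \<delta> n \<le> 16 * K * 4 ^ n * (1 / (16 * K * 4 ^ n))"
      by (rule m) (simp add: \<delta>_def)
    also have "\<dots> = 1" by (rule canc[OF A])
    finally show "16 * K * 4 ^ n * \<delta> n \<le> 1" .
    have "16 * K * 4 ^ n * \<delta> n \<le> 16 * K * 4 ^ n * ((1/2) ^ Suc n / B (Suc n) / 2 / (16 * K * 4 ^ n))"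
      by (rule m) (simp add: \<delta>_def)
    also have "\<dots> = (1/2) ^ Suc n / B (Suc n) / 2" by (rule canc[OF A])
    finally show "16 * K * 4 ^ n * \<delta> n \<le> (1/2) ^ Suc n / B (Suc n) / 2" .
  qed
  have "\<forall>n. \<exists>N \<beta> k k1. P n (B n) (\<delta> n) N \<beta> k k1" using B(2) \<delta>(1) by blast
  then obtain N \<beta> k k1 where Q: "\<And>n. P n (B n) (\<delta> n) (N n) (\<beta> n) (k n) (k1 n)" by metis
  have "spike_data B \<delta> N \<beta> k k1 \<theta> \<theta>1 \<theta>2 K"
    by (unfold_locales; (fact B th \<delta>)?) (use Q in \<open>auto simp: P_def\<close>)
  then show ?thesis by blast
qed

theorem theorem1p1:
  assumes "CARD('n::finite) \<ge> 2"
  shows "\<exists>(\<Omega> :: (real^'n) set) (\<rho> :: real^'n \<Rightarrow> real) (u :: real^'n \<Rightarrow> real).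
           open \<Omega> \<and> convex \<Omega> \<and> bounded \<Omega> \<and> \<Omega> \<noteq> {} \<and>
           \<rho> \<in> borel_measurable (lebesgue_on \<Omega>) \<and> (\<forall>x\<in>\<Omega>. 0 \<le> \<rho> x \<and> \<rho> x \<le> 1) \<and>
           convex_on \<Omega> u \<and> continuous_on (closure \<Omega>) u \<and>
           alexandrov_solution \<Omega> \<rho> u \<and> (\<forall>x\<in>frontier \<Omega>. u x = 0) \<and>
           \<not> W21_loc \<Omega> u"
proof -
  have "\<exists>i j :: 'n. i \<noteq> j"
    using assms card_le_Suc0_iff_eq[of "UNIV :: 'n set"] by force
  then obtain i j :: 'n where ij: "i \<noteq> j" by blast
  obtain B \<delta> N \<beta> k k1 \<theta> \<theta>1 \<theta>2 K where "spike_data B \<delta> N \<beta> k k1 \<theta> \<theta>1 \<theta>2 K"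
    using spike_data_exists by blast
  then interpret spike_data B \<delta> N \<beta> k k1 \<theta> \<theta>1 \<theta>2 K .
  obtain C c where "partial_legendre i j w wp wy wpp wpy wpy wyy M C c (spike_free i)"
    using legendre[OF ij] by blast
  then interpret L: partial_legendre i j w wp wy wpp wpy wpy wyy M C c "spike_free i" .
  show ?thesis using L.counterexample by blast
qed

end
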